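(* Consider a trajectory of the simplified drift-flux model, with topside measurement $Y(t)$, sampling instants $t_k=k\theta$, and Algorithm 1 (observer), all described in the context. Assume the measurement $Y(t)$ is Lipschitz-continuous for all $t$. There exist $K\in\mathbb{N}$ and constants $\delta_3>0$ and $\delta_3'>0$ such that if $$\|\tilde Y(t)\|\le\delta_3\quad\text{and}\quad\Big\|\tfrac{\partial}{\partial t}\tilde Y(t)\Big\|\le\delta_3'\qquad\text{for all }t\in[0,\infty),$$ then the state estimate obtained by Algorithm 1 is equal to the actual state at all times $t_k$ with $k\ge K$.
   Context: **Parameters.** $L,A,D,f,g,c_L,c_G,\rho_{L,0},C_0,v_\infty,k_G,p_{\mathrm{res}},p_{\mathrm{ref}},W^{L,inj},\theta$ are positive constants and $\phi$ is the inclination angle of the well (from vertical). $\theta$ is the sampling period, $t_k=k\theta$, $k\in\mathbb{N}$. **Algebraic relations.** For a triple $(\bar\alpha_G,\bar p,\bar v_G)$ with $\bar p>0$ set $\bar\rho_L=\rho_{L,0}+\bar p/c_L^2$, $\bar\rho_G=\bar p/c_G^2$, $\bar\rho=\bar\alpha_G\bar\rho_G+(1-\bar\alpha_G)\bar\rho_L$, $\bar v_L=(\bar v_G-v_\infty)/C_0$, $\bar v_m=(1-\bar\alpha_G)\bar v_L+\bar\alpha_G\bar v_G$, $\bar G=\bar\rho g\cos\phi$, $\bar F=f\bar\rho\,\bar v_m|\bar v_m|/D$, and $$\frac{\partial\bar p}{\partial x}=-(\bar G+\bar F),\quad \frac{\partial\bar v_G}{\partial x}=-\frac{C_0\bar\alpha_G\bar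 v_G}{\bar p}\frac{\partial\bar p}{\partial x},\quad \bar E_G=-\frac{\bar\alpha_G(1-C_0\bar\alpha_G)\bar v_G}{\bar p}\frac{\partial\bar p}{\partial x}.$$ **Inflow relation.** Given a bottomhole pressure $q>0$, let $(\alpha,v)$ with $\alpha\in[0,1)$, $v>v_\infty$, solve $\alpha v=\dfrac{k_G\max(0,p_{\mathrm{res}}-q)}{A\,\bar\rho_G(q)}$ and $(1-\alpha)\dfrac{v-v_\infty}{C_0}=\dfrac{W^{L,inj}}{A\,\bar\rho_L(q)}$; write $\alpha=\bar\alpha_G^{\mathrm{inflow}}(q)$. **Simplified drift-flux model (the actual system).** Unknowns $\bar\alpha_G,\bar p,\bar v_G$ on $x\in[0,L]$ ($x=0$ well bottom, $x=L$ top), $t\ge0$, satisfying $$\frac{\partial\bar\alpha_G}{\partial t}+\bar v_G\frac{\partial\bar\alpha_G}{\partial x}=\bar E_G,\quad \bar p(x,t)=\bar p(L,t)+\int_x^L(\bar G+\bar F)(\xi,t)\,d\xi,\quad \bar v_G(x,t)=\bar v_G(0,t)+\int_0^x\frac{\partial\bar v_G}{\partial\xi}(\xi,t)\,d\xi,$$ with $\bar p(L,t)=p^{\mathrm{top}}(t)$ (the topside pressure input) and with $(\bar\alpha_G(0,t),\bar v_G(0,t))$ given by the inflow relation for $q=\bar p(0,t)$. "Solution"/"trajectory" means Lipschitz-continuous broad solution: $\bar\alpha_G,\bar p,\bar v_G$ are Lipschitz in $(x,t)$, the transport equation holds a.e. (equivalently, in integrated form along characteristic lines $dx/dt=\bar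 v_G$), and the remaining equations hold pointwise. The actual state at time $t$ is $X(\cdot,t)$ with $X=(\bar\alpha_G,\bar p,\bar v_G)^T$, and the topside measurement is $Y(t)=X(L,t)$. **Notation.** Let $\bar p_0,\bar v_{G,0}$ be the steady-state pressure and velocity profiles for zero gas concentration with $\bar p_0(0)=p_{\mathrm{ref}}$ (assumed to satisfy $\bar p_0>0$ on $[0,L]$), i.e. $\bar v_{G,0}\equiv v_\infty+C_0W^{L,inj}/(A\bar\rho_L(p_{\mathrm{ref}}))$ and $\bar p_0'=-(\bar G+\bar F)$ evaluated at $\bar\alpha_G=0$, $\bar p=\bar p_0$, $\bar v_G=\bar v_{G,0}$. Put $\tilde X=(\bar\alpha_G,\ \bar p-\bar p_0,\ \bar v_G-\bar v_{G,0})^T$ and $\tilde Y(t)=\tilde X(L,t)$. $\|\cdot\|$ is the Euclidean norm on $\mathbb{R}^3$; bounds on derivatives of Lipschitz functions are understood almost everywhere. The characteristic line ending at $(L,t)$ is $\tau(t;x)=t-\int_x^L\frac{d\xi}{\bar v_G(\xi,\tau(t;\xi))}$, and $\tau_k^{\mathrm{inv}}$ is the inverse of $x\mapsto\tau(t_k;x)$. **Algorithm 1 (observer at time $t_k$).** Input: $Y(s)$, $s\in[t_k-H,t_k]$, with a horizon $H\ge t_k-\tau(t_k;0)$ (and $H\le t_k$). Step 1: on $\mathcal A(t_k)=\{(x,t):x\in[0,L],\ t\in[t_k-H,\tau(t_k;x)]\}$ solve, in the negative $x$-direction, $\frac{\partial\bar\alpha_G}{\partial x}=\frac1{\bar v_G}\big(\bar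 E_G-\frac{\partial\bar\alpha_G}{\partial t}\big)$, $\bar p(x,t)=\bar p(L,t)+\int_x^L(\bar G+\bar F)d\xi$, $\bar v_G(x,t)=\bar v_G(L,t)-\int_x^L\frac{\partial\bar v_G}{\partial\xi}d\xi$, with $(\bar\alpha_G,\bar p,\bar v_G)(L,t)=Y(t)$. Step 2: on $\mathcal B(t_k)=\{(x,t):x\in[0,L],\ t\in[\tau(t_k;x),t_k]\}$ solve, forward in time and starting from the values of step 1 on the line $(x,\tau(t_k;x))$, $\frac{\partial\bar\alpha_G}{\partial t}+\bar v_G\frac{\partial\bar\alpha_G}{\partial x}=\bar E_G$, $\bar\alpha_G(0,t)=\bar\alpha_G^{\mathrm{inflow}}(\bar p(0,t))$, $\bar p(x,t)=\bar p(\tau_k^{\mathrm{inv}}(t),t)+\int_x^{\tau_k^{\mathrm{inv}}(t)}(\bar G+\bar F)d\xi$, $\bar v_G(x,t)=\bar v_G(\tau_k^{\mathrm{inv}}(t),t)-\int_x^{\tau_k^{\mathrm{inv}}(t)}\frac{\partial\bar v_G}{\partial\xi}d\xi$. In both steps $\tau$ is computed with the velocity being solved for. Output (state estimate): the values $(\bar\alpha_G,\bar p,\bar v_G)(\cdot,t_k)$ of the step-2 solution. *)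

theory Defs
  imports "HOL-Analysis.Analysis"
begin

section \<open>Parameters and algebraic relations\<close>

record well =
  len :: real          \<comment> \<open>well length, \<open>L\<close>\<close>
  area :: real         \<comment> \<open>cross-section, \<open>A\<close>\<close>
  diam :: real         \<comment> \<open>diameter, \<open>D\<close>\<close>
  fric_coeff :: real   \<comment> \<open>friction factor, \<open>f\<close>\<close>
  grav_acc :: real     \<comment> \<open>gravitational acceleration, \<open>g\<close>\<close>
  incl :: real         \<comment> \<open>inclination from vertical; carries no sign condition\<close>
  c_liq :: real        \<comment> \<open>sound speed in liquid, \<open>c\<^sub>L\<close>\<close>
  c_gas :: real        \<comment> \<open>sound speed in gas, \<open>c\<^sub>G\<close>\<close>
  rho_L0 :: real       \<comment> \<open>reference liquid density\<close>
  slip :: real         \<comment> \<open>slip coefficient \<open>C\<^sub>0\<close>\<close>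
  v_inf :: real        \<comment> \<open>drift velocity\<close>
  k_G :: real          \<comment> \<open>gas production index\<close>
  p_res :: real        \<comment> \<open>reservoir pressure\<close>
  p_ref :: real        \<comment> \<open>reference bottomhole pressure\<close>
  W_inj :: real        \<comment> \<open>liquid injection mass rate\<close>
  period :: real       \<comment> \<open>sampling period\<close>

definition positive_parameters :: "well \<Rightarrow> bool" where
  "positive_parameters P \<longleftrightarrow>
     0 < len P \<and> 0 < area P \<and> 0 < diam P \<and> 0 < fric_coeff P \<and> 0 < grav_acc P \<and>
     0 < c_liq P \<and> 0 < c_gas P \<and> 0 < rho_L0 P \<and> 0 < slip P \<and> 0 < v_inf P \<and>
     0 < k_G P \<and> 0 < p_res P \<and> 0 < p_ref P \<and> 0 < W_inj P \<and> 0 < period P"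

text \<open>A state is a triple (gas fraction, pressure, gas velocity). The product norm on it is the
  Euclidean norm.\<close>

type_synonym state = "real \<times> real \<times> real"

abbreviation gas_frac :: "state \<Rightarrow> real" where "gas_frac \<equiv> \<lambda>(a, q, w). a"
abbreviation pres :: "state \<Rightarrow> real" where "pres \<equiv> \<lambda>(a, q, w). q"
abbreviation gas_vel :: "state \<Rightarrow> real" where "gas_vel \<equiv> \<lambda>(a, q, w). w"

definition rho_L :: "well \<Rightarrow> real \<Rightarrow> real" where
  "rho_L P q = rho_L0 P + q / (c_liq P)\<^sup>2"

definition rho_G :: "well \<Rightarrow> real \<Rightarrow> real" where
  "rho_G P q = q / (c_gas P)\<^sup>2"

fun rho_mix :: "well \<Rightarrow> state \<Rightarrow> real" where
  "rho_mix P (a, q, w) = a * rho_G P q + (1 - a) * rho_L P q"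

definition liq_vel :: "well \<Rightarrow> real \<Rightarrow> real" where
  "liq_vel P w = (w - v_inf P) / slip P"

fun mix_vel :: "well \<Rightarrow> state \<Rightarrow> real" where
  "mix_vel P (a, q, w) = (1 - a) * liq_vel P w + a * w"

definition grav_term :: "well \<Rightarrow> state \<Rightarrow> real" where
  "grav_term P s = rho_mix P s * grav_acc P * cos (incl P)"

definition fric_term :: "well \<Rightarrow> state \<Rightarrow> real" where
  "fric_term P s = fric_coeff P * rho_mix P s * mix_vel P s * \<bar>mix_vel P s\<bar> / diam P"

definition dp_dx :: "well \<Rightarrow> state \<Rightarrow> real" where
  "dp_dx P s = - (grav_term P s + fric_term P s)"

fun dv_dx :: "well \<Rightarrow> state \<Rightarrow> real" where
  "dv_dx P (a, q, w) = - (slip P * a * w / q) * dp_dx P (a, q, w)"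

fun E_G :: "well \<Rightarrow> state \<Rightarrow> real" where
  "E_G P (a, q, w) = - (a * (1 - slip P * a) * w / q) * dp_dx P (a, q, w)"

section \<open>Inflow relation\<close>

definition inflow :: "well \<Rightarrow> real \<Rightarrow> real \<Rightarrow> real \<Rightarrow> bool" where
  "inflow P q a w \<longleftrightarrow>
     0 \<le> a \<and> a < 1 \<and> v_inf P < w \<and>
     a * w = k_G P * max 0 (p_res P - q) / (area P * rho_G P q) \<and>
     (1 - a) * ((w - v_inf P) / slip P) = W_inj P / (area P * rho_L P q)"

text \<open>For positive parameters and \<open>q > 0\<close> the pair solving the inflow relation is unique.\<close>

definition inflow_gas_frac :: "well \<Rightarrow> real \<Rightarrow> real" where
  "inflow_gas_frac P q = (THE a. \<exists>w. inflow P q a w)"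

section \<open>Broad solutions\<close>

text \<open>Fields are functions of \<open>x\<close> and then \<open>t\<close>. The transport equation
  \<open>\<partial>\<^sub>t \<alpha> + v \<partial>\<^sub>x \<alpha> = E\<^sub>G\<close> on a set \<open>S\<close> of points \<open>(x, t)\<close> is imposed in integrated form along every
  characteristic \<open>dx/dt = v\<close> that runs inside \<open>S\<close>; where \<open>v > 0\<close> this is also the integrated form of
  \<open>\<partial>\<^sub>x \<alpha> = (E\<^sub>G - \<partial>\<^sub>t \<alpha>) / v\<close>.\<close>

definition broad_transport :: "well \<Rightarrow> (real \<times> real) set \<Rightarrow> (real \<Rightarrow> real \<Rightarrow> state) \<Rightarrow> bool" where
  "broad_transport P S X \<longleftrightarrow>
     (\<forall>a b c. a \<le> b \<and>
        (\<forall>s\<in>{a..b}. (c s, s) \<in> S \<and>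
           (c has_real_derivative gas_vel (X (c s) s)) (at s within {a..b})) \<longrightarrow>
        ((\<lambda>s. E_G P (X (c s) s)) has_integral
           (gas_frac (X (c b) b) - gas_frac (X (c a) a))) {a..b})"

definition lipschitz_field :: "(real \<times> real) set \<Rightarrow> (real \<Rightarrow> real \<Rightarrow> state) \<Rightarrow> bool" where
  "lipschitz_field S X \<longleftrightarrow> (\<exists>M. M-lipschitz_on S (\<lambda>(x, t). X x t))"

definition trajectory :: "well \<Rightarrow> (real \<Rightarrow> real) \<Rightarrow> (real \<Rightarrow> real \<Rightarrow> state) \<Rightarrow> bool" where
  "trajectory P ptop X \<longleftrightarrow>
     lipschitz_field ({0..len P} \<times> {0..}) X \<and>
     broad_transport P ({0..len P} \<times> {0..}) X \<and>
     (\<forall>t\<ge>0.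
        pres (X (len P) t) = ptop t \<and>
        inflow P (pres (X 0 t)) (gas_frac (X 0 t)) (gas_vel (X 0 t)) \<and>
        (\<forall>x\<in>{0..len P}.
           0 < pres (X x t) \<and>
           pres (X x t) = pres (X (len P) t)
             + integral {x..len P} (\<lambda>\<xi>. grav_term P (X \<xi> t) + fric_term P (X \<xi> t)) \<and>
           gas_vel (X x t) = gas_vel (X 0 t) + integral {0..x} (\<lambda>\<xi>. dv_dx P (X \<xi> t))))"

section \<open>Zero-gas steady state\<close>

definition steady_vel :: "well \<Rightarrow> real" where
  "steady_vel P = v_inf P + slip P * W_inj P / (area P * rho_L P (p_ref P))"

definition steady_pressure :: "well \<Rightarrow> (real \<Rightarrow> real) \<Rightarrow> bool" where
  "steady_pressure P p0 \<longleftrightarrow>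
     p0 0 = p_ref P \<and>
     (\<forall>x\<in>{0..len P}.
        (p0 has_real_derivative dp_dx P (0, p0 x, steady_vel P)) (at x within {0..len P}))"

definition deviation :: "well \<Rightarrow> (real \<Rightarrow> real) \<Rightarrow> (real \<Rightarrow> real \<Rightarrow> state) \<Rightarrow> real \<Rightarrow> real \<Rightarrow> state" where
  "deviation P p0 X x t = X x t - (0, p0 x, steady_vel P)"

section \<open>The observer\<close>

text \<open>The line \<open>x \<mapsto> (x, \<tau> x)\<close> is the characteristic of the field \<open>X\<close> that ends at \<open>(L, t)\<close>.\<close>

definition characteristic_line :: "well \<Rightarrow> (real \<Rightarrow> real \<Rightarrow> state) \<Rightarrow> real \<Rightarrow> (real \<Rightarrow> real) \<Rightarrow> bool" where
  "characteristic_line P X t \<tau> \<longleftrightarrow>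
     (\<forall>x\<in>{0..len P}.
        0 < gas_vel (X x (\<tau> x)) \<and>
        ((\<lambda>\<xi>. 1 / gas_vel (X \<xi> (\<tau> \<xi>))) has_integral (t - \<tau> x)) {x..len P})"

definition admissible_horizon :: "real \<Rightarrow> (real \<Rightarrow> real) \<Rightarrow> real \<Rightarrow> bool" where
  "admissible_horizon t \<tau> H \<longleftrightarrow> t - \<tau> 0 \<le> H \<and> H \<le> t"

definition region_A :: "well \<Rightarrow> real \<Rightarrow> real \<Rightarrow> (real \<Rightarrow> real) \<Rightarrow> (real \<times> real) set" where
  "region_A P t H \<tau> = {(x, s). x \<in> {0..len P} \<and> t - H \<le> s \<and> s \<le> \<tau> x}"

definition region_B :: "well \<Rightarrow> real \<Rightarrow> (real \<Rightarrow> real) \<Rightarrow> (real \<times> real) set" where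
  "region_B P t \<tau> = {(x, s). x \<in> {0..len P} \<and> \<tau> x \<le> s \<and> s \<le> t}"

definition step1 ::
  "well \<Rightarrow> (real \<Rightarrow> state) \<Rightarrow> real \<Rightarrow> real \<Rightarrow> (real \<Rightarrow> real) \<Rightarrow> (real \<Rightarrow> real \<Rightarrow> state) \<Rightarrow> bool" where
  "step1 P Y t H \<tau> X \<longleftrightarrow>
     characteristic_line P X t \<tau> \<and>
     admissible_horizon t \<tau> H \<and>
     lipschitz_field (region_A P t H \<tau>) X \<and>
     broad_transport P (region_A P t H \<tau>) X \<and>
     (\<forall>s\<in>{t - H..t}. X (len P) s = Y s) \<and>
     (\<forall>(x, s)\<in>region_A P t H \<tau>.
        0 < pres (X x s) \<and> 0 < gas_vel (X x s) \<and>
        pres (X x s) = pres (X (len P) s)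
          + integral {x..len P} (\<lambda>\<xi>. grav_term P (X \<xi> s) + fric_term P (X \<xi> s)) \<and>
        gas_vel (X x s) = gas_vel (X (len P) s)
          - integral {x..len P} (\<lambda>\<xi>. dv_dx P (X \<xi> s)))"

text \<open>Since \<open>X2\<close> takes the values of \<open>X1\<close> on the line \<open>\<tau>\<close>, this line is a characteristic of
  \<open>X2\<close> as well.\<close>

definition step2 ::
  "well \<Rightarrow> real \<Rightarrow> (real \<Rightarrow> real) \<Rightarrow> (real \<Rightarrow> real \<Rightarrow> state) \<Rightarrow> (real \<Rightarrow> real \<Rightarrow> state) \<Rightarrow> bool" where
  "step2 P t \<tau> X1 X2 \<longleftrightarrow>
     lipschitz_field (region_B P t \<tau>) X2 \<and>
     broad_transport P (region_B P t \<tau>) X2 \<and>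
     (\<forall>x\<in>{0..len P}. X2 x (\<tau> x) = X1 x (\<tau> x)) \<and>
     (\<forall>s\<in>{\<tau> 0..t}. gas_frac (X2 0 s) = inflow_gas_frac P (pres (X2 0 s))) \<and>
     (\<forall>(x, s)\<in>region_B P t \<tau>.
        let z = the_inv_into {0..len P} \<tau> s in
        0 < pres (X2 x s) \<and> 0 < gas_vel (X2 x s) \<and>
        pres (X2 x s) = pres (X2 z s)
          + integral {x..z} (\<lambda>\<xi>. grav_term P (X2 \<xi> s) + fric_term P (X2 \<xi> s)) \<and>
        gas_vel (X2 x s) = gas_vel (X2 z s) - integral {x..z} (\<lambda>\<xi>. dv_dx P (X2 \<xi> s)))"

text \<open>\<open>observer_output P Y t H Xhat\<close>: the profile \<open>Xhat\<close> is a state estimate that the observer, run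
  at time \<open>t\<close> on the measurements \<open>Y s\<close> with \<open>s \<in> [t - H, t]\<close>, returns.\<close>

definition observer_output ::
  "well \<Rightarrow> (real \<Rightarrow> state) \<Rightarrow> real \<Rightarrow> real \<Rightarrow> (real \<Rightarrow> state) \<Rightarrow> bool" where
  "observer_output P Y t H Xhat \<longleftrightarrow>
     (\<exists>\<tau> X1 X2. step1 P Y t H \<tau> X1 \<and> step2 P t \<tau> X1 X2 \<and> (\<forall>x\<in>{0..len P}. Xhat x = X2 x t))"

text \<open>The observer succeeds at time \<open>t\<close>: some horizon is long enough for the actual
  characteristic line, the observer returns an estimate for each such horizon, and every estimate it
  can return is the actual state.\<close>

definition observer_exact :: "well \<Rightarrow> (real \<Rightarrow> real \<Rightarrow> state) \<Rightarrow> real \<Rightarrow> bool" where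
  "observer_exact P X t \<longleftrightarrow>
     (\<exists>\<tau> H. characteristic_line P X t \<tau> \<and> admissible_horizon t \<tau> H) \<and>
     (\<forall>\<tau> H. characteristic_line P X t \<tau> \<and> admissible_horizon t \<tau> H \<longrightarrow>
        (\<exists>Xhat. observer_output P (X (len P)) t H Xhat)) \<and>
     (\<forall>H Xhat. observer_output P (X (len P)) t H Xhat \<longrightarrow> (\<forall>x\<in>{0..len P}. Xhat x = X x t))"

end

theory Submission
  imports Defs
begin

text \<open>
  All equations are read in the \<open>x\<close>-direction, with characteristics parametrised as \<open>t = \<sigma> x\<close>,
  \<open>\<sigma>' = 1 / v\<close>. In a field confined to a box of states on which the source terms are Lipschitz, the
  difference of two gas fractions along a characteristic is bounded by the integral of the state
  difference, and pressure and velocity differences are bounded by integrals over \<open>x\<close> at fixed time.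
  Suitable exponential weights turn these bounds into contractions, with three consequences.

  First, the actual trajectory is compared with the zero-gas steady state, descending from the
  top in short steps: a small topside deviation keeps the whole trajectory close to the steady state,
  so that the velocity has a uniform positive lower bound \<open>v\<close> and every characteristic
  crosses the well within time \<open>L / v\<close>. Second, data at the top determine the solution below the
  characteristic ending at \<open>(L, t)\<close>, which is uniqueness for step 1. Third, data on this
  characteristic and the inflow relation determine the solution above it, which is uniqueness
  for step 2. Since the trajectory itself solves both steps, it is the only possible output.
\<close>

section \<open>Scalar differential equations\<close>

text \<open>A Gronwall argument in one variable does not fit the full system: gas fractions are
  coupled along characteristics, pressures and velocities along horizontal lines, so the deviation
  at a point depends on its values on two different curves. Its weighted supremum over a whole
  region is estimated instead, and each time a crude a priori bound is needed to make this supremum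
  finite. The source terms are Lipschitz only on a box of states, while membership in the box is
  what the comparison with the steady state must prove. The circle is broken by descending in steps
  so short that the Lipschitz constant \<open>M\<close> of the trajectory cannot carry it out of the
  box; the stability estimate then restores a bound of half the size. The step length depends on
  \<open>M\<close>, but the threshold \<delta> does not: the comparison field there is constant in
  time, so all constants come from the well and \<open>p0\<close>. This makes \<delta> and
  \<open>K\<close> uniform over all trajectories. For uniqueness the constants may depend on the
  fields, because the deviation is shown to vanish.\<close>

lemma has_integral_exp_affine:
  fixes m c x y :: real
  assumes "x \<le> y" "m \<noteq> 0"
  shows "((\<lambda>\<xi>. exp (m * \<xi> + c)) has_integral (exp (m * y + c) - exp (m * x + c)) / m) {x..y}"
proof -
  have "((\<lambda>\<xi>. exp (m * \<xi> + c)) has_integral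
     (exp (m * y + c) / m - exp (m * x + c) / m)) {x..y}"
    using assms
    by (intro fundamental_theorem_of_calculus)
      (auto intro!: derivative_eq_intros simp flip: has_real_derivative_iff_has_vector_derivative)
  then show ?thesis by (simp add: diff_divide_distrib)
qed

lemma derivative_bound_integral:
  fixes f f' g :: "real \<Rightarrow> real"
  assumes "a \<le> b"
    and "\<And>x. x \<in> {a..b} \<Longrightarrow> (f has_real_derivative f' x) (at x within {a..b})"
    and "\<And>x. x \<in> {a..b} \<Longrightarrow> \<bar>f' x\<bar> \<le> g x"
    and "g integrable_on {a..b}"
  shows "\<bar>f b - f a\<bar> \<le> integral {a..b} g"
proof -
  have "(f' has_integral f b - f a) {a..b}"
    using assms(1,2)
    by (intro fundamental_theorem_of_calculus)
      (auto simp flip: has_real_derivative_iff_has_vector_derivative)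
  then have i: "f' integrable_on {a..b}" and e: "integral {a..b} f' = f b - f a"
    by (auto simp: integral_unique)
  have "norm (integral {a..b} f') \<le> integral {a..b} g"
    using assms(3) by (intro integral_norm_bound_integral[OF i assms(4)]) auto
  then show ?thesis by (simp add: e)
qed

text \<open>Banach's fixed point theorem in a Bielecki norm. The unknown is the solution divided by
  \<open>exp (m * (x - a))\<close>; in this scaling the integral operator contracts on an interval
  of any length, so no local solutions have to be glued.\<close>

lemma picard:
  fixes F :: "real \<Rightarrow> real \<Rightarrow> real"
  assumes ab: "a \<le> b" and K: "0 \<le> K"
    and cont: "continuous_on ({a..b} \<times> UNIV) (\<lambda>(x, y). F x y)"
    and lip: "\<And>x y z. x \<in> {a..b} \<Longrightarrow> \<bar>F x y - F x z\<bar> \<le> K * \<bar>y - z\<bar>"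
  shows "\<exists>\<sigma>. \<sigma> a = y0 \<and>
    (\<forall>x\<in>{a..b}. (\<sigma> has_real_derivative F x (\<sigma> x)) (at x within {a..b}))"
proof -
  \<comment> \<open>Integrating the weight gains a factor \<open>1 / m\<close>, and
    \<open>K / m \<le> 1/2\<close>; the summand 1 keeps \<open>m\<close> positive when
    \<open>K = 0\<close>.\<close>
  define m where "m = 2 * K + 1"
  have m: "0 < m" using K by (simp add: m_def)
  \<comment> \<open>Bounded continuous functions live on the whole line here, so the iterates are
    extended constantly beyond both ends of the interval.\<close>
  define c where "c x = max a (min b x)" for x
  have c: "c x \<in> {a..b}" for x using ab by (auto simp: c_def)
  have c_id: "x \<in> {a..b} \<Longrightarrow> c x = x" for x by (auto simp: c_def)
  have c_cont: "continuous_on S c" for S unfolding c_def by (intro continuous_intros)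
  define h where "h g \<xi> = F \<xi> (exp (m * \<xi> + - m * a) * apply_bcontfun g \<xi>)" for g \<xi>
  have h_cont: "continuous_on {a..b} (h g)" for g
  proof -
    have "continuous_on {a..b} (\<lambda>\<xi>. (\<lambda>(x, y). F x y) (\<xi>, exp (m * \<xi> + - m * a) * apply_bcontfun g \<xi>))"
      by (rule continuous_on_compose2[OF cont])
        (auto intro!: continuous_intros continuous_on_subset[OF continuous_on_apply_bcontfun])
    then show ?thesis by (simp add: h_def)
  qed
  have h_int: "h g integrable_on {a..x}" if "x \<in> {a..b}" for g x
    using that by (intro integrable_continuous_interval continuous_on_subset[OF h_cont]) auto
  define T where "T g x = exp (- m * (c x - a)) * (y0 + integral {a..c x} (h g))" for g x
  have T0: "continuous_on {a..b} (\<lambda>x. exp (- m * (x - a)) * (y0 + integral {a..x} (h g)))" for g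
    by (intro continuous_intros indefinite_integral_continuous_1 integrable_continuous_interval h_cont)
  have T_cont: "continuous_on UNIV (T g)" for g
    unfolding T_def
    by (rule continuous_on_compose2[OF T0 c_cont]) (use c in auto)
  have T_b: "T g \<in> bcontfun" for g
  proof -
    have "range (T g) \<subseteq> (\<lambda>x. exp (- m * (x - a)) * (y0 + integral {a..x} (h g))) ` {a..b}"
      using c by (auto simp: T_def)
    moreover have "bounded ((\<lambda>x. exp (- m * (x - a)) * (y0 + integral {a..x} (h g))) ` {a..b})"
      by (intro compact_imp_bounded compact_continuous_image T0) auto
    ultimately show ?thesis
      using T_cont by (auto simp: bcontfun_def intro: bounded_subset)
  qed
  have "\<exists>!g. Bcontfun (T g) = g"
  proof (rule banach_fix_type[of "1/2"], simp, simp, intro allI)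
    fix f g :: "real \<Rightarrow>\<^sub>C real"
    show "dist (Bcontfun (T f)) (Bcontfun (T g)) \<le> 1/2 * dist f g"
    proof (rule dist_bound)
      fix x
      define d where "d = dist f g"
      have d: "0 \<le> d" by (simp add: d_def)
      have fg: "\<bar>apply_bcontfun f \<xi> - apply_bcontfun g \<xi>\<bar> \<le> d" for \<xi>
        using dist_bounded[of f \<xi> g] by (simp add: d_def dist_real_def)
      let ?e = "\<lambda>\<xi>. exp (m * \<xi> + - m * a)"
      note he = has_integral_exp_affine[of a "c x" m "- m * a"]
      have ac: "a \<le> c x" using c[of x] by auto
      have "\<bar>integral {a..c x} (h f) - integral {a..c x} (h g)\<bar> = norm (integral {a..c x} (\<lambda>\<xi>. h f \<xi> - h g \<xi>))"
        by (subst integral_diff) (auto intro!: h_int c)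
      also have "\<dots> \<le> integral {a..c x} (\<lambda>\<xi>. (K * d) * ?e \<xi>)"
      proof (rule integral_norm_bound_integral)
        show "(\<lambda>\<xi>. h f \<xi> - h g \<xi>) integrable_on {a..c x}"
          by (intro integrable_diff h_int c)
        show "(\<lambda>\<xi>. (K * d) * ?e \<xi>) integrable_on {a..c x}"
          by (intro integrable_continuous_interval continuous_intros)
        fix \<xi> assume "\<xi> \<in> {a..c x}"
        then have xi: "\<xi> \<in> {a..b}" using c[of x] by auto
        have "\<bar>h f \<xi> - h g \<xi>\<bar> \<le> K * \<bar>?e \<xi> * f \<xi> - ?e \<xi> * g \<xi>\<bar>"
          unfolding h_def by (rule lip[OF xi])
        also have "\<dots> = K * (?e \<xi> * \<bar>f \<xi> - g \<xi>\<bar>)"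
          by (simp flip: right_diff_distrib add: abs_mult)
        also have "\<dots> \<le> K * (?e \<xi> * d)" using fg K by (intro mult_left_mono) auto
        finally show "norm (h f \<xi> - h g \<xi>) \<le> (K * d) * ?e \<xi>" by (simp add: mult_ac)
      qed
      also have "\<dots> = (K * d) * ((?e (c x) - ?e a) / m)"
        using he[OF ac] m by (intro integral_unique has_integral_mult_right) auto
      also have "\<dots> \<le> (K * d) * (?e (c x) / m)"
        using K d m by (intro mult_left_mono divide_right_mono) auto
      also have "\<dots> = (K / m) * d * ?e (c x)" by simp
      also have "\<dots> \<le> (1/2) * d * ?e (c x)"
        using K d m by (intro mult_right_mono) (auto simp: m_def field_simps)
      finally have i: "\<bar>integral {a..c x} (h f) - integral {a..c x} (h g)\<bar> \<le> (1/2) * d * ?e (c x)" .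
      have "\<bar>T f x - T g x\<bar> = exp (- m * (c x - a)) * \<bar>integral {a..c x} (h f) - integral {a..c x} (h g)\<bar>"
        unfolding T_def by (simp flip: right_diff_distrib add: abs_mult)
      also have "\<dots> \<le> exp (- m * (c x - a)) * ((1/2) * d * ?e (c x))"
        using i by (intro mult_left_mono) auto
      also have "\<dots> = (1/2) * d * (exp (- m * (c x - a)) * ?e (c x))" by simp
      also have "exp (- m * (c x - a)) * ?e (c x) = 1"
        by (simp flip: exp_add add: algebra_simps)
      finally show "dist (Bcontfun (T f) x) (Bcontfun (T g) x) \<le> 1/2 * dist f g"
        by (simp add: Bcontfun_inverse[OF T_b] dist_real_def d_def)
    qed
  qed
  then obtain g where g: "Bcontfun (T g) = g" by auto
  have gT: "apply_bcontfun g x = T g x" for x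
    using Bcontfun_inverse[OF T_b, of g] g by simp
  define \<sigma> where "\<sigma> x = y0 + integral {a..x} (h g)" for x
  have s: "\<sigma> x = exp (m * x + - m * a) * apply_bcontfun g x" if "x \<in> {a..b}" for x
  proof -
    have "exp (m * x + - m * a) * apply_bcontfun g x = (exp (m * x + - m * a) * exp (- m * (x - a))) * \<sigma> x"
      unfolding gT T_def \<sigma>_def by (simp add: c_id[OF that])
    also have "exp (m * x + - m * a) * exp (- m * (x - a)) = 1"
      by (simp flip: exp_add add: algebra_simps)
    finally show ?thesis by simp
  qed
  show ?thesis
  proof (intro exI[of _ \<sigma>] conjI ballI)
    show "\<sigma> a = y0" by (simp add: \<sigma>_def)
    fix x assume x: "x \<in> {a..b}"
    have "((\<lambda>u. integral {a..u} (h g)) has_real_derivative h g x) (at x within {a..b})"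
      by (rule integral_has_real_derivative[OF h_cont x])
    then have "(\<sigma> has_real_derivative h g x) (at x within {a..b})"
      unfolding \<sigma>_def by (auto intro!: derivative_eq_intros)
    also have "h g x = F x (\<sigma> x)" by (simp add: h_def s[OF x])
    finally show "(\<sigma> has_real_derivative F x (\<sigma> x)) (at x within {a..b})" .
  qed
qed

text \<open>Should \<open>w y\<close> be positive, take the last point \<open>z < y\<close> with
  \<open>w z \<le> 0\<close>. From there to \<open>y\<close> the function is positive, hence its
  derivative nonpositive, and the mean value theorem contradicts
  \<open>w z \<le> 0 < w y\<close>.\<close>

lemma nonpos_of_derivative_nonpos_where_pos:
  fixes w w' :: "real \<Rightarrow> real"
  assumes "\<And>x. x \<in> {a..b} \<Longrightarrow> (w has_real_derivative w' x) (at x within {a..b})"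
    and "w a \<le> 0" and "\<And>x. x \<in> {a..b} \<Longrightarrow> 0 < w x \<Longrightarrow> w' x \<le> 0"
    and y: "y \<in> {a..b}"
  shows "w y \<le> 0"
proof (rule ccontr)
  assume neg: "\<not> w y \<le> 0"
  have cont: "continuous_on {a..b} w"
    using assms(1) by (meson DERIV_continuous_on)
  define Z where "Z = {x \<in> {a..y}. w x \<le> 0}"
  have cy: "continuous_on {a..y} w" using cont y by (auto intro: continuous_on_subset)
  have "closed Z" unfolding Z_def
    by (rule continuous_on_closed_Collect_le[OF cy]) auto
  moreover have "bounded Z" unfolding Z_def by (rule bounded_subset[of "{a..y}"]) auto
  ultimately have "compact Z" by (simp add: compact_eq_bounded_closed)
  moreover have "a \<in> Z" using y assms(2) by (auto simp: Z_def)
  ultimately obtain z where z: "z \<in> Z" and zmax: "\<And>x. x \<in> Z \<Longrightarrow> x \<le> z"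
    using compact_attains_sup[of Z] by blast
  have zy: "z < y" "a \<le> z" using z neg by (auto simp: Z_def order.order_iff_strict)
  have pos: "0 < w x" if "z < x" "x \<le> y" for x
    using zmax[of x] that zy by (fastforce simp: Z_def)
  have der: "(w has_real_derivative w' u) (at u)" if "z < u" "u < y" for u
    using assms(1)[of u] that zy y at_within_Icc_at[of a u b] by auto
  have "\<exists>l u. z < u \<and> u < y \<and> (w has_real_derivative l) (at u) \<and> w y - w z = (y - z) * l"
    by (rule MVT[OF zy(1)])
      (use der zy y in \<open>auto intro: continuous_on_subset[OF cont] simp: real_differentiable_def\<close>)
  then obtain l u where lu: "z < u" "u < y" "(w has_real_derivative l) (at u)"
      "w y - w z = (y - z) * l"
    by auto
  have "l = w' u" using DERIV_unique[OF lu(3) der] lu by auto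
  with lu have "\<exists>u>z. u < y \<and> w y - w z = (y - z) * w' u" by auto
  then obtain u where u: "z < u" "u < y" "w y - w z = (y - z) * w' u" by auto
  then have "w' u \<le> 0" using assms(3)[of u] pos[of u] y zy by auto
  then have "(y - z) * w' u \<le> 0" using zy by (simp add: mult_le_0_iff)
  then show False using u neg z by (auto simp: Z_def)
qed


lemma gronwall:
  fixes w :: "real \<Rightarrow> real"
  assumes cont: "continuous_on {a..b} w" and k: "0 \<le> k"
    and le: "\<And>x. x \<in> {a..b} \<Longrightarrow> w x \<le> c + k * integral {a..x} w"
    and y: "y \<in> {a..b}"
  shows "w y \<le> c * exp (k * (y - a))"
proof -
  define U where "U x = c + k * integral {a..x} w" for x
  have dU: "(U has_real_derivative k * w x) (at x within {a..b})" if "x \<in> {a..b}" for x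
    unfolding U_def
    by (rule derivative_eq_intros integral_has_real_derivative[OF cont that] refl)+ simp
  \<comment> \<open>With this integrating factor \<open>U\<close> becomes nonincreasing, because
    \<open>w \<le> U\<close>, and it starts from \<open>c\<close>.\<close>
  have "U y * exp (- k * (y - a)) - c \<le> 0"
  proof (rule nonpos_of_derivative_nonpos_where_pos[of a b "\<lambda>x. U x * exp (- k * (x - a)) - c"
        "\<lambda>x. k * exp (- k * (x - a)) * (w x - U x)"])
    fix x assume x: "x \<in> {a..b}"
    show "((\<lambda>x. U x * exp (- k * (x - a)) - c) has_real_derivative
        k * exp (- k * (x - a)) * (w x - U x)) (at x within {a..b})"
      by (rule derivative_eq_intros dU[OF x] refl)+ (simp add: algebra_simps)
    have "w x - U x \<le> 0" using le[OF x] by (simp add: U_def)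
    then show "k * exp (- k * (x - a)) * (w x - U x) \<le> 0"
      using k by (intro mult_nonneg_nonpos) auto
  qed (use y in \<open>auto simp: U_def\<close>)
  then have "U y * exp (- (k * (y - a))) * exp (k * (y - a)) \<le> c * exp (k * (y - a))"
    by (intro mult_right_mono) auto
  then have "U y \<le> c * exp (k * (y - a))" by (simp add: mult.assoc flip: exp_add)
  then show ?thesis using le[OF y] by (simp add: U_def)
qed

text \<open>The right-hand side is frozen beyond the lower and the upper curve; the excess of the solution over
  a curve then cannot increase while it is positive.\<close>

lemma picard_between:
  fixes G :: "real \<Rightarrow> real \<Rightarrow> real"
  assumes ab: "a \<le> b" and K: "0 \<le> K"
    and cont: "continuous_on {(x, y). x \<in> {a..b} \<and> lo x \<le> y \<and> y \<le> hi x} (\<lambda>(x, y). G x y)"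
    and lip: "\<And>x y z. x \<in> {a..b} \<Longrightarrow> y \<in> {lo x..hi x} \<Longrightarrow> z \<in> {lo x..hi x} \<Longrightarrow>
      \<bar>G x y - G x z\<bar> \<le> K * \<bar>y - z\<bar>"
    and le: "\<And>x. x \<in> {a..b} \<Longrightarrow> lo x \<le> hi x"
    and lo: "\<And>x. x \<in> {a..b} \<Longrightarrow> (lo has_real_derivative lo' x) (at x within {a..b})"
      "\<And>x. x \<in> {a..b} \<Longrightarrow> lo' x \<le> G x (lo x)"
    and hi: "\<And>x. x \<in> {a..b} \<Longrightarrow> (hi has_real_derivative hi' x) (at x within {a..b})"
      "\<And>x. x \<in> {a..b} \<Longrightarrow> G x (hi x) \<le> hi' x"
    and y0: "y0 \<in> {lo a..hi a}"
  shows "\<exists>\<sigma>. \<sigma> a = y0 \<and> (\<forall>x\<in>{a..b}. \<sigma> x \<in> {lo x..hi x} \<and>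
    (\<sigma> has_real_derivative G x (\<sigma> x)) (at x within {a..b}))"
proof -
  define cl where "cl x y = max (lo x) (min (hi x) y)" for x y
  have cl: "cl x y \<in> {lo x..hi x}" if "x \<in> {a..b}" for x y
    using le[OF that] by (auto simp: cl_def)
  have lo_cont: "continuous_on {a..b} lo" using lo(1) by (rule DERIV_continuous_on)
  have hi_cont: "continuous_on {a..b} hi" using hi(1) by (rule DERIV_continuous_on)
  have clc: "continuous_on ({a..b} \<times> UNIV) (\<lambda>z. cl (fst z) (snd z))"
    unfolding cl_def
    by (intro continuous_intros continuous_on_compose2[OF lo_cont] continuous_on_compose2[OF hi_cont]) auto
  have F: "continuous_on ({a..b} \<times> UNIV) (\<lambda>(x, y). G x (cl x y))"
  proof -
    have "continuous_on ({a..b} \<times> UNIV) (\<lambda>z. (\<lambda>(x, y). G x y) (fst z, cl (fst z) (snd z)))"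
      by (rule continuous_on_compose2[OF cont]) (use cl clc in \<open>auto intro!: continuous_intros\<close>)
    then show ?thesis by (simp add: split_beta)
  qed
  have "\<exists>\<sigma>. \<sigma> a = y0 \<and>
    (\<forall>x\<in>{a..b}. (\<sigma> has_real_derivative G x (cl x (\<sigma> x))) (at x within {a..b}))"
  proof (rule picard[OF ab K F])
    fix x y z assume x: "x \<in> {a..b}"
    have "\<bar>G x (cl x y) - G x (cl x z)\<bar> \<le> K * \<bar>cl x y - cl x z\<bar>"
      using lip[OF x cl cl] x by auto
    also have "\<dots> \<le> K * \<bar>y - z\<bar>" using K by (intro mult_left_mono) (auto simp: cl_def)
    finally show "\<bar>G x (cl x y) - G x (cl x z)\<bar> \<le> K * \<bar>y - z\<bar>" .
  qed
  then obtain \<sigma> where s: "\<sigma> a = y0"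
    "\<And>x. x \<in> {a..b} \<Longrightarrow> (\<sigma> has_real_derivative G x (cl x (\<sigma> x))) (at x within {a..b})"
    by auto
  have up: "\<sigma> x - hi x \<le> 0" if "x \<in> {a..b}" for x
  proof (rule nonpos_of_derivative_nonpos_where_pos[of a b "\<lambda>x. \<sigma> x - hi x" "\<lambda>x. G x (cl x (\<sigma> x)) - hi' x"])
    fix x assume x: "x \<in> {a..b}" and p: "0 < \<sigma> x - hi x"
    have "cl x (\<sigma> x) = hi x" using p le[OF x] by (auto simp: cl_def)
    then show "G x (cl x (\<sigma> x)) - hi' x \<le> 0" using hi(2)[OF x] by simp
  qed (use s(1) y0 that DERIV_diff[OF s(2) hi(1)] in simp_all)
  have dn: "lo x - \<sigma> x \<le> 0" if "x \<in> {a..b}" for x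
  proof (rule nonpos_of_derivative_nonpos_where_pos[of a b "\<lambda>x. lo x - \<sigma> x" "\<lambda>x. lo' x - G x (cl x (\<sigma> x))"])
    fix x assume x: "x \<in> {a..b}" and p: "0 < lo x - \<sigma> x"
    have "cl x (\<sigma> x) = lo x" using p le[OF x] by (auto simp: cl_def)
    then show "lo' x - G x (cl x (\<sigma> x)) \<le> 0" using lo(2)[OF x] by simp
  qed (use s(1) y0 that DERIV_diff[OF lo(1) s(2)] in simp_all)
  have "cl x (\<sigma> x) = \<sigma> x" if "x \<in> {a..b}" for x
    using up[OF that] dn[OF that] by (auto simp: cl_def)
  moreover have "\<sigma> x \<in> {lo x..hi x}" if "x \<in> {a..b}" for x
    using up[OF that] dn[OF that] by simp
  ultimately show ?thesis using s by (intro exI[of _ \<sigma>] conjI ballI) simp_all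
qed

text \<open>The reflection \<open>x \<mapsto> - x\<close> turns the end condition at
  \<open>b\<close> into an initial condition. Going to the left, a solution stays above
  \<open>lo\<close> if \<open>lo\<close> rises at least as steeply as the field demands, and below
  \<open>hi\<close> if \<open>hi\<close> rises at most as steeply; hence the reversed slope
  inequalities.\<close>

lemma picard_between_backward:
  fixes G :: "real \<Rightarrow> real \<Rightarrow> real"
  assumes ab: "a \<le> b" and K: "0 \<le> K"
    and cont: "continuous_on {(x, y). x \<in> {a..b} \<and> lo x \<le> y \<and> y \<le> hi x} (\<lambda>(x, y). G x y)"
    and lip: "\<And>x y z. x \<in> {a..b} \<Longrightarrow> y \<in> {lo x..hi x} \<Longrightarrow> z \<in> {lo x..hi x} \<Longrightarrow>
      \<bar>G x y - G x z\<bar> \<le> K * \<bar>y - z\<bar>"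
    and le: "\<And>x. x \<in> {a..b} \<Longrightarrow> lo x \<le> hi x"
    and lo: "\<And>x. x \<in> {a..b} \<Longrightarrow> (lo has_real_derivative lo' x) (at x within {a..b})"
      "\<And>x. x \<in> {a..b} \<Longrightarrow> G x (lo x) \<le> lo' x"
    and hi: "\<And>x. x \<in> {a..b} \<Longrightarrow> (hi has_real_derivative hi' x) (at x within {a..b})"
      "\<And>x. x \<in> {a..b} \<Longrightarrow> hi' x \<le> G x (hi x)"
    and y0: "y0 \<in> {lo b..hi b}"
  shows "\<exists>\<sigma>. \<sigma> b = y0 \<and> (\<forall>x\<in>{a..b}. \<sigma> x \<in> {lo x..hi x} \<and>
    (\<sigma> has_real_derivative G x (\<sigma> x)) (at x within {a..b}))"
proof -
  have reflect: "((\<lambda>x. f (- x)) has_real_derivative - f' (- x)) (at x within {-b..-a})"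
    if "\<And>x. x \<in> {a..b} \<Longrightarrow> (f has_real_derivative f' x) (at x within {a..b})" "x \<in> {-b..-a}"
    for f f' :: "real \<Rightarrow> real" and x
  proof -
    have "(f has_real_derivative f' (- x)) (at (- x) within uminus ` {-b..-a})"
      using that by auto
    then show ?thesis
      using DERIV_image_chain[OF _ DERIV_minus[OF DERIV_ident], of f "f' (- x)" x "{-b..-a}"]
      by (simp add: o_def)
  qed
  have "\<exists>\<sigma>. \<sigma> (- b) = y0 \<and> (\<forall>x\<in>{-b..-a}. \<sigma> x \<in> {lo (- x)..hi (- x)} \<and>
    (\<sigma> has_real_derivative - G (- x) (\<sigma> x)) (at x within {-b..-a}))"
  proof (rule picard_between[where K=K and lo="\<lambda>x. lo (- x)" and hi="\<lambda>x. hi (- x)"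
        and G="\<lambda>x y. - G (- x) y"
        and lo'="\<lambda>x. - lo' (- x)" and hi'="\<lambda>x. - hi' (- x)"])
    show "continuous_on {(x, y). x \<in> {- b..- a} \<and> lo (- x) \<le> y \<and> y \<le> hi (- x)} (\<lambda>(x, y). - G (- x) y)"
    proof -
      have "continuous_on {(x, y). x \<in> {- b..- a} \<and> lo (- x) \<le> y \<and> y \<le> hi (- x)}
        (\<lambda>z. - (\<lambda>(x, y). G x y) (- fst z, snd z))"
        by (intro continuous_intros continuous_on_compose2[OF cont]) auto
      then show ?thesis by (simp add: split_beta)
    qed
    show "\<And>x y z. x \<in> {- b..- a} \<Longrightarrow> y \<in> {lo (- x)..hi (- x)} \<Longrightarrow> z \<in> {lo (- x)..hi (- x)} \<Longrightarrow>
      \<bar>- G (- x) y - - G (- x) z\<bar> \<le> K * \<bar>y - z\<bar>"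
    proof -
      fix x y z :: real assume "x \<in> {- b..- a}" "y \<in> {lo (- x)..hi (- x)}" "z \<in> {lo (- x)..hi (- x)}"
      then have "\<bar>G (- x) y - G (- x) z\<bar> \<le> K * \<bar>y - z\<bar>" by (intro lip) auto
      then show "\<bar>- G (- x) y - - G (- x) z\<bar> \<le> K * \<bar>y - z\<bar>" by linarith
    qed
    show "\<And>x. x \<in> {- b..- a} \<Longrightarrow>
      ((\<lambda>x. lo (- x)) has_real_derivative - lo' (- x)) (at x within {- b..- a})"
      by (rule reflect[OF lo(1)])
    show "\<And>x. x \<in> {- b..- a} \<Longrightarrow>
      ((\<lambda>x. hi (- x)) has_real_derivative - hi' (- x)) (at x within {- b..- a})"
      by (rule reflect[OF hi(1)])
  qed (use ab K le lo(2) hi(2) y0 in auto)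
  then obtain \<sigma> where s: "\<sigma> (- b) = y0"
    "\<And>x. x \<in> {-b..-a} \<Longrightarrow> \<sigma> x \<in> {lo (- x)..hi (- x)}"
    "\<And>x. x \<in> {-b..-a} \<Longrightarrow> (\<sigma> has_real_derivative - G (- x) (\<sigma> x)) (at x within {-b..-a})"
    by auto
  have "((\<lambda>x. \<sigma> (- x)) has_real_derivative G x (\<sigma> (- x))) (at x within {a..b})" if "x \<in> {a..b}" for x
  proof -
    have "(\<sigma> has_real_derivative - G x (\<sigma> (- x))) (at (- x) within uminus ` {a..b})"
      using s(3)[of "- x"] that by auto
    then show ?thesis
      using DERIV_image_chain[OF _ DERIV_minus[OF DERIV_ident], of \<sigma> "- G x (\<sigma> (- x))" x "{a..b}"]
      by (simp add: o_def)
  qed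
  moreover have "\<sigma> (- x) \<in> {lo x..hi x}" if "x \<in> {a..b}" for x
    using s(2)[of "- x"] that by simp
  ultimately show ?thesis using s(1) by (intro exI[of _ "\<lambda>x. \<sigma> (- x)"] conjI ballI) simp_all
qed

section \<open>Transport along characteristics\<close>

lemma increasing_curve:
  fixes \<sigma> \<sigma>' :: "real \<Rightarrow> real"
  assumes "a \<le> b"
    and d: "\<And>x. x \<in> {a..b} \<Longrightarrow> (\<sigma> has_real_derivative \<sigma>' x) (at x within {a..b})"
    and p: "\<And>x. x \<in> {a..b} \<Longrightarrow> 0 < \<sigma>' x"
  shows "strict_mono_on {a..b} \<sigma>" "\<sigma> ` {a..b} = {\<sigma> a..\<sigma> b}"
proof -
  have c: "continuous_on {a..b} \<sigma>" using d by (rule DERIV_continuous_on)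
  show mono: "strict_mono_on {a..b} \<sigma>"
  proof (rule strict_mono_onI)
    fix x y assume xy: "x \<in> {a..b}" "y \<in> {a..b}" "x < y"
    show "\<sigma> x < \<sigma> y"
    proof (rule DERIV_pos_imp_increasing_open[OF xy(3)])
      fix z assume z: "x < z" "z < y"
      then have "(\<sigma> has_real_derivative \<sigma>' z) (at z)"
        using d[of z] xy at_within_Icc_at[of a z b] by auto
      then show "\<exists>y. (\<sigma> has_real_derivative y) (at z) \<and> 0 < y" using p[of z] z xy by auto
    qed (use c xy in \<open>auto intro: continuous_on_subset\<close>)
  qed
  have le: "\<sigma> x \<le> \<sigma> y" if "x \<in> {a..b}" "y \<in> {a..b}" "x \<le> y" for x y
    using strict_mono_onD[OF mono, of x y] that by (cases "x = y") auto
  show "\<sigma> ` {a..b} = {\<sigma> a..\<sigma> b}"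
  proof
    show "\<sigma> ` {a..b} \<subseteq> {\<sigma> a..\<sigma> b}" using le assms(1) by auto
    show "{\<sigma> a..\<sigma> b} \<subseteq> \<sigma> ` {a..b}"
      using IVT'[of \<sigma> a _ b] c assms(1) by fastforce
  qed
qed

section \<open>Continuity and size of the state components, continuity of the source terms\<close>

lemma continuous_on_curve:
  assumes "continuous_on S (\<lambda>(x, t). X x t)" "continuous_on T \<sigma>"
    and "\<And>x. x \<in> T \<Longrightarrow> (x, \<sigma> x) \<in> S"
  shows "continuous_on T (\<lambda>x. X x (\<sigma> x))"
proof -
  have "continuous_on T (\<lambda>x. (\<lambda>(x, t). X x t) (x, \<sigma> x))"
    by (rule continuous_on_compose2[OF assms(1)]) (use assms in \<open>auto intro!: continuous_intros\<close>)
  then show ?thesis by simp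
qed

lemma state_fields:
  "gas_frac s = fst s" "pres s = fst (snd s)" "gas_vel s = snd (snd s)"
  by (simp_all add: split_beta)

lemma continuous_on_gas_frac: "continuous_on T f \<Longrightarrow> continuous_on T (\<lambda>x. gas_frac (f x))"
  and continuous_on_pres: "continuous_on T f \<Longrightarrow> continuous_on T (\<lambda>x. pres (f x))"
  and continuous_on_gas_vel: "continuous_on T f \<Longrightarrow> continuous_on T (\<lambda>x. gas_vel (f x))"
  unfolding state_fields by (auto intro!: continuous_intros)

lemma abs_gas_frac_diff_le: "\<bar>gas_frac s - gas_frac s'\<bar> \<le> norm (s - s')"
  and abs_pres_diff_le: "\<bar>pres s - pres s'\<bar> \<le> norm (s - s')"
  and abs_gas_vel_diff_le: "\<bar>gas_vel s - gas_vel s'\<bar> \<le> norm (s - s')"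
proof -
  have "norm (fst d) \<le> norm d" "norm (fst (snd d)) \<le> norm d" "norm (snd (snd d)) \<le> norm d"
    for d :: state
    using norm_fst_le[of "fst d" "snd d"] norm_snd_le[of "snd d" "fst d"]
      norm_fst_le[of "fst (snd d)" "snd (snd d)"] norm_snd_le[of "snd (snd d)" "fst (snd d)"]
    by simp_all
  from this[of "s - s'"] show "\<bar>gas_frac s - gas_frac s'\<bar> \<le> norm (s - s')"
    "\<bar>pres s - pres s'\<bar> \<le> norm (s - s')" "\<bar>gas_vel s - gas_vel s'\<bar> \<le> norm (s - s')"
    unfolding state_fields by simp_all
qed

lemma norm_state_diff_le:
  "norm (s - s') \<le> \<bar>gas_frac s - gas_frac s'\<bar> + \<bar>pres s - pres s'\<bar> + \<bar>gas_vel s - gas_vel s'\<bar>"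
proof -
  have "norm d \<le> norm (fst d) + (norm (fst (snd d)) + norm (snd (snd d)))" for d :: state
    using norm_Pair_le[of "fst d" "snd d"] norm_Pair_le[of "fst (snd d)" "snd (snd d)"] by simp
  from this[of "s - s'"] show ?thesis unfolding state_fields by simp
qed

lemma continuous_on_dp_dx: "continuous_on T f \<Longrightarrow> continuous_on T (\<lambda>x. dp_dx P (f x))"
proof -
  have "dp_dx P s = - ((fst s * rho_G P (fst (snd s)) + (1 - fst s) * rho_L P (fst (snd s)))
      * grav_acc P * cos (incl P)
    + fric_coeff P * (fst s * rho_G P (fst (snd s)) + (1 - fst s) * rho_L P (fst (snd s)))
      * ((1 - fst s) * liq_vel P (snd (snd s)) + fst s * snd (snd s))
      * \<bar>(1 - fst s) * liq_vel P (snd (snd s)) + fst s * snd (snd s)\<bar> * inverse (diam P))" for s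
    by (cases s) (simp add: dp_dx_def grav_term_def fric_term_def divide_inverse)
  then show "continuous_on T f \<Longrightarrow> continuous_on T (\<lambda>x. dp_dx P (f x))"
    unfolding rho_G_def rho_L_def liq_vel_def divide_inverse
    by (auto intro!: continuous_intros)
qed

lemma dv_dx_eq: "dv_dx P s = - (slip P * gas_frac s * gas_vel s / pres s) * dp_dx P s"
  and E_G_eq: "E_G P s = - (gas_frac s * (1 - slip P * gas_frac s) * gas_vel s / pres s) * dp_dx P s"
  by (cases s; simp)+

lemma continuous_on_dv_dx:
  assumes "continuous_on T f" "\<And>x. x \<in> T \<Longrightarrow> pres (f x) \<noteq> 0"
  shows "continuous_on T (\<lambda>x. dv_dx P (f x))"
  unfolding dv_dx_eq using assms
  by (intro continuous_intros continuous_on_dp_dx continuous_on_gas_frac continuous_on_gas_vel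
      continuous_on_pres) auto

lemma continuous_on_E_G:
  assumes "continuous_on T f" "\<And>x. x \<in> T \<Longrightarrow> pres (f x) \<noteq> 0"
  shows "continuous_on T (\<lambda>x. E_G P (f x))"
  unfolding E_G_eq using assms
  by (intro continuous_intros continuous_on_dp_dx continuous_on_gas_frac continuous_on_gas_vel
      continuous_on_pres) auto

text \<open>Here a characteristic is parametrised by position; its inverse function is the
  time-parametrised curve that occurs in \<open>broad_transport\<close>.\<close>

lemma broad_transport_along_curve:
  assumes tr: "broad_transport P S X" and cont: "continuous_on S (\<lambda>(x, t). X x t)"
    and S: "\<And>x. x \<in> {a..b} \<Longrightarrow> (x, \<sigma> x) \<in> S"
    and p: "\<And>x. x \<in> {a..b} \<Longrightarrow> 0 < pres (X x (\<sigma> x))"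
    and v: "\<And>x. x \<in> {a..b} \<Longrightarrow> 0 < gas_vel (X x (\<sigma> x))"
    and d: "\<And>x. x \<in> {a..b} \<Longrightarrow>
      (\<sigma> has_real_derivative 1 / gas_vel (X x (\<sigma> x))) (at x within {a..b})"
    and x: "x \<in> {a..b}"
  shows "((\<lambda>x. gas_frac (X x (\<sigma> x))) has_real_derivative
    E_G P (X x (\<sigma> x)) / gas_vel (X x (\<sigma> x))) (at x within {a..b})"
proof -
  have ab: "a \<le> b" using x by auto
  have inc: "strict_mono_on {a..b} \<sigma>" "\<sigma> ` {a..b} = {\<sigma> a..\<sigma> b}"
    using increasing_curve[OF ab d] v by auto
  have sc: "continuous_on {a..b} \<sigma>" using d by (rule DERIV_continuous_on)
  define c where "c = the_inv_into {a..b} \<sigma>"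
  have inj: "inj_on \<sigma> {a..b}" by (rule strict_mono_on_imp_inj_on[OF inc(1)])
  have c1: "c (\<sigma> y) = y" if "y \<in> {a..b}" for y
    unfolding c_def by (rule the_inv_into_f_f[OF inj that])
  have c2: "c s \<in> {a..b}" "\<sigma> (c s) = s" if "s \<in> {\<sigma> a..\<sigma> b}" for s
    using that c1 unfolding inc(2)[symmetric] by auto
  have cc: "continuous_on {\<sigma> a..\<sigma> b} c"
    using continuous_on_inv[OF sc compact_Icc, of c] c1 by (simp add: inc(2))
  \<comment> \<open>The inverse function rule turns the slowness into the velocity. Derivatives are
    taken within the closed interval, since \<open>broad_transport\<close> asks for them at the end
    points too.\<close>
  have cd: "(c has_real_derivative gas_vel (X (c s) s)) (at s within {\<sigma> a..\<sigma> b})"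
    if s: "s \<in> {\<sigma> a..\<sigma> b}" for s
  proof -
    define y where "y = c s"
    have y: "y \<in> {a..b}" "\<sigma> y = s" using c2[OF s] by (auto simp: y_def)
    have "(c has_derivative (*) (gas_vel (X y (\<sigma> y)))) (at (\<sigma> y) within \<sigma> ` {a..b})"
    proof (rule has_derivative_inverse_within)
      show "(\<sigma> has_derivative (*) (1 / gas_vel (X y (\<sigma> y)))) (at y within {a..b})"
        using d[OF y(1)] by (simp add: has_field_derivative_def)
      show "continuous (at (\<sigma> y) within \<sigma> ` {a..b}) c"
        using cc s y by (auto simp: inc(2) continuous_on_eq_continuous_within)
      show "(*) (gas_vel (X y (\<sigma> y))) \<circ> (*) (1 / gas_vel (X y (\<sigma> y))) = id"
        using v[OF y(1)] by (auto simp: fun_eq_iff)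
    qed (use y c1 in \<open>auto intro!: linear_times\<close>)
    then show ?thesis by (simp add: has_field_derivative_def inc(2) y y_def[symmetric])
  qed
  \<comment> \<open>The integrated equation is used for every upper limit \<open>s\<close>: along
    the curve the gas fraction is then an indefinite integral of a continuous function, hence
    differentiable.\<close>
  have int: "((\<lambda>s. E_G P (X (c s) s)) has_integral
      gas_frac (X (c s) s) - gas_frac (X a (\<sigma> a))) {\<sigma> a..s}" if s: "s \<in> {\<sigma> a..\<sigma> b}" for s
  proof -
    have "\<sigma> a \<le> s \<and> (\<forall>r\<in>{\<sigma> a..s}. (c r, r) \<in> S \<and>
        (c has_real_derivative gas_vel (X (c r) r)) (at r within {\<sigma> a..s}))"
    proof (intro conjI ballI)
      fix r assume r: "r \<in> {\<sigma> a..s}"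
      then have r': "r \<in> {\<sigma> a..\<sigma> b}" using s by auto
      show "(c r, r) \<in> S" using S[OF c2(1)[OF r']] c2(2)[OF r'] by simp
      show "(c has_real_derivative gas_vel (X (c r) r)) (at r within {\<sigma> a..s})"
        by (rule DERIV_subset[OF cd[OF r']]) (use s in auto)
    qed (use s in auto)
    then have "((\<lambda>s. E_G P (X (c s) s)) has_integral
      gas_frac (X (c s) s) - gas_frac (X (c (\<sigma> a)) (\<sigma> a))) {\<sigma> a..s}"
      using tr unfolding broad_transport_def by blast
    then show ?thesis using c1[of a] ab by simp
  qed
  define A where "A s = gas_frac (X a (\<sigma> a)) + integral {\<sigma> a..s} (\<lambda>s. E_G P (X (c s) s))" for s
  have Xc: "continuous_on {\<sigma> a..\<sigma> b} (\<lambda>s. X (c s) s)"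
  proof -
    have "continuous_on {\<sigma> a..\<sigma> b} (\<lambda>s. (\<lambda>(x, t). X x t) (c s, s))"
    proof (rule continuous_on_compose2[OF cont])
      show "(\<lambda>s. (c s, s)) ` {\<sigma> a..\<sigma> b} \<subseteq> S"
        using S c2 by (metis (mono_tags, lifting) image_subsetI)
    qed (intro continuous_intros cc)
    then show ?thesis by simp
  qed
  have Ec: "continuous_on {\<sigma> a..\<sigma> b} (\<lambda>s. E_G P (X (c s) s))"
  proof (rule continuous_on_E_G[OF Xc])
    fix s assume "s \<in> {\<sigma> a..\<sigma> b}"
    then show "pres (X (c s) s) \<noteq> 0" using p[of "c s"] c2[of s] by auto
  qed
  have sx: "\<sigma> x \<in> {\<sigma> a..\<sigma> b}" using inc(2) x by blast
  have "(A has_real_derivative E_G P (X (c (\<sigma> x)) (\<sigma> x))) (at (\<sigma> x) within {\<sigma> a..\<sigma> b})"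
    unfolding A_def
    by (rule derivative_eq_intros integral_has_real_derivative[OF Ec sx] refl)+ simp
  then have "((A \<circ> \<sigma>) has_real_derivative E_G P (X x (\<sigma> x)) * (1 / gas_vel (X x (\<sigma> x))))
      (at x within {a..b})"
    by (intro DERIV_image_chain d x) (simp add: inc(2) c1[OF x])
  then have "((A \<circ> \<sigma>) has_real_derivative E_G P (X x (\<sigma> x)) / gas_vel (X x (\<sigma> x)))
      (at x within {a..b})" by simp
  then show ?thesis
  proof (rule has_field_derivative_transform_within[OF _ zero_less_one x])
    fix y assume y: "y \<in> {a..b}"
    then have "\<sigma> y \<in> {\<sigma> a..\<sigma> b}" using inc(2) by blast
    from integral_unique[OF int[OF this]]
    show "(A \<circ> \<sigma>) y = gas_frac (X y (\<sigma> y))" by (simp add: A_def c1[OF y])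
  qed
qed

section \<open>Lipschitz constants of the source terms\<close>

text \<open>Boundedness is built in because products of unbounded Lipschitz functions need not be
  Lipschitz. With it the class is closed under the operations that build the source terms, where
  division asks for a positive lower bound of the divisor.\<close>

definition bounded_lipschitz :: "state set \<Rightarrow> (state \<Rightarrow> real) \<Rightarrow> bool" where
  "bounded_lipschitz B f \<longleftrightarrow> (\<exists>K\<ge>0. \<forall>s\<in>B. \<bar>f s\<bar> \<le> K \<and> (\<forall>s'\<in>B. \<bar>f s - f s'\<bar> \<le> K * norm (s - s')))"

lemma bounded_lipschitzE:
  assumes "bounded_lipschitz B f"
  obtains K where "0 \<le> K" "\<And>s. s \<in> B \<Longrightarrow> \<bar>f s\<bar> \<le> K"
    "\<And>s s'. s \<in> B \<Longrightarrow> s' \<in> B \<Longrightarrow> \<bar>f s - f s'\<bar> \<le> K * norm (s - s')"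
  using assms unfolding bounded_lipschitz_def by blast

lemma bounded_lipschitzI:
  assumes "0 \<le> K" "0 \<le> K'" "\<And>s. s \<in> B \<Longrightarrow> \<bar>f s\<bar> \<le> K"
    "\<And>s s'. s \<in> B \<Longrightarrow> s' \<in> B \<Longrightarrow> \<bar>f s - f s'\<bar> \<le> K' * norm (s - s')"
  shows "bounded_lipschitz B f"
  unfolding bounded_lipschitz_def
proof (intro exI[of _ "K + K'"] conjI ballI)
  fix s assume s: "s \<in> B"
  show "\<bar>f s\<bar> \<le> K + K'" using assms(3)[OF s] assms(2) by linarith
  fix s' assume s': "s' \<in> B"
  have "K' * norm (s - s') \<le> (K + K') * norm (s - s')"
    using assms(1) by (intro mult_right_mono) auto
  then show "\<bar>f s - f s'\<bar> \<le> (K + K') * norm (s - s')" using assms(4)[OF s s'] by linarith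
qed (use assms in auto)

section \<open>Closure properties of bounded Lipschitz functions\<close>

lemma bounded_lipschitz_const: "bounded_lipschitz B (\<lambda>s. c)"
  by (rule bounded_lipschitzI[of "\<bar>c\<bar>" 0]) auto

lemma bounded_lipschitz_add:
  assumes "bounded_lipschitz B f" "bounded_lipschitz B g"
  shows "bounded_lipschitz B (\<lambda>s. f s + g s)"
proof -
  obtain K where K: "0 \<le> K" "\<And>s. s \<in> B \<Longrightarrow> \<bar>f s\<bar> \<le> K"
    "\<And>s s'. s \<in> B \<Longrightarrow> s' \<in> B \<Longrightarrow> \<bar>f s - f s'\<bar> \<le> K * norm (s - s')"
    using assms(1) by (rule bounded_lipschitzE) blast
  obtain J where J: "0 \<le> J" "\<And>s. s \<in> B \<Longrightarrow> \<bar>g s\<bar> \<le> J"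
    "\<And>s s'. s \<in> B \<Longrightarrow> s' \<in> B \<Longrightarrow> \<bar>g s - g s'\<bar> \<le> J * norm (s - s')"
    using assms(2) by (rule bounded_lipschitzE) blast
  show ?thesis
  proof (rule bounded_lipschitzI[of "K + J" "K + J"])
    fix s assume s: "s \<in> B"
    show "\<bar>f s + g s\<bar> \<le> K + J" using K(2)[OF s] J(2)[OF s] by linarith
    fix s' assume s': "s' \<in> B"
    show "\<bar>f s + g s - (f s' + g s')\<bar> \<le> (K + J) * norm (s - s')"
      using K(3)[OF s s'] J(3)[OF s s'] unfolding distrib_right by linarith
  qed (use K J in auto)
qed

lemma bounded_lipschitz_mult:
  assumes "bounded_lipschitz B f" "bounded_lipschitz B g"
  shows "bounded_lipschitz B (\<lambda>s. f s * g s)"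
proof -
  obtain K where K: "0 \<le> K" "\<And>s. s \<in> B \<Longrightarrow> \<bar>f s\<bar> \<le> K"
    "\<And>s s'. s \<in> B \<Longrightarrow> s' \<in> B \<Longrightarrow> \<bar>f s - f s'\<bar> \<le> K * norm (s - s')"
    using assms(1) by (rule bounded_lipschitzE) blast
  obtain J where J: "0 \<le> J" "\<And>s. s \<in> B \<Longrightarrow> \<bar>g s\<bar> \<le> J"
    "\<And>s s'. s \<in> B \<Longrightarrow> s' \<in> B \<Longrightarrow> \<bar>g s - g s'\<bar> \<le> J * norm (s - s')"
    using assms(2) by (rule bounded_lipschitzE) blast
  show ?thesis
  proof (rule bounded_lipschitzI[of "K * J" "2 * K * J"])
    fix s assume s: "s \<in> B"
    show "\<bar>f s * g s\<bar> \<le> K * J"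
      using K(2)[OF s] J(2)[OF s] K(1) by (simp add: abs_mult mult_mono)
    fix s' assume s': "s' \<in> B"
    have "\<bar>f s * g s - f s' * g s'\<bar> = \<bar>f s * (g s - g s') + g s' * (f s - f s')\<bar>"
      by (simp add: algebra_simps)
    also have "\<dots> \<le> \<bar>f s\<bar> * \<bar>g s - g s'\<bar> + \<bar>g s'\<bar> * \<bar>f s - f s'\<bar>"
      by (simp flip: abs_mult)
    also have "\<dots> \<le> K * (J * norm (s - s')) + J * (K * norm (s - s'))"
      using K J s s' by (intro add_mono mult_mono) auto
    finally show "\<bar>f s * g s - f s' * g s'\<bar> \<le> 2 * K * J * norm (s - s')"
      by (simp add: mult_ac)
  qed (use K J in auto)
qed

lemma bounded_lipschitz_minus:
  assumes "bounded_lipschitz B f" shows "bounded_lipschitz B (\<lambda>s. - f s)"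
  using bounded_lipschitz_mult[OF bounded_lipschitz_const[of B "-1"] assms] by simp

lemma bounded_lipschitz_diff:
  assumes "bounded_lipschitz B f" "bounded_lipschitz B g"
  shows "bounded_lipschitz B (\<lambda>s. f s - g s)"
  using bounded_lipschitz_add[OF assms(1) bounded_lipschitz_minus[OF assms(2)]] by simp

lemma bounded_lipschitz_abs:
  assumes "bounded_lipschitz B f" shows "bounded_lipschitz B (\<lambda>s. \<bar>f s\<bar>)"
proof -
  obtain K where K: "0 \<le> K" "\<And>s. s \<in> B \<Longrightarrow> \<bar>f s\<bar> \<le> K"
    "\<And>s s'. s \<in> B \<Longrightarrow> s' \<in> B \<Longrightarrow> \<bar>f s - f s'\<bar> \<le> K * norm (s - s')"
    using assms(1) by (rule bounded_lipschitzE) blast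
  show ?thesis
  proof (rule bounded_lipschitzI[of K K])
    fix s s' assume "s \<in> B" "s' \<in> B"
    then show "\<bar>\<bar>f s\<bar> - \<bar>f s'\<bar>\<bar> \<le> K * norm (s - s')"
      using K(3)[of s s'] by linarith
  qed (use K in auto)
qed

lemma bounded_lipschitz_inverse:
  assumes "bounded_lipschitz B f" "0 < c" "\<And>s. s \<in> B \<Longrightarrow> c \<le> f s"
  shows "bounded_lipschitz B (\<lambda>s. inverse (f s))"
proof -
  obtain K where K: "0 \<le> K" "\<And>s. s \<in> B \<Longrightarrow> \<bar>f s\<bar> \<le> K"
    "\<And>s s'. s \<in> B \<Longrightarrow> s' \<in> B \<Longrightarrow> \<bar>f s - f s'\<bar> \<le> K * norm (s - s')"
    using assms(1) by (rule bounded_lipschitzE) blast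
  have i: "0 \<le> inverse (f s)" "inverse (f s) \<le> inverse c" if "s \<in> B" for s
    using assms(2) assms(3)[OF that] by (auto intro: le_imp_inverse_le)
  show ?thesis
  proof (rule bounded_lipschitzI[of "inverse c" "inverse c * inverse c * K"])
    fix s assume s: "s \<in> B"
    show "\<bar>inverse (f s)\<bar> \<le> inverse c" using i[OF s] by simp
    fix s' assume s': "s' \<in> B"
    have "f s \<noteq> 0" "f s' \<noteq> 0" using assms(2) assms(3)[OF s] assms(3)[OF s'] by auto
    then have "inverse (f s) - inverse (f s') = inverse (f s) * inverse (f s') * (f s' - f s)"
      by (simp add: field_simps)
    then have "\<bar>inverse (f s) - inverse (f s')\<bar> = inverse (f s) * inverse (f s') * \<bar>f s - f s'\<bar>"
      using i[OF s] i[OF s'] by (simp add: abs_mult abs_minus_commute)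
    also have "\<dots> \<le> inverse c * inverse c * (K * norm (s - s'))"
      using i s s' K(3)[OF s s'] assms(2) by (intro mult_mono) auto
    finally show "\<bar>inverse (f s) - inverse (f s')\<bar> \<le> inverse c * inverse c * K * norm (s - s')"
      by simp
  qed (use K assms(2) in auto)
qed

text \<open>The lower bounds \<open>q\<close> and \<open>v\<close> keep the denominators of the
  source terms away from zero. The gas fraction is bounded in absolute value only, as the equations
  of the observer do not confine it to the unit interval beforehand.\<close>

definition state_box :: "real \<Rightarrow> real \<Rightarrow> real \<Rightarrow> state set" where
  "state_box q v R = {s. \<bar>gas_frac s\<bar> \<le> R \<and> q \<le> pres s \<and> pres s \<le> R \<and> v \<le> gas_vel s \<and> gas_vel s \<le> R}"

text \<open>The four functions are the right-hand sides of all equations in the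
  \<open>x\<close>-direction: the slopes of pressure and velocity at fixed time, and the slopes of
  gas fraction and time along a characteristic parametrised by position.\<close>

definition lipschitz_sources :: "well \<Rightarrow> state set \<Rightarrow> real \<Rightarrow> bool" where
  "lipschitz_sources P B C \<longleftrightarrow> 0 \<le> C \<and> (\<forall>s\<in>B. \<forall>s'\<in>B.
     \<bar>dp_dx P s - dp_dx P s'\<bar> \<le> C * norm (s - s') \<and>
     \<bar>dv_dx P s - dv_dx P s'\<bar> \<le> C * norm (s - s') \<and>
     \<bar>E_G P s / gas_vel s - E_G P s' / gas_vel s'\<bar> \<le> C * norm (s - s') \<and>
     \<bar>1 / gas_vel s - 1 / gas_vel s'\<bar> \<le> C * norm (s - s'))"

lemma lipschitz_sources_state_box:
  assumes "0 < q" "0 < v" "v \<le> R" "q \<le> R"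
  shows "\<exists>C. lipschitz_sources P (state_box q v R) C"
proof -
  let ?B = "state_box q v R"
  note bl = bounded_lipschitz_const bounded_lipschitz_add bounded_lipschitz_mult
    bounded_lipschitz_minus bounded_lipschitz_diff bounded_lipschitz_abs
  have a: "bounded_lipschitz ?B gas_frac" "bounded_lipschitz ?B pres" "bounded_lipschitz ?B gas_vel"
    by (rule bounded_lipschitzI[of R 1],
        use assms abs_gas_frac_diff_le abs_pres_diff_le abs_gas_vel_diff_le
          in \<open>auto simp: state_box_def state_fields\<close>)+
  have i: "bounded_lipschitz ?B (\<lambda>s. inverse (pres s))" "bounded_lipschitz ?B (\<lambda>s. inverse (gas_vel s))"
    by (rule bounded_lipschitz_inverse[OF a(2) assms(1)], simp add: state_box_def)
      (rule bounded_lipschitz_inverse[OF a(3) assms(2)], simp add: state_box_def)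
  \<comment> \<open>Only sums, products, absolute values and inverses of constants remain, so that
    the closure rules apply syntactically.\<close>
  have dp: "dp_dx P = (\<lambda>s. - ((gas_frac s * (pres s * inverse ((c_gas P)\<^sup>2)) + (1 - gas_frac s) * (rho_L0 P + pres s * inverse ((c_liq P)\<^sup>2)))
      * grav_acc P * cos (incl P)
    + fric_coeff P * (gas_frac s * (pres s * inverse ((c_gas P)\<^sup>2)) + (1 - gas_frac s) * (rho_L0 P + pres s * inverse ((c_liq P)\<^sup>2)))
      * ((1 - gas_frac s) * ((gas_vel s - v_inf P) * inverse (slip P)) + gas_frac s * gas_vel s)
      * \<bar>(1 - gas_frac s) * ((gas_vel s - v_inf P) * inverse (slip P)) + gas_frac s * gas_vel s\<bar> * inverse (diam P)))"
    by (rule ext, clarify) (simp add: dp_dx_def grav_term_def fric_term_def liq_vel_def rho_G_def rho_L_def divide_inverse)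
  have 1: "bounded_lipschitz ?B (dp_dx P)"
    unfolding dp by (intro bl a)
  have 2: "bounded_lipschitz ?B (dv_dx P)"
    unfolding dv_dx_eq[abs_def] divide_inverse by (intro bl a i 1)
  have 3: "bounded_lipschitz ?B (\<lambda>s. E_G P s / gas_vel s)"
    unfolding E_G_eq divide_inverse by (intro bl a i 1)
  have 4: "bounded_lipschitz ?B (\<lambda>s. 1 / gas_vel s)"
    unfolding divide_inverse by (intro bl a i)
  obtain C1 where C1: "0 \<le> C1" "\<And>s s'. s \<in> ?B \<Longrightarrow> s' \<in> ?B \<Longrightarrow> \<bar>dp_dx P s - dp_dx P s'\<bar> \<le> C1 * norm (s - s')"
    using 1 by (rule bounded_lipschitzE) blast
  obtain C2 where C2: "0 \<le> C2" "\<And>s s'. s \<in> ?B \<Longrightarrow> s' \<in> ?B \<Longrightarrow> \<bar>dv_dx P s - dv_dx P s'\<bar> \<le> C2 * norm (s - s')"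
    using 2 by (rule bounded_lipschitzE) blast
  obtain C3 where C3: "0 \<le> C3" "\<And>s s'. s \<in> ?B \<Longrightarrow> s' \<in> ?B \<Longrightarrow>
      \<bar>E_G P s / gas_vel s - E_G P s' / gas_vel s'\<bar> \<le> C3 * norm (s - s')"
    using 3 by (rule bounded_lipschitzE) blast
  obtain C4 where C4: "0 \<le> C4" "\<And>s s'. s \<in> ?B \<Longrightarrow> s' \<in> ?B \<Longrightarrow>
      \<bar>1 / gas_vel s - 1 / gas_vel s'\<bar> \<le> C4 * norm (s - s')"
    using 4 by (rule bounded_lipschitzE) blast
  define C where "C = C1 + C2 + C3 + C4"
  have m: "C1 * r \<le> C * r" "C2 * r \<le> C * r" "C3 * r \<le> C * r" "C4 * r \<le> C * r" if "0 \<le> r" for r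
    using C1(1) C2(1) C3(1) C4(1) that by (auto intro!: mult_right_mono simp: C_def)
  have "lipschitz_sources P ?B C"
    unfolding lipschitz_sources_def
  proof (intro conjI ballI)
    show "0 \<le> C" using C1(1) C2(1) C3(1) C4(1) by (simp add: C_def)
  next
    fix s s' assume s: "s \<in> ?B" "s' \<in> ?B"
    note n = norm_ge_zero[of "s - s'"]
    show "\<bar>dp_dx P s - dp_dx P s'\<bar> \<le> C * norm (s - s')"
      by (rule order_trans[OF C1(2)[OF s] m(1)[OF n]])
    show "\<bar>dv_dx P s - dv_dx P s'\<bar> \<le> C * norm (s - s')"
      by (rule order_trans[OF C2(2)[OF s] m(2)[OF n]])
    show "\<bar>E_G P s / gas_vel s - E_G P s' / gas_vel s'\<bar> \<le> C * norm (s - s')"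
      by (rule order_trans[OF C3(2)[OF s] m(3)[OF n]])
    show "\<bar>1 / gas_vel s - 1 / gas_vel s'\<bar> \<le> C * norm (s - s')"
      by (rule order_trans[OF C4(2)[OF s] m(4)[OF n]])
  qed
  then show ?thesis ..
qed

section \<open>Comparing two fields along a characteristic\<close>

text \<open>With characteristics parametrised by position, time is the dependent variable, so
  Lipschitz continuity in time at a fixed position is what Picard iteration asks of the
  slowness.\<close>

lemma reciprocal_velocity_regular:
  assumes src: "lipschitz_sources P B C" and vel: "0 < vmin" "\<And>u. u \<in> B \<Longrightarrow> vmin \<le> gas_vel u"
    and cont: "continuous_on S (\<lambda>(x, t). Z x t)" and Z: "\<And>x s. (x, s) \<in> S \<Longrightarrow> Z x s \<in> B"
    and lip: "\<And>x s t. (x, s) \<in> S \<Longrightarrow> (x, t) \<in> S \<Longrightarrow> norm (Z x s - Z x t) \<le> M * \<bar>s - t\<bar>"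
  shows "continuous_on S (\<lambda>(x, t). 1 / gas_vel (Z x t))"
    and "\<And>x s t. (x, s) \<in> S \<Longrightarrow> (x, t) \<in> S \<Longrightarrow>
      \<bar>1 / gas_vel (Z x s) - 1 / gas_vel (Z x t)\<bar> \<le> C * M * \<bar>s - t\<bar>"
proof -
  have "continuous_on S (\<lambda>z. 1 / gas_vel ((\<lambda>(x, t). Z x t) z))"
  proof (intro continuous_intros continuous_on_gas_vel cont ballI)
    fix z assume "z \<in> S"
    then have "(\<lambda>(x, t). Z x t) z \<in> B" using Z by (cases z) auto
    from vel(2)[OF this] show "gas_vel ((\<lambda>(x, t). Z x t) z) \<noteq> 0" using vel(1) by linarith
  qed
  then show "continuous_on S (\<lambda>(x, t). 1 / gas_vel (Z x t))" by (simp add: split_beta)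
  fix x s t assume st: "(x, s) \<in> S" "(x, t) \<in> S"
  have "\<bar>1 / gas_vel (Z x s) - 1 / gas_vel (Z x t)\<bar> \<le> C * norm (Z x s - Z x t)"
    using src Z[OF st(1)] Z[OF st(2)] by (auto simp: lipschitz_sources_def)
  also have "\<dots> \<le> C * (M * \<bar>s - t\<bar>)"
    using src lip[OF st] by (intro mult_left_mono) (auto simp: lipschitz_sources_def)
  finally show "\<bar>1 / gas_vel (Z x s) - 1 / gas_vel (Z x t)\<bar> \<le> C * M * \<bar>s - t\<bar>" by simp
qed

text \<open>The curves \<open>lo\<close> and \<open>hi\<close> are a subsolution and a supersolution
  of \<open>\<sigma>' = 1 / v\<close>, so the characteristic cannot leave the part of
  \<open>S\<close> between them. In the observer regions one barrier is itself a characteristic and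
  satisfies its inequality with equality.\<close>

lemma forward_characteristic_between:
  assumes src: "lipschitz_sources P B C" and vel: "0 < vmin" "\<And>u. u \<in> B \<Longrightarrow> vmin \<le> gas_vel u"
    and cont: "continuous_on S (\<lambda>(x, t). Z x t)" and Z: "\<And>x s. (x, s) \<in> S \<Longrightarrow> Z x s \<in> B"
    and M: "0 \<le> M"
    and lip: "\<And>x s t. (x, s) \<in> S \<Longrightarrow> (x, t) \<in> S \<Longrightarrow> norm (Z x s - Z x t) \<le> M * \<bar>s - t\<bar>"
    and S: "{(x, y). x \<in> {a..b} \<and> lo x \<le> y \<and> y \<le> hi x} \<subseteq> S"
    and ab: "a \<le> b" and le: "\<And>x. x \<in> {a..b} \<Longrightarrow> lo x \<le> hi x"
    and lo: "\<And>x. x \<in> {a..b} \<Longrightarrow> (lo has_real_derivative lo' x) (at x within {a..b})"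
      "\<And>x. x \<in> {a..b} \<Longrightarrow> lo' x \<le> 1 / gas_vel (Z x (lo x))"
    and hi: "\<And>x. x \<in> {a..b} \<Longrightarrow> (hi has_real_derivative hi' x) (at x within {a..b})"
      "\<And>x. x \<in> {a..b} \<Longrightarrow> 1 / gas_vel (Z x (hi x)) \<le> hi' x"
    and y0: "y0 \<in> {lo a..hi a}"
  shows "\<exists>\<sigma>. \<sigma> a = y0 \<and> (\<forall>x\<in>{a..b}. \<sigma> x \<in> {lo x..hi x} \<and>
    (\<sigma> has_real_derivative 1 / gas_vel (Z x (\<sigma> x))) (at x within {a..b}))"
proof (rule picard_between[OF ab _ _ _ le lo(1) lo(2) hi(1) hi(2) y0])
  show "0 \<le> C * M" using src M by (simp add: lipschitz_sources_def)
  show "continuous_on {(x, y). x \<in> {a..b} \<and> lo x \<le> y \<and> y \<le> hi x} (\<lambda>(x, t). 1 / gas_vel (Z x t))"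
    by (rule continuous_on_subset[OF reciprocal_velocity_regular(1)[OF src vel cont Z lip] S])
  fix x y z assume "x \<in> {a..b}" "y \<in> {lo x..hi x}" "z \<in> {lo x..hi x}"
  then have "(x, y) \<in> S" "(x, z) \<in> S" using S by auto
  then show "\<bar>1 / gas_vel (Z x y) - 1 / gas_vel (Z x z)\<bar> \<le> C * M * \<bar>y - z\<bar>"
    using reciprocal_velocity_regular(2)[where S = S and Z = Z and M = M, OF src vel cont Z lip] by blast
qed

text \<open>The version for curves prescribed at their right end: characteristics followed back in
  time towards the well bottom.\<close>

lemma backward_characteristic_between:
  assumes src: "lipschitz_sources P B C" and vel: "0 < vmin" "\<And>u. u \<in> B \<Longrightarrow> vmin \<le> gas_vel u"
    and cont: "continuous_on S (\<lambda>(x, t). Z x t)" and Z: "\<And>x s. (x, s) \<in> S \<Longrightarrow> Z x s \<in> B"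
    and M: "0 \<le> M"
    and lip: "\<And>x s t. (x, s) \<in> S \<Longrightarrow> (x, t) \<in> S \<Longrightarrow> norm (Z x s - Z x t) \<le> M * \<bar>s - t\<bar>"
    and S: "{(x, y). x \<in> {a..b} \<and> lo x \<le> y \<and> y \<le> hi x} \<subseteq> S"
    and ab: "a \<le> b" and le: "\<And>x. x \<in> {a..b} \<Longrightarrow> lo x \<le> hi x"
    and lo: "\<And>x. x \<in> {a..b} \<Longrightarrow> (lo has_real_derivative lo' x) (at x within {a..b})"
      "\<And>x. x \<in> {a..b} \<Longrightarrow> 1 / gas_vel (Z x (lo x)) \<le> lo' x"
    and hi: "\<And>x. x \<in> {a..b} \<Longrightarrow> (hi has_real_derivative hi' x) (at x within {a..b})"
      "\<And>x. x \<in> {a..b} \<Longrightarrow> hi' x \<le> 1 / gas_vel (Z x (hi x))"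
    and y0: "y0 \<in> {lo b..hi b}"
  shows "\<exists>\<sigma>. \<sigma> b = y0 \<and> (\<forall>x\<in>{a..b}. \<sigma> x \<in> {lo x..hi x} \<and>
    (\<sigma> has_real_derivative 1 / gas_vel (Z x (\<sigma> x))) (at x within {a..b}))"
proof (rule picard_between_backward[OF ab _ _ _ le lo(1) lo(2) hi(1) hi(2) y0])
  show "0 \<le> C * M" using src M by (simp add: lipschitz_sources_def)
  show "continuous_on {(x, y). x \<in> {a..b} \<and> lo x \<le> y \<and> y \<le> hi x} (\<lambda>(x, t). 1 / gas_vel (Z x t))"
    by (rule continuous_on_subset[OF reciprocal_velocity_regular(1)[OF src vel cont Z lip] S])
  fix x y z assume "x \<in> {a..b}" "y \<in> {lo x..hi x}" "z \<in> {lo x..hi x}"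
  then have "(x, y) \<in> S" "(x, z) \<in> S" using S by auto
  then show "\<bar>1 / gas_vel (Z x y) - 1 / gas_vel (Z x z)\<bar> \<le> C * M * \<bar>y - z\<bar>"
    using reciprocal_velocity_regular(2)[where S = S and Z = Z and M = M, OF src vel cont Z lip] by blast
qed

text \<open>A fluid particle entering at \<open>(a, s)\<close> stays above the horizontal line and below the line of
  slowness \<open>1 / vmin\<close>.\<close>

lemma forward_characteristic:
  assumes src: "lipschitz_sources P B C" and vel: "0 < vmin" "\<And>u. u \<in> B \<Longrightarrow> vmin \<le> gas_vel u"
    and cont: "continuous_on ({a..b} \<times> {0..}) (\<lambda>(x, t). Z x t)"
    and Z: "\<And>x s. x \<in> {a..b} \<Longrightarrow> 0 \<le> s \<Longrightarrow> Z x s \<in> B"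
    and M: "0 \<le> M"
    and lip: "\<And>x s t. x \<in> {a..b} \<Longrightarrow> 0 \<le> s \<Longrightarrow> 0 \<le> t \<Longrightarrow> norm (Z x s - Z x t) \<le> M * \<bar>s - t\<bar>"
    and ab: "a \<le> b" and s: "0 \<le> s"
  shows "\<exists>\<sigma>. \<sigma> a = s \<and> (\<forall>x\<in>{a..b}. 0 \<le> \<sigma> x \<and>
    (\<sigma> has_real_derivative 1 / gas_vel (Z x (\<sigma> x))) (at x within {a..b}))"
proof -
  have "\<exists>\<sigma>. \<sigma> a = s \<and> (\<forall>x\<in>{a..b}. \<sigma> x \<in> {s..s + (x - a) / vmin} \<and>
    (\<sigma> has_real_derivative 1 / gas_vel (Z x (\<sigma> x))) (at x within {a..b}))"
  proof (rule forward_characteristic_between[OF src vel cont _ M _ _ ab,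
        where lo' = "\<lambda>_. 0" and hi' = "\<lambda>_. 1 / vmin"])
    fix x assume x: "x \<in> {a..b}"
    have v: "vmin \<le> gas_vel (Z x y)" if "0 \<le> y" for y using vel Z[OF x that] by blast
    have n: "0 \<le> (x - a) / vmin" using x vel by auto
    then show "s \<le> s + (x - a) / vmin" by simp
    show "0 \<le> 1 / gas_vel (Z x s)" using v[OF s] vel by simp
    have "0 \<le> s + (x - a) / vmin" using s n by linarith
    from v[OF this] show "1 / gas_vel (Z x (s + (x - a) / vmin)) \<le> 1 / vmin"
      using vel by (intro divide_left_mono) auto
    show "((\<lambda>x. s + (x - a) / vmin) has_real_derivative 1 / vmin) (at x within {a..b})"
      using vel by (auto intro!: derivative_eq_intros)
  qed (use Z lip s in auto)
  then show ?thesis using s by force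
qed

text \<open>\<open>X\<close> is the field compared against: the steady state with
  \<open>M = 0\<close> in one interpretation, the actual trajectory in the others. The box
  \<open>B\<close> is to contain the values of both compared fields. \<open>M\<close> measures
  variation in time, the cost of moving \<open>X\<close> from one curve to another at the same
  position.\<close>

locale reference_field =
  fixes P :: well and B :: "state set" and C M vmin :: real and X :: "real \<Rightarrow> real \<Rightarrow> state"
  assumes vmin: "0 < vmin" and M: "0 \<le> M" and sources: "lipschitz_sources P B C"
    and B_pres: "\<And>s. s \<in> B \<Longrightarrow> 0 < pres s" and B_vel: "\<And>s. s \<in> B \<Longrightarrow> vmin \<le> gas_vel s"
    and X_cont: "continuous_on ({0..len P} \<times> {0..}) (\<lambda>(x, t). X x t)"
    and X_transport: "broad_transport P ({0..len P} \<times> {0..}) X"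
    and X_B: "\<And>x t. x \<in> {0..len P} \<Longrightarrow> 0 \<le> t \<Longrightarrow> X x t \<in> B"
    and X_lip: "\<And>x s t. x \<in> {0..len P} \<Longrightarrow> 0 \<le> s \<Longrightarrow> 0 \<le> t \<Longrightarrow> norm (X x s - X x t) \<le> M * \<bar>s - t\<bar>"
begin

lemma C: "0 \<le> C"
  using sources by (simp add: lipschitz_sources_def)

text \<open>The costs in \<open>gas_frac_comparison\<close> per unit of the integral
  \<open>J\<close> of the state difference. The sources cost \<open>C\<close> directly. By Gronwall
  the two characteristics differ by at most \<open>C * exp (C * M * len P)\<close> in time; this gap
  costs \<open>C * M * len P\<close> times its size through the sources, and \<open>M\<close> times
  its size when \<open>X\<close> is moved back to \<open>\<sigma>\<close> at the end.\<close>

definition comparison_const :: real where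
  "comparison_const = C + (M + C * M * len P) * (C * exp (C * M * len P))"

lemma comparison_const_nonneg: "0 \<le> len P \<Longrightarrow> 0 \<le> comparison_const"
  unfolding comparison_const_def using C M by auto

text \<open>The gas fraction of \<open>X\<close> need not be differentiable along the characteristic \<open>\<sigma>\<close> of \<open>Z\<close>,
  so it is transported along the characteristic of \<open>X\<close> with the same starting point, and
  the gap between the two curves is controlled by Gronwall's inequality.\<close>

lemma gas_frac_comparison:
  assumes ab: "0 \<le> a" "a \<le> b" "b \<le> len P"
    and tr: "broad_transport P S Z" and cont: "continuous_on S (\<lambda>(x, t). Z x t)"
    and S: "\<And>x. x \<in> {a..b} \<Longrightarrow> (x, \<sigma> x) \<in> S" "\<And>x. x \<in> {a..b} \<Longrightarrow> 0 \<le> \<sigma> x"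
    and S_B: "\<And>x. x \<in> {a..b} \<Longrightarrow> Z x (\<sigma> x) \<in> B"
    and d: "\<And>x. x \<in> {a..b} \<Longrightarrow>
      (\<sigma> has_real_derivative 1 / gas_vel (Z x (\<sigma> x))) (at x within {a..b})"
  defines "h \<equiv> \<lambda>x. gas_frac (Z x (\<sigma> x)) - gas_frac (X x (\<sigma> x))"
  shows "\<bar>h b - h a\<bar> \<le> comparison_const * integral {a..b} (\<lambda>x. norm (Z x (\<sigma> x) - X x (\<sigma> x)))"
proof -
  have sub: "{a..b} \<times> {0..} \<subseteq> {0..len P} \<times> {0..}" using ab by auto
  obtain \<rho> where r: "\<rho> a = \<sigma> a" "\<And>x. x \<in> {a..b} \<Longrightarrow> 0 \<le> \<rho> x"
    "\<And>x. x \<in> {a..b} \<Longrightarrow> (\<rho> has_real_derivative 1 / gas_vel (X x (\<rho> x))) (at x within {a..b})"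
    using forward_characteristic[where Z = X and s = "\<sigma> a", OF sources vmin B_vel
        continuous_on_subset[OF X_cont sub] _ M _ ab(2)] X_B X_lip S(2)[of a] ab by auto
  have L: "x \<in> {a..b} \<Longrightarrow> x \<in> {0..len P}" for x using ab by auto
  note src = sources[unfolded lipschitz_sources_def, THEN conjunct2, rule_format]
  define D where "D x = norm (Z x (\<sigma> x) - X x (\<sigma> x))" for x
  define w where "w x = \<bar>\<sigma> x - \<rho> x\<bar>" for x
  define J where "J = integral {a..b} D"
  have sc: "continuous_on {a..b} \<sigma>" "continuous_on {a..b} \<rho>"
    by (rule DERIV_continuous_on[OF d], assumption, rule DERIV_continuous_on[OF r(3)], assumption)
  have Dc: "continuous_on {a..b} D"
    unfolding D_def
    by (intro continuous_intros continuous_on_curve[OF cont sc(1)] continuous_on_curve[OF X_cont sc(1)])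
      (use S L in auto)
  have wc: "continuous_on {a..b} w" unfolding w_def by (intro continuous_intros sc)
  have D0: "0 \<le> D x" for x by (simp add: D_def)
  have J0: "0 \<le> J" unfolding J_def using D0 by (intro Henstock_Kurzweil_Integration.integral_nonneg integrable_continuous_interval Dc)
  have near: "norm (Z x (\<sigma> x) - X x (\<rho> x)) \<le> D x + M * w x" if x: "x \<in> {a..b}" for x
  proof -
    have "norm (Z x (\<sigma> x) - X x (\<rho> x)) \<le> D x + norm (X x (\<sigma> x) - X x (\<rho> x))"
      unfolding D_def using norm_triangle_ineq[of "Z x (\<sigma> x) - X x (\<sigma> x)" "X x (\<sigma> x) - X x (\<rho> x)"] by simp
    also have "norm (X x (\<sigma> x) - X x (\<rho> x)) \<le> M * w x"
      unfolding w_def by (rule X_lip[OF L[OF x] S(2)[OF x] r(2)[OF x]])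
    finally show ?thesis by simp
  qed
  have near': "C * norm (Z x (\<sigma> x) - X x (\<rho> x)) \<le> C * D x + C * M * w x" if "x \<in> {a..b}" for x
    using mult_left_mono[OF near[OF that] C] by (simp add: algebra_simps)
  have int: "D integrable_on {a..x}" "w integrable_on {a..x}" if "x \<in> {a..b}" for x
    using that by (auto intro!: integrable_continuous_interval intro: continuous_on_subset[OF Dc] continuous_on_subset[OF wc])
  \<comment> \<open>The integral of \<open>D\<close> up to \<open>x\<close> is enlarged to
    \<open>J\<close>, since Gronwall's inequality wants a constant as first summand.\<close>
  have w_le: "w x \<le> C * J + C * M * integral {a..x} w" if x: "x \<in> {a..b}" for x
  proof -
    have "\<bar>(\<sigma> x - \<rho> x) - (\<sigma> a - \<rho> a)\<bar> \<le> integral {a..x} (\<lambda>x. C * D x + C * M * w x)"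
    proof (rule derivative_bound_integral)
      fix y assume "y \<in> {a..x}"
      then have y: "y \<in> {a..b}" and sub: "{a..x} \<subseteq> {a..b}" using x by auto
      show "((\<lambda>y. \<sigma> y - \<rho> y) has_real_derivative
          1 / gas_vel (Z y (\<sigma> y)) - 1 / gas_vel (X y (\<rho> y))) (at y within {a..x})"
        by (rule DERIV_subset[OF DERIV_diff[OF d[OF y] r(3)[OF y]] sub])
      show "\<bar>1 / gas_vel (Z y (\<sigma> y)) - 1 / gas_vel (X y (\<rho> y))\<bar> \<le> C * D y + C * M * w y"
        using src[OF S_B[OF y] X_B[OF L[OF y] r(2)[OF y]]] near'[OF y] by linarith
    qed (use x int[OF x] in \<open>auto intro!: integrable_add integrable_on_mult_right\<close>)
    also have "\<dots> = C * integral {a..x} D + C * M * integral {a..x} w"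
      using int[OF x] by (subst integral_add) (auto intro!: integrable_on_mult_right)
    finally have "w x \<le> C * integral {a..x} D + C * M * integral {a..x} w"
      using r(1) by (simp add: w_def[of x])
    moreover have "integral {a..x} D \<le> J"
      unfolding J_def using x D0 int[OF x] int[of b] by (intro integral_subset_le) auto
    then have "C * integral {a..x} D \<le> C * J" using C by (rule mult_left_mono)
    ultimately show ?thesis by linarith
  qed
  define W where "W = C * J * exp (C * M * len P)"
  have wW: "w x \<le> W" if x: "x \<in> {a..b}" for x
  proof -
    have "w x \<le> C * J * exp (C * M * (x - a))"
      using gronwall[OF wc _ w_le x] C M by simp
    also have "\<dots> \<le> W" unfolding W_def
      using x ab C M J0 by (auto intro!: mult_left_mono)
    finally show ?thesis .
  qed
  have tr1: "((\<lambda>x. gas_frac (Z x (\<sigma> x))) has_real_derivative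
      E_G P (Z x (\<sigma> x)) / gas_vel (Z x (\<sigma> x))) (at x within {a..b})" if x: "x \<in> {a..b}" for x
  proof (rule broad_transport_along_curve[OF tr cont S(1) _ _ d x])
    fix y assume y: "y \<in> {a..b}"
    show "0 < pres (Z y (\<sigma> y))" "0 < gas_vel (Z y (\<sigma> y))"
      using B_pres[OF S_B[OF y]] B_vel[OF S_B[OF y]] vmin by auto
  qed
  have tr2: "((\<lambda>x. gas_frac (X x (\<rho> x))) has_real_derivative
      E_G P (X x (\<rho> x)) / gas_vel (X x (\<rho> x))) (at x within {a..b})" if x: "x \<in> {a..b}" for x
  proof (rule broad_transport_along_curve[OF X_transport X_cont _ _ _ r(3) x])
    fix y assume y: "y \<in> {a..b}"
    show "(y, \<rho> y) \<in> {0..len P} \<times> {0..}" using L[OF y] r(2)[OF y] by simp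
    show "0 < pres (X y (\<rho> y))" "0 < gas_vel (X y (\<rho> y))"
      using B_pres[OF X_B[OF L[OF y] r(2)[OF y]]] B_vel[OF X_B[OF L[OF y] r(2)[OF y]]] vmin by auto
  qed
  have "\<bar>(gas_frac (Z b (\<sigma> b)) - gas_frac (X b (\<rho> b))) - (gas_frac (Z a (\<sigma> a)) - gas_frac (X a (\<rho> a)))\<bar>
      \<le> integral {a..b} (\<lambda>x. C * D x + C * M * w x)"
  proof (rule derivative_bound_integral[OF ab(2) DERIV_diff[OF tr1 tr2]])
    fix x assume x: "x \<in> {a..b}"
    show "\<bar>E_G P (Z x (\<sigma> x)) / gas_vel (Z x (\<sigma> x)) - E_G P (X x (\<rho> x)) / gas_vel (X x (\<rho> x))\<bar>
        \<le> C * D x + C * M * w x"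
      using src[OF S_B[OF x] X_B[OF L[OF x] r(2)[OF x]]] near'[OF x] by linarith
  qed (use int[of b] ab in \<open>auto intro!: integrable_add integrable_on_mult_right\<close>)
  also have "\<dots> = C * J + C * M * integral {a..b} w"
    unfolding J_def using int[of b] ab by (subst integral_add) (auto intro!: integrable_on_mult_right)
  finally have 0: "\<bar>(gas_frac (Z b (\<sigma> b)) - gas_frac (X b (\<rho> b))) - h a\<bar>
      \<le> C * J + C * M * integral {a..b} w"
    unfolding h_def r(1) .
  have "integral {a..b} w \<le> integral {a..b} (\<lambda>_. W)"
    using int[of b] ab wW by (intro integral_le) auto
  also have "\<dots> = (b - a) * W" using ab by simp
  also have "\<dots> \<le> len P * W"
    using ab order_trans[OF abs_ge_zero wW[of a, unfolded w_def]] by (intro mult_right_mono) auto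
  finally have "C * M * integral {a..b} w \<le> C * M * (len P * W)"
    using C M by (intro mult_left_mono) auto
  then have 1: "\<bar>(gas_frac (Z b (\<sigma> b)) - gas_frac (X b (\<rho> b))) - h a\<bar> \<le> C * J + C * M * (len P * W)"
    using 0 by linarith
  have b: "b \<in> {a..b}" using ab by simp
  \<comment> \<open>The transported gas fraction of \<open>X\<close> arrives at
    \<open>(b, \<rho> b)\<close>, whereas \<open>h\<close> evaluates both fields at
    \<open>(b, \<sigma> b)\<close>.\<close>
  have "\<bar>gas_frac (X b (\<sigma> b)) - gas_frac (X b (\<rho> b))\<bar> \<le> M * w b"
    using abs_gas_frac_diff_le[of "X b (\<sigma> b)" "X b (\<rho> b)"] X_lip[OF L[OF b] S(2)[OF b] r(2)[OF b]]
    by (simp add: w_def)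
  also have "\<dots> \<le> M * W" using wW[OF b] M by (rule mult_left_mono)
  finally have "\<bar>h b - h a\<bar> \<le> C * J + C * M * (len P * W) + M * W"
    using 1 by (simp add: h_def)
  also have "\<dots> = comparison_const * J"
    unfolding comparison_const_def W_def by (simp add: algebra_simps)
  finally show ?thesis by (simp add: J_def D_def[abs_def])
qed

end

text \<open>The form in which contractions are exploited: the supremum \<open>N\<close> satisfies
  \<open>N \<le> c + N / 2\<close>, and being finite it can be absorbed on the left. The value of
  \<open>b\<close> does not enter the conclusion, so a crude bound suffices.\<close>

lemma bounded_by_halving:
  fixes f :: "'a \<Rightarrow> real"
  assumes b: "\<And>z. z \<in> S \<Longrightarrow> f z \<le> b"
    and step: "\<And>N z. (\<And>y. y \<in> S \<Longrightarrow> f y \<le> N) \<Longrightarrow> z \<in> S \<Longrightarrow> f z \<le> c + N / 2"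
    and z: "z \<in> S"
  shows "f z \<le> 2 * c"
proof -
  define N where "N = Sup (f ` S)"
  have bdd: "bdd_above (f ` S)" using b by (intro bdd_aboveI2[of S f b]) auto
  have le: "f y \<le> N" if "y \<in> S" for y unfolding N_def using bdd that by (rule cSUP_upper2) simp
  have "N \<le> c + N / 2"
    unfolding N_def[symmetric] by (subst N_def, rule cSUP_least) (use z step[OF le] in auto)
  then show ?thesis using le[OF z] by simp
qed

context reference_field
begin

section \<open>Differences of pressure and velocity on horizontal segments\<close>

lemma integral_source_comparison:
  fixes f :: "state \<Rightarrow> real"
  assumes x: "0 \<le> x" "x \<le> z" "z \<le> len P" and s: "0 \<le> s"
    and cont: "continuous_on {x..z} (\<lambda>\<xi>. Z \<xi> s)"
    and S_B: "\<And>\<xi>. \<xi> \<in> {x..z} \<Longrightarrow> Z \<xi> s \<in> B"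
    and f_cont: "\<And>T g. continuous_on T g \<Longrightarrow> (\<And>\<xi>. \<xi> \<in> T \<Longrightarrow> g \<xi> \<in> B) \<Longrightarrow> continuous_on (T :: real set) (\<lambda>\<xi>. f (g \<xi>))"
    and f_lip: "\<And>u u'. u \<in> B \<Longrightarrow> u' \<in> B \<Longrightarrow> \<bar>f u - f u'\<bar> \<le> C * norm (u - u')"
  shows "\<bar>integral {x..z} (\<lambda>\<xi>. f (Z \<xi> s)) - integral {x..z} (\<lambda>\<xi>. f (X \<xi> s))\<bar>
    \<le> C * integral {x..z} (\<lambda>\<xi>. norm (Z \<xi> s - X \<xi> s))"
proof -
  have X: "X \<xi> s \<in> B" if "\<xi> \<in> {x..z}" for \<xi> using X_B that x s by auto
  have Xc: "continuous_on {x..z} (\<lambda>\<xi>. X \<xi> s)"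
    by (rule continuous_on_curve[OF X_cont]) (use x s in \<open>auto intro!: continuous_intros\<close>)
  have i: "(\<lambda>\<xi>. f (Z \<xi> s)) integrable_on {x..z}" "(\<lambda>\<xi>. f (X \<xi> s)) integrable_on {x..z}"
    by (intro integrable_continuous_interval f_cont cont Xc S_B X; assumption)+
  have "norm (integral {x..z} (\<lambda>\<xi>. f (Z \<xi> s) - f (X \<xi> s)))
      \<le> integral {x..z} (\<lambda>\<xi>. C * norm (Z \<xi> s - X \<xi> s))"
  proof (rule integral_norm_bound_integral)
    show "(\<lambda>\<xi>. C * norm (Z \<xi> s - X \<xi> s)) integrable_on {x..z}"
      by (intro integrable_continuous_interval continuous_intros cont Xc)
  qed (use i f_lip S_B X in \<open>auto intro!: integrable_diff\<close>)
  then show ?thesis using i by (simp add: integral_diff)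
qed

lemma pressure_velocity_comparison:
  assumes x: "0 \<le> x" "x \<le> z" "z \<le> len P" and s: "0 \<le> s"
    and cont: "continuous_on {x..z} (\<lambda>\<xi>. Z \<xi> s)"
    and S_B: "\<And>\<xi>. \<xi> \<in> {x..z} \<Longrightarrow> Z \<xi> s \<in> B"
    and p: "pres (Z x s) = pres (Z z s) + integral {x..z} (\<lambda>\<xi>. grav_term P (Z \<xi> s) + fric_term P (Z \<xi> s))"
      "pres (X x s) = pres (X z s) + integral {x..z} (\<lambda>\<xi>. grav_term P (X \<xi> s) + fric_term P (X \<xi> s))"
    and v: "gas_vel (Z x s) = gas_vel (Z z s) - integral {x..z} (\<lambda>\<xi>. dv_dx P (Z \<xi> s))"
      "gas_vel (X x s) = gas_vel (X z s) - integral {x..z} (\<lambda>\<xi>. dv_dx P (X \<xi> s))"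
    and b: "integral {x..z} (\<lambda>\<xi>. norm (Z \<xi> s - X \<xi> s)) \<le> J"
  shows "\<bar>pres (Z x s) - pres (X x s)\<bar> \<le> norm (Z z s - X z s) + C * J"
    and "\<bar>gas_vel (Z x s) - gas_vel (X x s)\<bar> \<le> norm (Z z s - X z s) + C * J"
proof -
  note src = sources[unfolded lipschitz_sources_def, THEN conjunct2, rule_format]
  have J: "C * integral {x..z} (\<lambda>\<xi>. norm (Z \<xi> s - X \<xi> s)) \<le> C * J"
    using b C by (rule mult_left_mono)
  have e: "grav_term P u + fric_term P u = - dp_dx P u" for u by (simp add: dp_dx_def)
  have "\<bar>integral {x..z} (\<lambda>\<xi>. grav_term P (Z \<xi> s) + fric_term P (Z \<xi> s))
      - integral {x..z} (\<lambda>\<xi>. grav_term P (X \<xi> s) + fric_term P (X \<xi> s))\<bar>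
      \<le> C * integral {x..z} (\<lambda>\<xi>. norm (Z \<xi> s - X \<xi> s))"
    unfolding e
    by (rule integral_source_comparison[where f = "\<lambda>u. - dp_dx P u" and Z = Z, OF x s cont S_B])
      (use src in \<open>auto intro!: continuous_intros continuous_on_dp_dx simp: abs_minus_commute\<close>)
  then show "\<bar>pres (Z x s) - pres (X x s)\<bar> \<le> norm (Z z s - X z s) + C * J"
    using abs_pres_diff_le[of "Z z s" "X z s"] J unfolding p by linarith
  have "\<bar>integral {x..z} (\<lambda>\<xi>. dv_dx P (Z \<xi> s)) - integral {x..z} (\<lambda>\<xi>. dv_dx P (X \<xi> s))\<bar>
      \<le> C * integral {x..z} (\<lambda>\<xi>. norm (Z \<xi> s - X \<xi> s))"
  proof (rule integral_source_comparison[where f = "dv_dx P" and Z = Z, OF x s cont S_B])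
    fix T :: "real set" and g
    assume g: "continuous_on T g" "\<And>\<xi>. \<xi> \<in> T \<Longrightarrow> g \<xi> \<in> B"
    show "continuous_on T (\<lambda>\<xi>. dv_dx P (g \<xi>))"
    proof (rule continuous_on_dv_dx[OF g(1)])
      fix \<xi> assume "\<xi> \<in> T"
      from B_pres[OF g(2)[OF this]] show "pres (g \<xi>) \<noteq> 0" by linarith
    qed
  qed (use src in auto)
  then show "\<bar>gas_vel (Z x s) - gas_vel (X x s)\<bar> \<le> norm (Z z s - X z s) + C * J"
    using abs_gas_vel_diff_le[of "Z z s" "X z s"] J unfolding v by linarith
qed

text \<open>The gas fraction contributes \<open>comparison_const\<close>, pressure and velocity
  contribute \<open>C\<close> each. Twice their sum brings the factor gained from the weight down to
  one half, as \<open>bounded_by_halving\<close> requires; the added 1 keeps the rate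
  positive.\<close>

definition backward_rate :: real where
  "backward_rate = 2 * (comparison_const + 2 * C) + 1"

text \<open>The deviation is measured with the weight \<open>exp (\<mu> x)\<close>: integrating over \<open>[x, L]\<close> then gains
  a factor \<open>1 / \<mu>\<close>.\<close>

lemma backward_stability:
  assumes S: "S \<subseteq> {0..len P} \<times> {0..}"
    and tr: "broad_transport P S Z" and cont: "continuous_on S (\<lambda>(x, t). Z x t)"
    and S_B: "\<And>x s. (x, s) \<in> S \<Longrightarrow> Z x s \<in> B"
    and horizontal: "\<And>x y s. (x, s) \<in> S \<Longrightarrow> y \<in> {x..len P} \<Longrightarrow> (y, s) \<in> S"
    and char: "\<And>x s. (x, s) \<in> S \<Longrightarrow> \<exists>\<sigma>. \<sigma> x = s \<and> (\<forall>y\<in>{x..len P}. (y, \<sigma> y) \<in> S \<and>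
      (\<sigma> has_real_derivative 1 / gas_vel (Z y (\<sigma> y))) (at y within {x..len P}))"
    and p1: "\<And>x s. (x, s) \<in> S \<Longrightarrow> pres (Z x s) = pres (Z (len P) s)
      + integral {x..len P} (\<lambda>\<xi>. grav_term P (Z \<xi> s) + fric_term P (Z \<xi> s))"
    and v1: "\<And>x s. (x, s) \<in> S \<Longrightarrow> gas_vel (Z x s) = gas_vel (Z (len P) s)
      - integral {x..len P} (\<lambda>\<xi>. dv_dx P (Z \<xi> s))"
    and p: "\<And>x s. (x, s) \<in> S \<Longrightarrow> pres (X x s) = pres (X (len P) s)
      + integral {x..len P} (\<lambda>\<xi>. grav_term P (X \<xi> s) + fric_term P (X \<xi> s))"
    and v: "\<And>x s. (x, s) \<in> S \<Longrightarrow> gas_vel (X x s) = gas_vel (X (len P) s)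
      - integral {x..len P} (\<lambda>\<xi>. dv_dx P (X \<xi> s))"
    and top: "\<And>s. (len P, s) \<in> S \<Longrightarrow> norm (Z (len P) s - X (len P) s) \<le> \<delta>"
    and bdd: "\<And>x s. (x, s) \<in> S \<Longrightarrow> norm (Z x s - X x s) \<le> b"
    and xs: "(x, s) \<in> S"
  shows "norm (Z x s - X x s) \<le> 6 * \<delta> * exp (backward_rate * len P)"
proof -
  have L: "0 \<le> len P" using S xs by auto
  define m where "m = backward_rate"
  have m: "0 < m" "2 * (comparison_const + 2 * C) \<le> m"
    using comparison_const_nonneg[OF L] C by (auto simp: m_def backward_rate_def)
  define D where "D x s = norm (Z x s - X x s)" for x s
  have D0: "0 \<le> D x s" for x s by (simp add: D_def)
  have "(\<lambda>(x, s). D x s * exp (m * x)) (x, s) \<le> 2 * (3 * \<delta> * exp (m * len P))"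
  proof (rule bounded_by_halving[OF _ _ xs])
    fix z assume "z \<in> S"
    moreover obtain x s where z: "z = (x, s)" by (cases z)
    ultimately have xs: "(x, s) \<in> S" by simp
    then have x: "0 \<le> x" "x \<le> len P" "0 \<le> b"
      using S order_trans[OF norm_ge_zero bdd[OF xs]] by auto
    have "D x s * exp (m * x) \<le> b * exp (m * len P)"
      using x m bdd[OF xs] by (intro mult_mono) (auto simp: D_def)
    then show "(\<lambda>(x, s). D x s * exp (m * x)) z \<le> b * exp (m * len P)" by (simp add: z)
  next
    fix N z assume N: "\<And>y. y \<in> S \<Longrightarrow> (\<lambda>(x, s). D x s * exp (m * x)) y \<le> N" and "z \<in> S"
    moreover obtain x s where z: "z = (x, s)" by (cases z)
    ultimately have xs: "(x, s) \<in> S" by simp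
    have x: "0 \<le> x" "x \<le> len P" "0 \<le> s" using S xs by auto
    have DN: "D y r \<le> N * exp (- m * y)" if "(y, r) \<in> S" for y r
    proof -
      have "D y r * exp (m * y) * exp (- m * y) \<le> N * exp (- m * y)"
        using N[OF that] by (intro mult_right_mono) auto
      then show ?thesis by (simp add: mult.assoc flip: exp_add)
    qed
    have "0 \<le> D x s * exp (m * x)" using D0 by simp
    then have N0: "0 \<le> N" using N[OF xs] by simp
    define J where "J = N * exp (- m * x) / m"
    \<comment> \<open>The weight depends on position alone, so one bound serves every curve in
      \<open>S\<close>; it is used on the horizontal line and on the characteristic through
      \<open>(x, s)\<close>.\<close>
    have J: "integral {x..len P} (\<lambda>y. D y (\<sigma> y)) \<le> J"
      if "\<And>y. y \<in> {x..len P} \<Longrightarrow> (y, \<sigma> y) \<in> S" "continuous_on {x..len P} \<sigma>" for \<sigma>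
    proof -
      note he = has_integral_exp_affine[OF x(2), of "- m" 0]
      have "integral {x..len P} (\<lambda>y. D y (\<sigma> y)) \<le> integral {x..len P} (\<lambda>y. N * exp (- m * y + 0))"
      proof (rule integral_le)
        show "(\<lambda>y. D y (\<sigma> y)) integrable_on {x..len P}"
          unfolding D_def using that S x(1)
          by (intro integrable_continuous_interval continuous_intros
              continuous_on_curve[OF cont] continuous_on_curve[OF X_cont]) auto
        show "(\<lambda>y. N * exp (- m * y + 0)) integrable_on {x..len P}"
          by (intro integrable_continuous_interval continuous_intros)
      qed (use DN that in auto)
      also have "\<dots> = N * ((exp (- m * len P + 0) - exp (- m * x + 0)) / - m)"
        using he m by (intro integral_unique has_integral_mult_right) auto
      also have "\<dots> = N * ((exp (- m * x) - exp (- m * len P)) / m)"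
        using m by (simp add: field_simps)
      also have "\<dots> \<le> N * (exp (- m * x) / m)"
        using N0 m by (intro mult_left_mono divide_right_mono) auto
      finally show ?thesis by (simp add: J_def)
    qed
    have top_s: "(len P, s) \<in> S" using horizontal[OF xs] x by auto
    have cs: "continuous_on {x..len P} (\<lambda>y. Z y s)"
      by (rule continuous_on_curve[OF cont])
        (use horizontal[OF xs] in \<open>auto intro!: continuous_intros\<close>)
    have Js: "integral {x..len P} (\<lambda>y. norm (Z y s - X y s)) \<le> J"
      using J[of "\<lambda>_. s"] horizontal[OF xs] by (simp add: D_def)
    have pv: "\<bar>pres (Z x s) - pres (X x s)\<bar> \<le> norm (Z (len P) s - X (len P) s) + C * J"
      "\<bar>gas_vel (Z x s) - gas_vel (X x s)\<bar> \<le> norm (Z (len P) s - X (len P) s) + C * J"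
      using pressure_velocity_comparison[of x "len P" s Z J, OF x(1,2) order_refl x(3) cs
          S_B[OF horizontal[OF xs]] p1[OF xs] p[OF xs] v1[OF xs] v[OF xs] Js] by blast+
    obtain \<sigma> where sg: "\<sigma> x = s" "\<And>y. y \<in> {x..len P} \<Longrightarrow> (y, \<sigma> y) \<in> S"
      "\<And>y. y \<in> {x..len P} \<Longrightarrow> (\<sigma> has_real_derivative 1 / gas_vel (Z y (\<sigma> y))) (at y within {x..len P})"
      using char[OF xs] by blast
    have sc: "continuous_on {x..len P} \<sigma>" using sg(3) by (rule DERIV_continuous_on)
    let ?h = "\<lambda>y. gas_frac (Z y (\<sigma> y)) - gas_frac (X y (\<sigma> y))"
    have "\<bar>?h (len P) - ?h x\<bar> \<le> comparison_const * integral {x..len P} (\<lambda>y. norm (Z y (\<sigma> y) - X y (\<sigma> y)))"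
      by (rule gas_frac_comparison[OF x(1,2) order_refl tr cont])
        (use sg S S_B in auto)
    also have "\<dots> \<le> comparison_const * J"
      using J[OF sg(2) sc] comparison_const_nonneg[OF L] by (intro mult_left_mono) (auto simp: D_def)
    finally have 1: "\<bar>?h (len P) - ?h x\<bar> \<le> comparison_const * J" .
    have top_\<sigma>: "(len P, \<sigma> (len P)) \<in> S" using sg(2) x by auto
    have "\<bar>?h (len P)\<bar> \<le> \<delta>"
      using abs_gas_frac_diff_le[of "Z (len P) (\<sigma> (len P))" "X (len P) (\<sigma> (len P))"] top[OF top_\<sigma>] by linarith
    then have "\<bar>gas_frac (Z x s) - gas_frac (X x s)\<bar> \<le> \<delta> + comparison_const * J"
      using 1 unfolding sg(1) by linarith
    \<comment> \<open>Each component inherits one \<delta> from the top: the gas fraction at time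
      \<open>\<sigma> (len P)\<close>, pressure and velocity at time \<open>s\<close>.\<close>
    then have "D x s \<le> 3 * \<delta> + (comparison_const + 2 * C) * J"
      using norm_state_diff_le[of "Z x s" "X x s"] pv top[OF top_s]
      unfolding D_def distrib_right by linarith
    then have "D x s * exp (m * x) \<le> (3 * \<delta> + (comparison_const + 2 * C) * J) * exp (m * x)"
      by (intro mult_right_mono) auto
    also have "\<dots> = 3 * \<delta> * exp (m * x) + (comparison_const + 2 * C) / m * N"
      unfolding J_def by (simp add: algebra_simps add_divide_distrib flip: exp_add)
    also have "3 * \<delta> * exp (m * x) \<le> 3 * \<delta> * exp (m * len P)"
      using x m top[OF top_s] norm_ge_zero[of "Z (len P) s - X (len P) s"]
      by (intro mult_left_mono) (auto simp del: norm_ge_zero)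
    also have "(comparison_const + 2 * C) / m * N \<le> 1 / 2 * N"
      using m N0 by (intro mult_right_mono) (auto simp: field_simps)
    finally show "(\<lambda>(x, s). D x s * exp (m * x)) z \<le> 3 * \<delta> * exp (m * len P) + N / 2"
      by (simp add: z)
  qed
  then have le: "D x s * exp (m * x) \<le> 6 * \<delta> * exp (m * len P)" by simp
  have "D x s * 1 \<le> D x s * exp (m * x)"
    using S xs m D0 by (intro mult_left_mono) auto
  then show ?thesis using le by (simp add: D_def m_def)
qed

text \<open>On the region above the characteristic, gas fractions are transported from \<open>x = 0\<close>, where they
  depend on the pressure at the same time, and pressures are integrated from the characteristic.
  The weight \<open>exp (\<mu> x - \<lambda> s)\<close> handles both directions once \<open>\<lambda>\<close> dominates \<open>\<mu>\<close> times the largest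
  velocity \<open>R\<close>.\<close>

lemma forward_uniqueness:
  assumes S: "S \<subseteq> {0..len P} \<times> {0..}"
    and tr: "broad_transport P S Z" and cont: "continuous_on S (\<lambda>(x, t). Z x t)"
    and S_B: "\<And>x s. (x, s) \<in> S \<Longrightarrow> Z x s \<in> B"
    and R: "\<And>u. u \<in> B \<Longrightarrow> gas_vel u \<le> R"
    and line: "\<And>x s. (x, s) \<in> S \<Longrightarrow> \<exists>z\<in>{x..len P}. (\<forall>y\<in>{x..z}. (y, s) \<in> S) \<and> Z z s = X z s \<and>
      pres (Z x s) = pres (Z z s) + integral {x..z} (\<lambda>\<xi>. grav_term P (Z \<xi> s) + fric_term P (Z \<xi> s)) \<and>
      pres (X x s) = pres (X z s) + integral {x..z} (\<lambda>\<xi>. grav_term P (X \<xi> s) + fric_term P (X \<xi> s)) \<and>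
      gas_vel (Z x s) = gas_vel (Z z s) - integral {x..z} (\<lambda>\<xi>. dv_dx P (Z \<xi> s)) \<and>
      gas_vel (X x s) = gas_vel (X z s) - integral {x..z} (\<lambda>\<xi>. dv_dx P (X \<xi> s))"
    and char: "\<And>x s. (x, s) \<in> S \<Longrightarrow> \<exists>\<sigma>. \<sigma> x = s \<and> (\<forall>y\<in>{0..x}. (y, \<sigma> y) \<in> S \<and>
      (\<sigma> has_real_derivative 1 / gas_vel (Z y (\<sigma> y))) (at y within {0..x}))"
    and inflow: "0 \<le> E" "\<And>s. (0, s) \<in> S \<Longrightarrow>
      \<bar>gas_frac (Z 0 s) - gas_frac (X 0 s)\<bar> \<le> E * \<bar>pres (Z 0 s) - pres (X 0 s)\<bar>"
    and bdd: "\<And>x s. (x, s) \<in> S \<Longrightarrow> norm (Z x s - X x s) \<le> b"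
    and xs: "(x, s) \<in> S"
  shows "Z x s = X x s"
proof -
  have L: "0 \<le> len P" using S xs by auto
  \<comment> \<open>The summands stand for pressure and velocity, for transport, and for the inflow,
    where \<open>E\<close> turns a pressure error at the bottom into a gas fraction error.\<close>
  define K where "K = 2 * C + comparison_const + E * C"
  define m where "m = 2 * K + 1"
  have K: "0 \<le> K"
    using comparison_const_nonneg[OF L] C inflow(1) by (auto simp: K_def)
  then have m: "0 < m" "2 * K \<le> m" by (auto simp: m_def)
  have R0: "0 < R" using B_vel[OF S_B[OF xs]] R[OF S_B[OF xs]] vmin by linarith
  \<comment> \<open>The slowness is at least \<open>1 / R\<close>, so going back a distance
    \<open>d\<close> along a characteristic lowers \<open>l * s\<close> by at least
    \<open>2 * m * d\<close>. One half of this outweighs the loss in the spatial weight; the other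
    half leaves decay at rate \<open>m\<close>.\<close>
  define l where "l = 2 * m * R"
  have l: "0 < l" using m R0 by (simp add: l_def)
  define D where "D x s = norm (Z x s - X x s)" for x s
  have D0: "0 \<le> D x s" for x s by (simp add: D_def)
  have D_cont: "continuous_on T (\<lambda>y. D y (\<sigma> y))"
    if "\<And>y. y \<in> T \<Longrightarrow> (y, \<sigma> y) \<in> S" "continuous_on T \<sigma>" for \<sigma> T
  proof -
    have "(y, \<sigma> y) \<in> {0..len P} \<times> {0..}" if "y \<in> T" for y
      using S \<open>y \<in> T \<Longrightarrow> (y, \<sigma> y) \<in> S\<close> that by blast
    then show ?thesis
      unfolding D_def
      by (intro continuous_intros continuous_on_curve[OF cont] continuous_on_curve[OF X_cont] that)
  qed
  \<comment> \<open>The fields agree where the horizontal integrals start and obey the same inflow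
    law, so there is no inhomogeneous term: halving with \<open>c = 0\<close>.\<close>
  have "(\<lambda>(x, s). D x s * exp (m * x - l * s)) (x, s) \<le> 2 * 0"
  proof (rule bounded_by_halving[OF _ _ xs])
    fix z assume "z \<in> S"
    moreover obtain x s where z: "z = (x, s)" by (cases z)
    ultimately have xs: "(x, s) \<in> S" by simp
    then have x: "x \<le> len P" "0 \<le> s" "0 \<le> b" using S order_trans[OF norm_ge_zero bdd[OF xs]] by auto
    have "m * x \<le> m * len P" "0 \<le> l * s" using x m l by auto
    then have "m * x - l * s \<le> m * len P" by linarith
    then show "(\<lambda>(x, s). D x s * exp (m * x - l * s)) z \<le> b * exp (m * len P)"
      unfolding z prod.case using bdd[OF xs] x(3) by (intro mult_mono) (auto simp: D_def)
  next
    fix N z assume N: "\<And>y. y \<in> S \<Longrightarrow> (\<lambda>(x, s). D x s * exp (m * x - l * s)) y \<le> N" and "z \<in> S"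
    moreover obtain x s where z: "z = (x, s)" by (cases z)
    ultimately have xs: "(x, s) \<in> S" by simp
    have x: "0 \<le> x" "x \<le> len P" "0 \<le> s" using S xs by auto
    have DN: "D y r \<le> N * exp (l * r - m * y)" if "(y, r) \<in> S" for y r
    proof -
      have "D y r * exp (m * y - l * r) * exp (l * r - m * y) \<le> N * exp (l * r - m * y)"
        using N[OF that] by (intro mult_right_mono) auto
      then show ?thesis by (simp add: mult.assoc flip: exp_add)
    qed
    have "0 \<le> D x s * exp (m * x - l * s)" using D0 by simp
    then have N0: "0 \<le> N" using N[OF xs] by simp
    have pv: "\<bar>pres (Z y r) - pres (X y r)\<bar> \<le> C * (N * exp (l * r - m * y) / m)"
      "\<bar>gas_vel (Z y r) - gas_vel (X y r)\<bar> \<le> C * (N * exp (l * r - m * y) / m)"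
      if yr: "(y, r) \<in> S" for y r
    proof -
      obtain z where z: "z \<in> {y..len P}" "\<And>u. u \<in> {y..z} \<Longrightarrow> (u, r) \<in> S" "Z z r = X z r"
        and p: "pres (Z y r) = pres (Z z r) + integral {y..z} (\<lambda>\<xi>. grav_term P (Z \<xi> r) + fric_term P (Z \<xi> r))"
          "pres (X y r) = pres (X z r) + integral {y..z} (\<lambda>\<xi>. grav_term P (X \<xi> r) + fric_term P (X \<xi> r))"
        and v: "gas_vel (Z y r) = gas_vel (Z z r) - integral {y..z} (\<lambda>\<xi>. dv_dx P (Z \<xi> r))"
          "gas_vel (X y r) = gas_vel (X z r) - integral {y..z} (\<lambda>\<xi>. dv_dx P (X \<xi> r))"
        using line[OF yr] by blast
      have yz: "0 \<le> y" "y \<le> z" "z \<le> len P" "0 \<le> r" using z(1) S yr by auto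
      note he = has_integral_exp_affine[OF yz(2), of "- m" "l * r"]
      have "integral {y..z} (\<lambda>u. D u r) \<le> integral {y..z} (\<lambda>u. N * exp (- m * u + l * r))"
      proof (rule integral_le)
        show "(\<lambda>u. D u r) integrable_on {y..z}"
          by (intro integrable_continuous_interval D_cont z(2) continuous_intros)
        show "(\<lambda>u. N * exp (- m * u + l * r)) integrable_on {y..z}"
          by (intro integrable_continuous_interval continuous_intros)
        fix u assume "u \<in> {y..z}"
        from DN[OF z(2)[OF this]] show "D u r \<le> N * exp (- m * u + l * r)"
          by (simp add: algebra_simps)
      qed
      also have "\<dots> = N * ((exp (- m * z + l * r) - exp (- m * y + l * r)) / - m)"
        using he m by (intro integral_unique has_integral_mult_right) auto
      also have "\<dots> = N * ((exp (- m * y + l * r) - exp (- m * z + l * r)) / m)"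
        using m by (simp add: field_simps)
      also have "\<dots> \<le> N * (exp (- m * y + l * r) / m)"
        using N0 m by (intro mult_left_mono divide_right_mono) auto
      also have "\<dots> = N * exp (l * r - m * y) / m" by (simp add: algebra_simps)
      finally have J: "integral {y..z} (\<lambda>u. norm (Z u r - X u r)) \<le> N * exp (l * r - m * y) / m"
        by (simp add: D_def)
      have c: "continuous_on {y..z} (\<lambda>u. Z u r)"
        by (rule continuous_on_curve[OF cont]) (use z(2) in \<open>auto intro!: continuous_intros\<close>)
      show "\<bar>pres (Z y r) - pres (X y r)\<bar> \<le> C * (N * exp (l * r - m * y) / m)"
        using pressure_velocity_comparison(1)[of y z r Z, OF yz c S_B[OF z(2)] p v J] z(3) by simp
      show "\<bar>gas_vel (Z y r) - gas_vel (X y r)\<bar> \<le> C * (N * exp (l * r - m * y) / m)"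
        using pressure_velocity_comparison(2)[of y z r Z, OF yz c S_B[OF z(2)] p v J] z(3) by simp
    qed
    obtain \<sigma> where sg: "\<sigma> x = s" "\<And>y. y \<in> {0..x} \<Longrightarrow> (y, \<sigma> y) \<in> S"
      "\<And>y. y \<in> {0..x} \<Longrightarrow> (\<sigma> has_real_derivative 1 / gas_vel (Z y (\<sigma> y))) (at y within {0..x})"
      using char[OF xs] by blast
    have sc: "continuous_on {0..x} \<sigma>" using sg(3) by (rule DERIV_continuous_on)
    have early: "l * \<sigma> y \<le> l * s - 2 * m * (x - y)" if y: "y \<in> {0..x}" for y
    proof -
      have "\<sigma> y + (x - y) / R - \<sigma> x \<le> 0"
      proof (rule nonpos_of_derivative_nonpos_where_pos[of y x "\<lambda>u. \<sigma> y + (u - y) / R - \<sigma> u"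
            "\<lambda>u. 1 / R - 1 / gas_vel (Z u (\<sigma> u))"])
        fix u assume "u \<in> {y..x}"
        then have u: "u \<in> {0..x}" and sub: "{y..x} \<subseteq> {0..x}" using y by auto
        show "((\<lambda>u. \<sigma> y + (u - y) / R - \<sigma> u) has_real_derivative
            1 / R - 1 / gas_vel (Z u (\<sigma> u))) (at u within {y..x})"
          using R0 by (auto intro!: derivative_eq_intros DERIV_subset[OF sg(3)[OF u] sub])
        show "1 / R - 1 / gas_vel (Z u (\<sigma> u)) \<le> 0"
          using R[OF S_B[OF sg(2)[OF u]]] B_vel[OF S_B[OF sg(2)[OF u]]] vmin
          by (simp add: frac_le)
      qed (use y in auto)
      then have "l * (\<sigma> y + (x - y) / R) \<le> l * s"
        using l unfolding sg(1) by (intro mult_left_mono) auto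
      also have "l * (\<sigma> y + (x - y) / R) = l * \<sigma> y + 2 * m * (x - y)"
        using R0 by (simp add: l_def field_simps)
      finally show ?thesis by simp
    qed
    define J where "J = N * exp (l * s - m * x) / m"
    have J0: "0 \<le> J" using N0 m by (simp add: J_def)
    have "integral {0..x} (\<lambda>y. D y (\<sigma> y)) \<le> integral {0..x} (\<lambda>y. N * exp (m * y + (l * s - 2 * m * x)))"
    proof (rule integral_le)
      show "(\<lambda>y. D y (\<sigma> y)) integrable_on {0..x}"
        by (intro integrable_continuous_interval D_cont sg(2) sc)
      show "(\<lambda>y. N * exp (m * y + (l * s - 2 * m * x))) integrable_on {0..x}"
        by (intro integrable_continuous_interval continuous_intros)
      fix y assume y: "y \<in> {0..x}"
      have "D y (\<sigma> y) \<le> N * exp (l * \<sigma> y - m * y)" by (rule DN[OF sg(2)[OF y]])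
      also have "\<dots> \<le> N * exp (m * y + (l * s - 2 * m * x))"
        using early[OF y] N0 by (intro mult_left_mono) (auto simp: algebra_simps)
      finally show "D y (\<sigma> y) \<le> N * exp (m * y + (l * s - 2 * m * x))" .
    qed
    also have "\<dots> = N * ((exp (m * x + (l * s - 2 * m * x)) - exp (m * 0 + (l * s - 2 * m * x))) / m)"
      using has_integral_exp_affine[OF x(1), of m "l * s - 2 * m * x"] m
      by (intro integral_unique has_integral_mult_right) auto
    also have "\<dots> \<le> N * (exp (m * x + (l * s - 2 * m * x)) / m)"
      using N0 m by (intro mult_left_mono divide_right_mono) auto
    also have "\<dots> = J" by (simp add: J_def algebra_simps)
    finally have IJ: "integral {0..x} (\<lambda>y. norm (Z y (\<sigma> y) - X y (\<sigma> y))) \<le> J" by (simp add: D_def)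
    let ?h = "\<lambda>y. gas_frac (Z y (\<sigma> y)) - gas_frac (X y (\<sigma> y))"
    have "\<bar>?h x - ?h 0\<bar> \<le> comparison_const * integral {0..x} (\<lambda>y. norm (Z y (\<sigma> y) - X y (\<sigma> y)))"
      by (rule gas_frac_comparison[OF order_refl x(1,2) tr cont])
        (use sg S S_B in auto)
    also have "\<dots> \<le> comparison_const * J"
      using IJ comparison_const_nonneg[OF L] by (intro mult_left_mono)
    finally have 1: "\<bar>?h x - ?h 0\<bar> \<le> comparison_const * J" .
    have bot: "(0, \<sigma> 0) \<in> S" using sg(2) x by auto
    have "\<bar>?h 0\<bar> \<le> E * (C * (N * exp (l * \<sigma> 0 - m * 0) / m))"
      using inflow(2)[OF bot] mult_left_mono[OF pv(1)[OF bot] inflow(1)] by linarith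
    \<comment> \<open>At the bottom the spatial weight is 1, but \<open>early\<close> gains
      \<open>2 * m * x\<close> there; half of it supplies the factor \<open>exp (- m * x)\<close>
      contained in \<open>J\<close>.\<close>
    also have "\<dots> \<le> E * (C * J)"
    proof -
      have "0 \<le> m * x" using m x by simp
      then have "l * \<sigma> 0 - m * 0 \<le> l * s - m * x" using early[of 0] x by (simp add: algebra_simps)
      then show ?thesis unfolding J_def using N0 m C inflow(1)
        by (intro mult_left_mono divide_right_mono) auto
    qed
    finally have "\<bar>gas_frac (Z x s) - gas_frac (X x s)\<bar> \<le> comparison_const * J + E * (C * J)"
      using 1 unfolding sg(1) by linarith
    then have "D x s \<le> K * J"
      using norm_state_diff_le[of "Z x s" "X x s"] pv[OF xs]
      unfolding D_def K_def distrib_right J_def[symmetric] by (simp add: mult.assoc)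
    then have "D x s * exp (m * x - l * s) \<le> K * J * exp (m * x - l * s)"
      by (intro mult_right_mono) auto
    also have "\<dots> = K / m * N"
      unfolding J_def by (simp flip: exp_add)
    also have "\<dots> \<le> 1 / 2 * N"
      using m N0 by (intro mult_right_mono) (auto simp: field_simps)
    finally show "(\<lambda>(x, s). D x s * exp (m * x - l * s)) z \<le> 0 + N / 2"
      by (simp add: z)
  qed
  then have "D x s \<le> 0" by (simp add: mult_le_0_iff)
  then show ?thesis by (simp add: D_def)
qed

end

section \<open>The inflow relation\<close>

text \<open>The superficial velocities of gas and liquid at the bottom, which the inflow relation
  prescribes.\<close>

definition gas_influx :: "well \<Rightarrow> real \<Rightarrow> real" where
  "gas_influx P q = k_G P * max 0 (p_res P - q) / (area P * rho_G P q)"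

definition liq_influx :: "well \<Rightarrow> real \<Rightarrow> real" where
  "liq_influx P q = W_inj P / (area P * rho_L P q)"

lemma influx_sign:
  assumes "positive_parameters P" "0 < q"
  shows "0 \<le> gas_influx P q" "0 < liq_influx P q"
  using assms
  by (auto simp: positive_parameters_def gas_influx_def liq_influx_def rho_G_def rho_L_def
      intro!: divide_nonneg_pos mult_pos_pos divide_pos_pos add_pos_pos)

text \<open>Eliminating \<open>w\<close> through the liquid balance leaves one scalar equation whose
  left-hand side increases strictly in \<open>a\<close> and blows up at \<open>a = 1\<close>.
  Existence, uniqueness and Lipschitz dependence all rest on this form.\<close>

lemma inflow_iff:
  assumes P: "positive_parameters P" and q: "0 < q"
  shows "inflow P q a w \<longleftrightarrow> 0 \<le> a \<and> a < 1 \<and> w = v_inf P + slip P * liq_influx P q / (1 - a) \<and>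
    a * v_inf P + slip P * liq_influx P q * (a / (1 - a)) = gas_influx P q"
proof -
  have s: "0 < slip P" "0 < v_inf P" using P by (auto simp: positive_parameters_def)
  have l: "0 < liq_influx P q" using influx_sign[OF P q] by simp
  have "(1 - a) * ((w - v_inf P) / slip P) = liq_influx P q \<longleftrightarrow>
      w = v_inf P + slip P * liq_influx P q / (1 - a)" if "a < 1"
    using that s by (auto simp: field_simps)
  moreover have "v_inf P < v_inf P + slip P * liq_influx P q / (1 - a)" if "a < 1"
    using that s l by simp
  ultimately show ?thesis
    unfolding inflow_def gas_influx_def[symmetric] liq_influx_def[symmetric]
    by (auto simp: algebra_simps)
qed

lemma inflow_exists:
  assumes P: "positive_parameters P" and q: "0 < q"
  shows "\<exists>a w. inflow P q a w"
proof -
  define c g where "c = slip P * liq_influx P q" and "g = gas_influx P q"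
  have v: "0 < v_inf P" and c: "0 < c" and g: "0 \<le> g"
    using P influx_sign[OF P q] by (auto simp: positive_parameters_def c_def g_def)
  \<comment> \<open>At this point the term with \<open>b / (1 - b)\<close> alone already equals
    \<open>g\<close>, so the root lies in \<open>{0..b}\<close>, away from the pole at 1.\<close>
  define b where "b = g / (g + c)"
  have b: "0 \<le> b" "b < 1" using c g by (auto simp: b_def)
  have "1 - b = c / (g + c)" using c g by (simp add: b_def field_simps)
  then have cb: "c * (b / (1 - b)) = g" using c g by (simp add: b_def)
  have "\<exists>a\<ge>0. a \<le> b \<and> a * v_inf P + c * (a / (1 - a)) = g"
  proof (rule IVT')
    show "g \<le> b * v_inf P + c * (b / (1 - b))" using cb b v by simp
    show "continuous_on {0..b} (\<lambda>a. a * v_inf P + c * (a / (1 - a)))"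
      using b by (intro continuous_intros) auto
  qed (use g b in auto)
  then show ?thesis
    unfolding inflow_iff[OF P q] c_def[symmetric] g_def[symmetric] using b by force
qed

text \<open>Subtract the two scalar equations: the left-hand side grows at least at rate
  \<open>v_inf P\<close> in \<open>a\<close>, and what remains are the differences of the data. For
  \<open>q = q'\<close> this is uniqueness, which gives the definite description in
  \<open>inflow_gas_frac\<close> its meaning.\<close>

lemma inflow_gas_frac_diff:
  assumes P: "positive_parameters P" and q: "0 < q" "0 < q'"
    and a: "inflow P q a w" "inflow P q' a' w'"
  shows "v_inf P * \<bar>a - a'\<bar> \<le> \<bar>gas_influx P q - gas_influx P q'\<bar>
    + gas_influx P q' / liq_influx P q' * \<bar>liq_influx P q - liq_influx P q'\<bar>"
proof -
  define c v where "c = slip P" and "v = v_inf P"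
  define g g' l l' where d: "g = gas_influx P q" "g' = gas_influx P q'"
    "l = liq_influx P q" "l' = liq_influx P q'"
  define u u' where u: "u = a / (1 - a)" "u' = a' / (1 - a')"
  have v: "0 < v" and c: "0 < c" and l: "0 < l" "0 < l'"
    using P influx_sign[OF P q(1)] influx_sign[OF P q(2)]
    by (auto simp: positive_parameters_def c_def d v_def)
  have a: "0 \<le> a" "a < 1" "a * v + c * l * u = g" "0 \<le> a'" "a' < 1" "a' * v + c * l' * u' = g'"
    using a unfolding inflow_iff[OF P q(1)] inflow_iff[OF P q(2)] d u c_def v_def by auto
  have "u - u' = (a - a') / ((1 - a) * (1 - a'))" unfolding u using a by (simp add: field_simps)
  \<comment> \<open>\<open>u - u'\<close> is a positive multiple of \<open>a - a'\<close>, so the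
    two summands cannot cancel.\<close>
  then have sgn: "\<bar>(a - a') * v\<bar> \<le> \<bar>(a - a') * v + c * l * (u - u')\<bar>"
  proof -
    assume e: "u - u' = (a - a') / ((1 - a) * (1 - a'))"
    have "c * l * (u - u') = (a - a') * (c * l / ((1 - a) * (1 - a')))" by (simp add: e)
    then have "(a - a') * v + c * l * (u - u') = (a - a') * (v + c * l / ((1 - a) * (1 - a')))"
      by (simp only: distrib_left)
    moreover have "\<bar>v\<bar> \<le> \<bar>v + c * l / ((1 - a) * (1 - a'))\<bar>" using v c l a by simp
    ultimately show ?thesis by (simp add: abs_mult mult_left_mono)
  qed
  have "(a - a') * v + c * l * (u - u') = (g - g') - c * u' * (l - l')"
    using a(3,6) by (simp add: algebra_simps)
  then have "\<bar>(a - a') * v\<bar> \<le> \<bar>g - g'\<bar> + \<bar>c * u' * (l - l')\<bar>" using sgn by linarith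
  also have "\<bar>c * u' * (l - l')\<bar> = c * u' * \<bar>l - l'\<bar>" using c a by (simp add: abs_mult u)
  also have "\<dots> \<le> g' / l' * \<bar>l - l'\<bar>"
  proof (rule mult_right_mono)
    \<comment> \<open>Drops the nonnegative summand \<open>a' * v\<close> from the equation for
      \<open>a'\<close>.\<close>
    have "c * l' * u' \<le> g'" using a v by (simp flip: a(6))
    then show "c * u' \<le> g' / l'" using l by (simp add: field_simps)
  qed auto
  finally show ?thesis using v by (simp add: d abs_mult v_def mult.commute)
qed

lemma inflow_gas_frac_eq:
  assumes P: "positive_parameters P" and q: "0 < q" and a: "inflow P q a w"
  shows "inflow_gas_frac P q = a"
  unfolding inflow_gas_frac_def
proof (rule the_equality)
  fix a' assume "\<exists>w. inflow P q a' w"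
  then obtain w' where "inflow P q a' w'" ..
  from inflow_gas_frac_diff[OF P q q this a] show "a' = a"
    using P by (simp add: positive_parameters_def mult_le_0_iff)
qed (use a in blast)

lemma inflow_gas_frac_lipschitz:
  assumes P: "positive_parameters P" and q0: "0 < q0"
  shows "\<exists>E\<ge>0. \<forall>q\<in>{q0..R}. \<forall>q'\<in>{q0..R}.
    \<bar>inflow_gas_frac P q - inflow_gas_frac P q'\<bar> \<le> E * \<bar>q - q'\<bar>"
proof -
  \<comment> \<open>Pressures are embedded as states, so that the calculus of
    \<open>bounded_lipschitz\<close> applies; the norm of a difference is then
    \<open>\<bar>q - q'\<bar>\<close>.\<close>
  define B :: "state set" where "B = {(0, q, 0) |q. q \<in> {q0..R}}"
  note bl = bounded_lipschitz_const bounded_lipschitz_add bounded_lipschitz_mult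
    bounded_lipschitz_minus bounded_lipschitz_diff bounded_lipschitz_abs
  have pos: "0 < v_inf P" "0 < area P" "0 < W_inj P" "0 < rho_L0 P" "0 < c_liq P"
    using P by (auto simp: positive_parameters_def)
  have p: "bounded_lipschitz B pres"
    by (rule bounded_lipschitzI[of "\<bar>R\<bar>" 1])
      (use q0 abs_pres_diff_le in \<open>auto simp: B_def state_fields\<close>)
  have ip: "bounded_lipschitz B (\<lambda>s. inverse (pres s))"
    by (rule bounded_lipschitz_inverse[OF p q0]) (auto simp: B_def)
  have il: "bounded_lipschitz B (\<lambda>s. inverse (rho_L0 P + pres s * inverse ((c_liq P)\<^sup>2)))"
  proof (rule bounded_lipschitz_inverse[OF _ pos(4)])
    fix s assume "s \<in> B"
    then have "0 \<le> pres s" using q0 by (auto simp: B_def)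
    then show "rho_L0 P \<le> rho_L0 P + pres s * inverse ((c_liq P)\<^sup>2)" by simp
  qed (intro bl p)
  \<comment> \<open>The kink at the reservoir pressure becomes an absolute value, which the closure
    rules cover.\<close>
  have m: "max 0 x = (x + \<bar>x\<bar>) * inverse 2" for x :: real by (simp add: max_def)
  have g: "bounded_lipschitz B (\<lambda>s. gas_influx P (pres s))"
    unfolding gas_influx_def rho_G_def divide_inverse inverse_mult_distrib inverse_inverse_eq m
    by (intro bl p ip)
  have l: "bounded_lipschitz B (\<lambda>s. liq_influx P (pres s))"
    unfolding liq_influx_def rho_L_def divide_inverse inverse_mult_distrib by (intro bl il)
  have gl: "bounded_lipschitz B (\<lambda>s. gas_influx P (pres s) / liq_influx P (pres s))"
    unfolding liq_influx_def rho_L_def divide_inverse inverse_mult_distrib inverse_inverse_eq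
    by (intro bl g p)
  obtain G where G: "0 \<le> G" "\<And>s s'. s \<in> B \<Longrightarrow> s' \<in> B \<Longrightarrow>
      \<bar>gas_influx P (pres s) - gas_influx P (pres s')\<bar> \<le> G * norm (s - s')"
    using g by (rule bounded_lipschitzE) blast
  obtain H where H: "0 \<le> H" "\<And>s s'. s \<in> B \<Longrightarrow> s' \<in> B \<Longrightarrow>
      \<bar>liq_influx P (pres s) - liq_influx P (pres s')\<bar> \<le> H * norm (s - s')"
    using l by (rule bounded_lipschitzE) blast
  obtain K where K: "0 \<le> K" "\<And>s. s \<in> B \<Longrightarrow>
      \<bar>gas_influx P (pres s) / liq_influx P (pres s)\<bar> \<le> K"
    using gl by (rule bounded_lipschitzE) blast
  show ?thesis
  proof (intro exI[of _ "(G + K * H) / v_inf P"] conjI ballI)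
    show "0 \<le> (G + K * H) / v_inf P" using G H K pos by auto
    fix q q' assume q: "q \<in> {q0..R}" "q' \<in> {q0..R}"
    have q_pos: "0 < q" "0 < q'" using q q0 by auto
    have B: "(0, q, 0) \<in> B" "(0, q', 0) \<in> B" using q by (auto simp: B_def)
    have n: "norm ((0, q, 0) - (0, q', 0) :: state) = \<bar>q - q'\<bar>" by (simp add: norm_Pair)
    obtain a w where a: "inflow P q a w" using inflow_exists[OF P q_pos(1)] by blast
    obtain a' w' where a': "inflow P q' a' w'" using inflow_exists[OF P q_pos(2)] by blast
    have "v_inf P * \<bar>a - a'\<bar> \<le> \<bar>gas_influx P q - gas_influx P q'\<bar>
        + gas_influx P q' / liq_influx P q' * \<bar>liq_influx P q - liq_influx P q'\<bar>"
      by (rule inflow_gas_frac_diff[OF P q_pos a a'])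
    also have "\<dots> \<le> G * \<bar>q - q'\<bar> + K * (H * \<bar>q - q'\<bar>)"
      using G(2)[OF B] H(2)[OF B] K(1) abs_le_D1[OF K(2)[OF B(2)]] unfolding n
      by (intro add_mono mult_mono) auto
    finally have "\<bar>a - a'\<bar> \<le> (G + K * H) / v_inf P * \<bar>q - q'\<bar>"
      using pos by (simp add: field_simps)
    then show "\<bar>inflow_gas_frac P q - inflow_gas_frac P q'\<bar> \<le> (G + K * H) / v_inf P * \<bar>q - q'\<bar>"
      by (simp add: inflow_gas_frac_eq[OF P q_pos(1) a] inflow_gas_frac_eq[OF P q_pos(2) a'])
  qed
qed

section \<open>Closeness to the steady state\<close>

lemma broad_transport_subset: "broad_transport P T X \<Longrightarrow> S \<subseteq> T \<Longrightarrow> broad_transport P S X"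
  unfolding broad_transport_def by blast

lemma lipschitz_field_subset: "lipschitz_field T X \<Longrightarrow> S \<subseteq> T \<Longrightarrow> lipschitz_field S X"
  unfolding lipschitz_field_def using lipschitz_on_subset by blast

lemma lipschitz_field_continuous_on: "lipschitz_field S X \<Longrightarrow> continuous_on S (\<lambda>(x, t). X x t)"
  unfolding lipschitz_field_def using lipschitz_on_continuous_on by blast

lemma lipschitz_fieldE:
  assumes "lipschitz_field S X"
  obtains M where "0 \<le> M"
    "\<And>x s t. (x, s) \<in> S \<Longrightarrow> (x, t) \<in> S \<Longrightarrow> norm (X x s - X x t) \<le> M * \<bar>s - t\<bar>"
    "\<And>x y t. (x, t) \<in> S \<Longrightarrow> (y, t) \<in> S \<Longrightarrow> norm (X x t - X y t) \<le> M * \<bar>x - y\<bar>"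
proof -
  obtain M where M: "M-lipschitz_on S (\<lambda>(x, t). X x t)"
    using assms by (auto simp: lipschitz_field_def)
  show ?thesis
  proof
    show "0 \<le> M" using M by (rule lipschitz_on_nonneg)
    show "norm (X x s - X x t) \<le> M * \<bar>s - t\<bar>" if "(x, s) \<in> S" "(x, t) \<in> S" for x s t
      using lipschitz_onD[OF M that] by (simp add: dist_norm norm_Pair)
    show "norm (X x t - X y t) \<le> M * \<bar>x - y\<bar>" if "(x, t) \<in> S" "(y, t) \<in> S" for x y t
      using lipschitz_onD[OF M that] by (simp add: dist_norm norm_Pair)
  qed
qed

lemma integral_from_top:
  fixes f F :: "real \<Rightarrow> real"
  assumes c: "continuous_on {a..b} f" and F: "\<And>x. x \<in> {a..b} \<Longrightarrow> F x = F b + integral {x..b} f"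
    and xz: "a \<le> x" "x \<le> z" "z \<le> b"
  shows "F x = F z + integral {x..z} f"
proof -
  have "integral {x..z} f + integral {z..b} f = integral {x..b} f"
    using xz by (intro Henstock_Kurzweil_Integration.integral_combine
        integrable_continuous_interval continuous_on_subset[OF c]) auto
  moreover have "F x = F b + integral {x..b} f" "F z = F b + integral {z..b} f"
    using xz by (intro F; simp)+
  ultimately show ?thesis by linarith
qed

text \<open>A trajectory integrates pressure from the top but velocity from the bottom, where the
  inflow fixes it. Both are recast as integrals down from an arbitrary position \<open>z\<close>,
  the form in which the observer and the comparison lemmas use them.\<close>

lemma
  assumes X: "trajectory P ptop X" and t: "0 \<le> t"
    and xz: "0 \<le> x" "x \<le> z" "z \<le> len P"
  shows trajectory_pres: "pres (X x t) = pres (X z t)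
      + integral {x..z} (\<lambda>\<xi>. grav_term P (X \<xi> t) + fric_term P (X \<xi> t))"
    and trajectory_vel: "gas_vel (X x t) = gas_vel (X z t) - integral {x..z} (\<lambda>\<xi>. dv_dx P (X \<xi> t))"
proof -
  have "lipschitz_field ({0..len P} \<times> {0..}) X" using X unfolding trajectory_def by blast
  then have c: "continuous_on {0..len P} (\<lambda>\<xi>. X \<xi> t)"
    by (intro continuous_on_curve[OF lipschitz_field_continuous_on])
      (use t in \<open>auto intro!: continuous_intros\<close>)
  have p: "0 < pres (X y t)" if "y \<in> {0..len P}" for y
    using X t that unfolding trajectory_def by blast
  have cp: "continuous_on {0..len P} (\<lambda>\<xi>. grav_term P (X \<xi> t) + fric_term P (X \<xi> t))"
    using continuous_on_minus[OF continuous_on_dp_dx[OF c, of P]] by (simp add: dp_dx_def add.commute)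
  have cv: "continuous_on {0..len P} (\<lambda>\<xi>. dv_dx P (X \<xi> t))"
  proof (rule continuous_on_dv_dx[OF c])
    fix y assume "y \<in> {0..len P}"
    from p[OF this] show "pres (X y t) \<noteq> 0" by linarith
  qed
  show "pres (X x t) = pres (X z t)
      + integral {x..z} (\<lambda>\<xi>. grav_term P (X \<xi> t) + fric_term P (X \<xi> t))"
  proof (rule integral_from_top[OF cp _ xz])
    fix y assume "y \<in> {0..len P}"
    then show "pres (X y t) = pres (X (len P) t)
        + integral {y..len P} (\<lambda>\<xi>. grav_term P (X \<xi> t) + fric_term P (X \<xi> t))"
      using X t unfolding trajectory_def by blast
  qed
  have v: "gas_vel (X y t) = gas_vel (X 0 t) + integral {0..y} (\<lambda>\<xi>. dv_dx P (X \<xi> t))"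
    if "y \<in> {0..len P}" for y
    using X t that unfolding trajectory_def by blast
  have "integral {0..x} (\<lambda>\<xi>. dv_dx P (X \<xi> t)) + integral {x..z} (\<lambda>\<xi>. dv_dx P (X \<xi> t))
      = integral {0..z} (\<lambda>\<xi>. dv_dx P (X \<xi> t))"
    using xz by (intro Henstock_Kurzweil_Integration.integral_combine
        integrable_continuous_interval continuous_on_subset[OF cv]) auto
  moreover have "gas_vel (X x t) = gas_vel (X 0 t) + integral {0..x} (\<lambda>\<xi>. dv_dx P (X \<xi> t))"
    "gas_vel (X z t) = gas_vel (X 0 t) + integral {0..z} (\<lambda>\<xi>. dv_dx P (X \<xi> t))"
    using xz by (intro v; simp)+
  ultimately show "gas_vel (X x t) = gas_vel (X z t) - integral {x..z} (\<lambda>\<xi>. dv_dx P (X \<xi> t))"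
    by linarith
qed

lemma state_box_near:
  assumes "norm (u - (0, p, w)) \<le> r" "p \<le> pmax" "q \<le> p - r" "v \<le> w - r" "0 \<le> p" "0 \<le> w"
    "r + pmax + w \<le> R"
  shows "u \<in> state_box q v R"
proof -
  have "\<bar>gas_frac u - 0\<bar> \<le> r" "\<bar>pres u - p\<bar> \<le> r" "\<bar>gas_vel u - w\<bar> \<le> r"
    using abs_gas_frac_diff_le[of u "(0, p, w)"] abs_pres_diff_le[of u "(0, p, w)"]
      abs_gas_vel_diff_le[of u "(0, p, w)"] assms(1) unfolding prod.case by linarith+
  then show ?thesis unfolding state_box_def mem_Collect_eq using assms(2-) by linarith
qed

lemma steady_vel_pos:
  assumes "positive_parameters P" shows "0 < steady_vel P"
proof -
  have "0 < rho_L P (p_ref P)"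
    using assms by (auto simp: positive_parameters_def rho_L_def intro!: add_pos_pos divide_pos_pos)
  then show ?thesis
    using assms by (auto simp: positive_parameters_def steady_vel_def
        intro!: add_pos_pos divide_pos_pos mult_pos_pos)
qed

lemma trajectory_near_steady_state:
  assumes P: "positive_parameters P" and p0: "steady_pressure P p0" "\<forall>x\<in>{0..len P}. 0 < p0 x"
  shows "\<exists>\<delta> q v R. 0 < \<delta> \<and> 0 < q \<and> 0 < v \<and> q \<le> R \<and> v \<le> R \<and>
    (\<forall>ptop X. trajectory P ptop X \<longrightarrow> (\<forall>t\<ge>0. norm (deviation P p0 X (len P) t) \<le> \<delta>) \<longrightarrow>
      (\<forall>x\<in>{0..len P}. \<forall>t\<ge>0. X x t \<in> state_box q v R))"
proof -
  have L: "0 < len P" using P by (simp add: positive_parameters_def)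
  define w where "w = steady_vel P"
  have w: "0 < w" unfolding w_def by (rule steady_vel_pos[OF P])
  have p0_deriv: "(p0 has_real_derivative dp_dx P (0, p0 x, w)) (at x within {0..len P})"
    if "x \<in> {0..len P}" for x
    using p0(1) that unfolding steady_pressure_def w_def by blast
  have p0_cont: "continuous_on {0..len P} p0" using p0_deriv by (rule DERIV_continuous_on)
  obtain xmin where xmin: "xmin \<in> {0..len P}" "\<And>x. x \<in> {0..len P} \<Longrightarrow> p0 xmin \<le> p0 x"
    using continuous_attains_inf[OF compact_Icc _ p0_cont] L by auto
  obtain xmax where xmax: "xmax \<in> {0..len P}" "\<And>x. x \<in> {0..len P} \<Longrightarrow> p0 x \<le> p0 xmax"
    using continuous_attains_sup[OF compact_Icc _ p0_cont] L by auto
  have pmin: "0 < p0 xmin" using p0(2) xmin by blast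
  \<comment> \<open>Within distance \<open>r\<close> of the steady state, pressure and velocity keep
    at least half of their minimal steady values; these halves are the lower bounds of the
    box.\<close>
  define r where "r = min (p0 xmin / 2) (w / 2)"
  have r: "0 < r" "r \<le> p0 xmin / 2" "r \<le> w / 2" using pmin w by (auto simp: r_def)
  define q v R where "q = p0 xmin / 2" and "v = w / 2" and "R = r + p0 xmax + w"
  have "p0 xmin \<le> p0 xmax" using xmin(2)[OF xmax(1)] .
  then have qv: "0 < q" "0 < v" "q \<le> R" "v \<le> R" using pmin w r by (auto simp: q_def v_def R_def)
  define B where "B = state_box q v R"
  obtain C where C: "lipschitz_sources P B C"
    using lipschitz_sources_state_box[of q v R] qv unfolding B_def by blast
  define S0 :: "real \<Rightarrow> state" where "S0 x = (0, p0 x, w)" for x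
  have near: "u \<in> B" if "x \<in> {0..len P}" "norm (u - S0 x) \<le> r" for u x
    unfolding B_def
    by (rule state_box_near[OF that(2)[unfolded S0_def], of "p0 xmax"])
      (use xmin(2)[OF that(1)] xmax(2)[OF that(1)] r w pmin in \<open>auto simp: q_def v_def R_def\<close>)
  have S0_cont: "continuous_on {0..len P} S0"
    unfolding S0_def by (intro continuous_intros p0_cont)
  \<comment> \<open>The steady state does not vary in time, so \<open>M = 0\<close> and
    \<open>ref.backward_rate\<close> involves no constant of the trajectory. Its transport equation
    holds because \<open>E_G\<close> vanishes at zero gas fraction.\<close>
  interpret ref: reference_field P B C 0 v "\<lambda>x t. S0 x"
  proof
    show "continuous_on ({0..len P} \<times> {0..}) (\<lambda>(x, t :: real). S0 x)"
      unfolding split_beta by (rule continuous_on_compose2[OF S0_cont]) (auto intro!: continuous_intros)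
    show "broad_transport P ({0..len P} \<times> {0..}) (\<lambda>x t. S0 x)"
      by (auto simp: broad_transport_def S0_def)
    show "S0 x \<in> B" if "x \<in> {0..len P}" for x using near[OF that] r by simp
    show "0 < pres s" "v \<le> gas_vel s" if "s \<in> B" for s
      using that qv unfolding B_def state_box_def by auto
  qed (use C qv in auto)
  define c where "c = exp (ref.backward_rate * len P)"
  have "0 \<le> ref.backward_rate"
    using ref.comparison_const_nonneg ref.C L by (simp add: ref.backward_rate_def)
  then have c: "1 \<le> c" using L by (simp add: c_def)
  \<comment> \<open>Chosen to make the bound \<open>6 * \<delta> * c\<close> of
    \<open>backward_stability\<close> equal to \<open>r / 2\<close>.\<close>
  define \<delta> where "\<delta> = r / (12 * c)"
  have d: "0 < \<delta>" "6 * \<delta> * c = r / 2" "\<delta> \<le> r / 2"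
    using r c by (auto simp: \<delta>_def field_simps)
  have "X x t \<in> B" if X: "trajectory P ptop X"
    and top: "\<And>t. 0 \<le> t \<Longrightarrow> norm (deviation P p0 X (len P) t) \<le> \<delta>"
    and x: "x \<in> {0..len P}" and t: "0 \<le> t" for ptop X x t
  proof -
    have lip: "lipschitz_field ({0..len P} \<times> {0..}) X"
      and tr: "broad_transport P ({0..len P} \<times> {0..}) X"
      using X unfolding trajectory_def by blast+
    obtain M where M: "0 \<le> M"
      "\<And>x s t. x \<in> {0..len P} \<Longrightarrow> 0 \<le> s \<Longrightarrow> 0 \<le> t \<Longrightarrow> norm (X x s - X x t) \<le> M * \<bar>s - t\<bar>"
      "\<And>x y t. x \<in> {0..len P} \<Longrightarrow> y \<in> {0..len P} \<Longrightarrow> 0 \<le> t \<Longrightarrow> norm (X x t - X y t) \<le> M * \<bar>x - y\<bar>"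
      by (rule lipschitz_fieldE[OF lip]) auto
    have top': "norm (X (len P) t - S0 (len P)) \<le> \<delta>" if "0 \<le> t" for t
      using top[OF that] by (simp add: deviation_def S0_def w_def)
    have "uniformly_continuous_on {0..len P} S0"
      by (rule compact_uniformly_continuous[OF S0_cont compact_Icc])
    moreover have "0 < r / 4" using r by simp
    ultimately obtain e where e: "0 < e"
      "\<And>x y. x \<in> {0..len P} \<Longrightarrow> y \<in> {0..len P} \<Longrightarrow> dist y x < e \<Longrightarrow> dist (S0 y) (S0 x) < r / 4"
      unfolding uniformly_continuous_on_def by blast
    \<comment> \<open>Over a distance of at most \<eta> the trajectory and the steady state each
      change by at most \<open>r / 4\<close>, so a deviation of \<open>r / 2\<close> grows to at
      most \<open>r\<close>.\<close>
    define \<eta> where "\<eta> = min (e / 2) (r / (4 * (M + 1)))"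
    have \<eta>: "0 < \<eta>" "\<eta> < e" "M * \<eta> \<le> r / 4"
    proof -
      show "0 < \<eta>" "\<eta> < e" using e(1) r M(1) by (auto simp: \<eta>_def)
      have "M * \<eta> \<le> (M + 1) * (r / (4 * (M + 1)))"
        using M(1) \<open>0 < \<eta>\<close> by (intro mult_mono) (auto simp: \<eta>_def)
      also have "\<dots> = r / 4" using M(1) by (simp add: field_simps)
      finally show "M * \<eta> \<le> r / 4" .
    qed
    have bound: "norm (X x t - S0 x) \<le> r / 2"
      if "x \<in> {0..len P}" "len P - real n * \<eta> \<le> x" "0 \<le> t" for n x t
      using that
    proof (induction n arbitrary: x t)
      case 0
      then have "x = len P" by simp
      then show ?case using top'[OF 0(3)] d by simp
    next
      case (Suc n)
      have close: "norm (X y s - S0 y) \<le> r" if y: "y \<in> {x..len P}" and s: "0 \<le> s" for y s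
      proof -
        have yL: "y \<in> {0..len P}" using y Suc.prems by auto
        show ?thesis
        proof (cases "len P - real n * \<eta> \<le> y")
          case True
          then show ?thesis using Suc.IH[OF yL True s] r by linarith
        next
          case False
          define z where "z = len P - real n * \<eta>"
          have z: "z \<in> {0..len P}" "\<bar>y - z\<bar> \<le> \<eta>"
            using False Suc.prems(2) y yL \<eta>(1) by (auto simp: z_def algebra_simps)
          have "norm (X y s - X z s) \<le> M * \<bar>y - z\<bar>" by (rule M(3)[OF yL z(1) s])
          also have "\<dots> \<le> r / 4" using mult_left_mono[OF z(2) M(1)] \<eta>(3) by linarith
          finally have 1: "norm (X y s - X z s) \<le> r / 4" .
          have 2: "norm (X z s - S0 z) \<le> r / 2" by (rule Suc.IH[OF z(1) _ s]) (simp add: z_def)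
          have "dist (S0 z) (S0 y) < r / 4"
            by (rule e(2)[OF yL z(1)]) (use z(2) \<eta>(2) in \<open>simp add: dist_real_def\<close>)
          then have 3: "norm (S0 z - S0 y) \<le> r / 4" by (simp add: dist_norm)
          have "X y s - S0 y = (X y s - X z s) + (X z s - S0 z) + (S0 z - S0 y)" by simp
          then have "norm (X y s - S0 y) \<le> norm (X y s - X z s) + norm (X z s - S0 z) + norm (S0 z - S0 y)"
            by (simp only: order_trans[OF norm_triangle_ineq add_right_mono[OF norm_triangle_ineq]])
          then show ?thesis using 1 2 3 by linarith
        qed
      qed
      let ?S = "{x..len P} \<times> {0::real..}"
      have sub: "?S \<subseteq> {0..len P} \<times> {0..}" using Suc.prems by auto
      have cont: "continuous_on ?S (\<lambda>(x, t). X x t)"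
        by (rule lipschitz_field_continuous_on[OF lipschitz_field_subset[OF lip sub]])
      have XB: "X y s \<in> B" if "y \<in> {x..len P}" "0 \<le> s" for y s
        using near[OF _ close[OF that]] that Suc.prems by auto
      \<comment> \<open>The crude bound \<open>r\<close> puts the trajectory into the box on
        \<open>{x..len P}\<close>. There stability, with the trajectory as the field
        \<open>Z\<close>, improves it to \<open>r / 2\<close> and closes the induction.\<close>
      have "norm (X x t - S0 x) \<le> 6 * \<delta> * exp (ref.backward_rate * len P)"
      proof (rule ref.backward_stability[OF sub broad_transport_subset[OF tr sub] cont, where b = r])
        fix y s assume "(y, s) \<in> ?S"
        then have y: "y \<in> {x..len P}" "0 \<le> s" and yL: "0 \<le> y" "y \<le> len P" using Suc.prems by auto
        show "X y s \<in> B" by (rule XB[OF y])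
        show "norm (X y s - S0 y) \<le> r" by (rule close[OF y])
        have sub': "{y..len P} \<times> {0..} \<subseteq> ?S" using y by auto
        have "\<exists>\<sigma>. \<sigma> y = s \<and> (\<forall>z\<in>{y..len P}. 0 \<le> \<sigma> z \<and>
            (\<sigma> has_real_derivative 1 / gas_vel (X z (\<sigma> z))) (at z within {y..len P}))"
          by (rule forward_characteristic[OF C qv(2) _ continuous_on_subset[OF cont sub'] _ M(1) M(2)])
            (use ref.B_vel XB y Suc.prems in simp_all)
        then obtain \<sigma> where sg: "\<sigma> y = s" "\<And>z. z \<in> {y..len P} \<Longrightarrow> 0 \<le> \<sigma> z"
          "\<And>z. z \<in> {y..len P} \<Longrightarrow>
            (\<sigma> has_real_derivative 1 / gas_vel (X z (\<sigma> z))) (at z within {y..len P})"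
          by blast
        show "\<exists>\<sigma>. \<sigma> y = s \<and> (\<forall>z\<in>{y..len P}. (z, \<sigma> z) \<in> ?S \<and>
            (\<sigma> has_real_derivative 1 / gas_vel (X z (\<sigma> z))) (at z within {y..len P}))"
        proof (intro exI[of _ \<sigma>] conjI ballI)
          fix z assume z: "z \<in> {y..len P}"
          show "(z, \<sigma> z) \<in> ?S" using sg(2)[OF z] z y by simp
        qed (use sg in simp_all)
        show "pres (X y s) = pres (X (len P) s)
            + integral {y..len P} (\<lambda>\<xi>. grav_term P (X \<xi> s) + fric_term P (X \<xi> s))"
          by (rule trajectory_pres[OF X y(2) yL order_refl])
        show "gas_vel (X y s) = gas_vel (X (len P) s) - integral {y..len P} (\<lambda>\<xi>. dv_dx P (X \<xi> s))"
          by (rule trajectory_vel[OF X y(2) yL order_refl])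
        have "((\<lambda>\<xi>. dp_dx P (S0 \<xi>)) has_integral p0 (len P) - p0 y) {y..len P}"
          unfolding S0_def using p0_deriv yL
          by (intro fundamental_theorem_of_calculus)
            (auto intro!: DERIV_subset[OF p0_deriv] simp flip: has_real_derivative_iff_has_vector_derivative)
        from has_integral_neg[OF this]
        have "((\<lambda>\<xi>. grav_term P (S0 \<xi>) + fric_term P (S0 \<xi>)) has_integral - (p0 (len P) - p0 y)) {y..len P}"
          by (simp add: dp_dx_def add.commute)
        then show "pres (S0 y) = pres (S0 (len P))
            + integral {y..len P} (\<lambda>\<xi>. grav_term P (S0 \<xi>) + fric_term P (S0 \<xi>))"
          by (simp add: integral_unique) (simp add: S0_def)
        show "gas_vel (S0 y) = gas_vel (S0 (len P)) - integral {y..len P} (\<lambda>\<xi>. dv_dx P (S0 \<xi>))"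
          by (simp add: S0_def)
      qed (use top' Suc.prems in auto)
      then show ?case using d(2) by (simp add: c_def)
    qed
    obtain n :: nat where "len P / \<eta> \<le> real n" using real_arch_simple by blast
    then have "len P - real n * \<eta> \<le> x" using \<eta>(1) x by (simp add: field_simps)
    from bound[OF x this t] show ?thesis using near[OF x] r by simp
  qed
  then show ?thesis
    using d(1) qv unfolding B_def
    by (intro exI[of _ \<delta>] exI[of _ q] exI[of _ v] exI[of _ R] conjI allI impI ballI) simp_all
qed

section \<open>Characteristic lines\<close>

lemma characteristic_line_end:
  assumes "characteristic_line P X t \<tau>" "0 \<le> len P"
  shows "\<tau> (len P) = t"
proof -
  have "((\<lambda>\<xi>. 1 / gas_vel (X \<xi> (\<tau> \<xi>))) has_integral (t - \<tau> (len P))) {len P..len P}"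
    by (rule conjunct2[OF bspec[OF assms(1)[unfolded characteristic_line_def]]])
      (use assms(2) in simp)
  moreover have "((\<lambda>\<xi>. 1 / gas_vel (X \<xi> (\<tau> \<xi>))) has_integral 0) {len P..len P}"
    by (rule has_integral_null_real) simp
  ultimately have "t - \<tau> (len P) = 0" by (rule has_integral_unique)
  then show ?thesis by simp
qed

lemma characteristic_line_mono:
  assumes cl: "characteristic_line P X t \<tau>" and xy: "0 \<le> x" "x \<le> y" "y \<le> len P"
  shows "\<tau> x \<le> \<tau> y"
proof -
  have i: "((\<lambda>\<xi>. 1 / gas_vel (X \<xi> (\<tau> \<xi>))) has_integral (t - \<tau> z)) {z..len P}"
    and p: "0 < gas_vel (X z (\<tau> z))" if "z \<in> {0..len P}" for z
    using cl that unfolding characteristic_line_def by blast+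
  have "t - \<tau> y \<le> t - \<tau> x"
  proof (rule has_integral_subset_le[OF _ i i])
    show "\<forall>z\<in>{x..len P}. 0 \<le> 1 / gas_vel (X z (\<tau> z))"
    proof
      fix z assume "z \<in> {x..len P}"
      then have "0 < gas_vel (X z (\<tau> z))" using p[of z] xy by simp
      then show "0 \<le> 1 / gas_vel (X z (\<tau> z))" by simp
    qed
  qed (use xy in auto)
  then show ?thesis by simp
qed

text \<open>A regularity bootstrap. The definition only makes the slowness along \<tau> integrable;
  as an indefinite integral \<tau> is then continuous, so the slowness along it is continuous, so
  \<tau> is differentiable.\<close>

lemma characteristic_line_derivative:
  assumes cl: "characteristic_line P X t \<tau>" and cont: "continuous_on S (\<lambda>(x, t). X x t)"
    and S: "\<And>x. x \<in> {0..len P} \<Longrightarrow> (x, \<tau> x) \<in> S" and x: "x \<in> {0..len P}"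
  shows "(\<tau> has_real_derivative 1 / gas_vel (X x (\<tau> x))) (at x within {0..len P})"
proof -
  define g where "g \<xi> = 1 / gas_vel (X \<xi> (\<tau> \<xi>))" for \<xi>
  have i: "(g has_integral (t - \<tau> z)) {z..len P}" and p: "0 < gas_vel (X z (\<tau> z))"
    if "z \<in> {0..len P}" for z
    using cl that unfolding characteristic_line_def g_def by blast+
  have g: "g integrable_on {0..len P}" using i[of 0] x by auto
  have tau: "\<tau> z = \<tau> 0 + integral {0..z} g" if z: "z \<in> {0..len P}" for z
  proof -
    have "integral {0..z} g + integral {z..len P} g = integral {0..len P} g"
      using z g by (intro Henstock_Kurzweil_Integration.integral_combine) auto
    moreover have "integral {z..len P} g = t - \<tau> z" "integral {0..len P} g = t - \<tau> 0"
      using i[of z] i[of 0] z by (auto intro: integral_unique)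
    ultimately show ?thesis by linarith
  qed
  have "continuous_on {0..len P} (\<lambda>z. \<tau> 0 + integral {0..z} g)"
    by (intro continuous_intros indefinite_integral_continuous_1 g)
  then have tc: "continuous_on {0..len P} \<tau>" by (rule continuous_on_eq) (rule tau[symmetric])
  have gc: "continuous_on {0..len P} g"
    unfolding g_def
  proof (intro continuous_intros continuous_on_gas_vel continuous_on_curve[OF cont tc] S ballI)
    fix z assume "z \<in> {0..len P}"
    from p[OF this] show "gas_vel (X z (\<tau> z)) \<noteq> 0" by linarith
  qed
  have "((\<lambda>z. \<tau> 0 + integral {0..z} g) has_real_derivative g x) (at x within {0..len P})"
    by (rule derivative_eq_intros integral_has_real_derivative[OF gc x] refl)+ simp
  then have "(\<tau> has_real_derivative g x) (at x within {0..len P})"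
    by (rule has_field_derivative_transform_within[OF _ zero_less_one x]) (rule tau[symmetric])
  then show ?thesis by (simp add: g_def)
qed

lemma characteristic_lineI:
  assumes d: "\<And>x. x \<in> {0..len P} \<Longrightarrow>
      (\<tau> has_real_derivative 1 / gas_vel (X x (\<tau> x))) (at x within {0..len P})"
    and v: "\<And>x. x \<in> {0..len P} \<Longrightarrow> 0 < gas_vel (X x (\<tau> x))" and e: "\<tau> (len P) = t"
  shows "characteristic_line P X t \<tau>"
  unfolding characteristic_line_def
proof (intro ballI conjI v)
  fix x assume x: "x \<in> {0..len P}"
  have "((\<lambda>\<xi>. 1 / gas_vel (X \<xi> (\<tau> \<xi>))) has_integral \<tau> (len P) - \<tau> x) {x..len P}"
  proof (rule fundamental_theorem_of_calculus)
    fix y assume y: "y \<in> {x..len P}"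
    have "(\<tau> has_real_derivative 1 / gas_vel (X y (\<tau> y))) (at y within {x..len P})"
      by (rule DERIV_subset[OF d]) (use x y in auto)
    then show "(\<tau> has_vector_derivative 1 / gas_vel (X y (\<tau> y))) (at y within {x..len P})"
      by (simp add: has_real_derivative_iff_has_vector_derivative)
  qed (use x in auto)
  then show "((\<lambda>\<xi>. 1 / gas_vel (X \<xi> (\<tau> \<xi>))) has_integral (t - \<tau> x)) {x..len P}" by (simp add: e)
qed

text \<open>The line increases from \<open>\<tau> 0\<close> to \<open>t\<close>, so the inverse used
  in step 2 is meaningful at every time that occurs, and a horizontal line through a point of the
  region meets the characteristic at that point or to its right.\<close>

lemma region_B_inverse:
  assumes cl: "characteristic_line P X t \<tau>" and cont: "continuous_on S (\<lambda>(x, t). X x t)"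
    and S: "\<And>x. x \<in> {0..len P} \<Longrightarrow> (x, \<tau> x) \<in> S" and xs: "(x, s) \<in> region_B P t \<tau>"
  shows "the_inv_into {0..len P} \<tau> s \<in> {x..len P}" "\<tau> (the_inv_into {0..len P} \<tau> s) = s"
proof -
  have x: "x \<in> {0..len P}" "\<tau> x \<le> s" "s \<le> t" using xs by (auto simp: region_B_def)
  then have L: "0 \<le> len P" by auto
  have v: "0 < 1 / gas_vel (X x (\<tau> x))" if "x \<in> {0..len P}" for x
    using cl that unfolding characteristic_line_def by simp
  note inc = increasing_curve[OF L characteristic_line_derivative[OF cl cont S] v]
  have inj: "inj_on \<tau> {0..len P}" by (rule strict_mono_on_imp_inj_on[OF inc(1)])
  have "\<tau> 0 \<le> \<tau> x" using characteristic_line_mono[OF cl] x by auto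
  then have "s \<in> {\<tau> 0..\<tau> (len P)}" using x by (simp add: characteristic_line_end[OF cl L])
  then have s: "s \<in> \<tau> ` {0..len P}" using inc(2) by simp
  let ?z = "the_inv_into {0..len P} \<tau> s"
  show z: "\<tau> ?z = s" by (rule f_the_inv_into_f[OF inj s])
  have zL: "?z \<in> {0..len P}" by (rule the_inv_into_into[OF inj s order_refl])
  have "x \<le> ?z"
  proof (rule ccontr)
    assume "\<not> x \<le> ?z"
    then have "\<tau> ?z < \<tau> x" using strict_mono_onD[OF inc(1) zL x(1)] by simp
    then show False using z x(2) by simp
  qed
  then show "?z \<in> {x..len P}" using zL by simp
qed

text \<open>The set is the image of a rectangle under linear interpolation between the two
  curves.\<close>

lemma compact_between_curves:
  fixes lo hi :: "real \<Rightarrow> real"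
  assumes "continuous_on {a..b} lo" "continuous_on {a..b} hi"
    and le: "\<And>x. x \<in> {a..b} \<Longrightarrow> lo x \<le> hi x"
  shows "compact {(x, s). x \<in> {a..b} \<and> lo x \<le> s \<and> s \<le> hi x}"
proof -
  let ?f = "\<lambda>z. (fst z, lo (fst z) + snd z * (hi (fst z) - lo (fst z)))"
  have "continuous_on ({a..b} \<times> {0..1}) ?f"
    by (intro continuous_intros continuous_on_compose2[OF assms(1)] continuous_on_compose2[OF assms(2)]) auto
  then have "compact (?f ` ({a..b} \<times> {0..1}))"
    by (rule compact_continuous_image) (intro compact_Times compact_Icc)
  also have "?f ` ({a..b} \<times> {0..1}) = {(x, s). x \<in> {a..b} \<and> lo x \<le> s \<and> s \<le> hi x}"
  proof (intro equalityI subsetI)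
    fix z assume "z \<in> {(x, s). x \<in> {a..b} \<and> lo x \<le> s \<and> s \<le> hi x}"
    then obtain x s where z: "z = (x, s)" "x \<in> {a..b}" "lo x \<le> s" "s \<le> hi x" by auto
    \<comment> \<open>Where the curves meet, every \<open>u\<close> gives the same point, and 0
      avoids the vanishing denominator.\<close>
    define u where "u = (if hi x = lo x then 0 else (s - lo x) / (hi x - lo x))"
    have "u \<in> {0..1}" "s = lo x + u * (hi x - lo x)"
      using z by (auto simp: u_def field_simps)
    then show "z \<in> ?f ` ({a..b} \<times> {0..1})" using z by (intro image_eqI[of _ _ "(x, u)"]) auto
  next
    fix z assume "z \<in> ?f ` ({a..b} \<times> {0..1})"
    then obtain y where "y \<in> {a..b} \<times> {0..1}" "z = ?f y" by blast
    then obtain x u where z: "z = (x, lo x + u * (hi x - lo x))" "x \<in> {a..b}" "u \<in> {0..1}"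
      by (metis SigmaE fst_conv snd_conv)
    have "u * (hi x - lo x) \<le> 1 * (hi x - lo x)" "0 \<le> u * (hi x - lo x)"
      using z(3) le[OF z(2)] mult_right_mono[of u 1 "hi x - lo x"] by simp_all
    then show "z \<in> {(x, s). x \<in> {a..b} \<and> lo x \<le> s \<and> s \<le> hi x}" using z by auto
  qed
  finally show ?thesis .
qed

lemma state_box_mono: "q' \<le> q \<Longrightarrow> v' \<le> v \<Longrightarrow> R \<le> R' \<Longrightarrow> u \<in> state_box q v R \<Longrightarrow> u \<in> state_box q' v' R'"
  by (auto simp: state_box_def)

text \<open>Supplies the a priori bound for the uniqueness proofs. Gas fractions may have opposite
  signs and differ by \<open>2 * R\<close>; pressures and velocities are nonnegative and differ by
  at most \<open>R\<close>.\<close>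

lemma state_box_diff_bound:
  assumes "u \<in> state_box q v R" "u' \<in> state_box q v R" "0 \<le> q" "0 \<le> v"
  shows "norm (u - u') \<le> 4 * R"
proof -
  note a = assms(1,2)[unfolded state_box_def mem_Collect_eq]
  have "\<bar>gas_frac u - gas_frac u'\<bar> \<le> 2 * R" "\<bar>pres u - pres u'\<bar> \<le> R"
    "\<bar>gas_vel u - gas_vel u'\<bar> \<le> R"
    using a assms(3,4) by linarith+
  then show ?thesis using norm_state_diff_le[of u u'] by linarith
qed

text \<open>An observer field is only known to have positive pressure and velocity at each point.
  Compactness of the region makes these bounds uniform, so that the source terms are Lipschitz on
  its values.\<close>

lemma compact_in_state_box:
  assumes S: "compact S" "S \<noteq> {}" and cont: "continuous_on S (\<lambda>(x, t). Z x t)"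
    and p: "\<And>x s. (x, s) \<in> S \<Longrightarrow> 0 < pres (Z x s)" and v: "\<And>x s. (x, s) \<in> S \<Longrightarrow> 0 < gas_vel (Z x s)"
  obtains q w R where "0 < q" "0 < w" "\<And>x s. (x, s) \<in> S \<Longrightarrow> Z x s \<in> state_box q w R"
proof -
  let ?Z = "\<lambda>(x, t). Z x t"
  obtain z1 where z1: "z1 \<in> S" "\<And>z. z \<in> S \<Longrightarrow> pres (?Z z1) \<le> pres (?Z z)"
    using continuous_attains_inf[OF S continuous_on_pres[OF cont]] by blast
  obtain z2 where z2: "z2 \<in> S" "\<And>z. z \<in> S \<Longrightarrow> gas_vel (?Z z2) \<le> gas_vel (?Z z)"
    using continuous_attains_inf[OF S continuous_on_gas_vel[OF cont]] by blast
  obtain R where R: "\<And>z. z \<in> S \<Longrightarrow> norm (?Z z) \<le> R"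
    using compact_imp_bounded[OF compact_continuous_image[OF cont S(1)]]
    unfolding bounded_iff by blast
  have "0 < pres (?Z z1)" "0 < gas_vel (?Z z2)" using p v z1(1) z2(1) by (cases z1; cases z2; simp)+
  moreover have "Z x s \<in> state_box (pres (?Z z1)) (gas_vel (?Z z2)) R" if xs: "(x, s) \<in> S" for x s
  proof -
    have n: "norm (Z x s - (0, 0, 0)) \<le> R" using R[OF xs] by (simp flip: zero_prod_def)
    have "\<bar>gas_frac (Z x s)\<bar> \<le> R" "pres (Z x s) \<le> R" "gas_vel (Z x s) \<le> R"
      using abs_gas_frac_diff_le[of "Z x s" "(0, 0, 0)"] abs_pres_diff_le[of "Z x s" "(0, 0, 0)"]
        abs_gas_vel_diff_le[of "Z x s" "(0, 0, 0)"] n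
      unfolding prod.case by linarith+
    moreover have "pres (?Z z1) \<le> pres (Z x s)" "gas_vel (?Z z2) \<le> gas_vel (Z x s)"
      using z1(2)[OF xs] z2(2)[OF xs] unfolding prod.case .
    ultimately show ?thesis unfolding state_box_def mem_Collect_eq by blast
  qed
  ultimately show ?thesis by (rule that)
qed

section \<open>Exactness of the observer\<close>

locale confined_trajectory =
  fixes P :: well and ptop :: "real \<Rightarrow> real" and X :: "real \<Rightarrow> real \<Rightarrow> state" and q v R :: real
  assumes P: "positive_parameters P" and X: "trajectory P ptop X"
    and qv: "0 < q" "0 < v" "q \<le> R" "v \<le> R"
    and box: "\<And>x t. x \<in> {0..len P} \<Longrightarrow> 0 \<le> t \<Longrightarrow> X x t \<in> state_box q v R"
begin

lemma L: "0 < len P"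
  using P by (simp add: positive_parameters_def)

lemma lip: "lipschitz_field ({0..len P} \<times> {0..}) X"
  and transport: "broad_transport P ({0..len P} \<times> {0..}) X"
  using X unfolding trajectory_def by blast+

lemma cont: "continuous_on ({0..len P} \<times> {0..}) (\<lambda>(x, t). X x t)"
  by (rule lipschitz_field_continuous_on[OF lip])

lemma X_pos:
  assumes "x \<in> {0..len P}" "0 \<le> t"
  shows "0 < pres (X x t)" "0 < gas_vel (X x t)"
  using box[OF assms] qv unfolding state_box_def mem_Collect_eq by linarith+

text \<open>The box may be enlarged, because an observer field brings its own bounds and both fields
  must lie in one box.\<close>

lemma reference:
  assumes "0 < q'" "q' \<le> q" "0 < v'" "v' \<le> v" "R \<le> R'"
  obtains C M where "reference_field P (state_box q' v' R') C M v' X"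
proof -
  obtain M where M: "0 \<le> M"
    "\<And>x s t. x \<in> {0..len P} \<Longrightarrow> 0 \<le> s \<Longrightarrow> 0 \<le> t \<Longrightarrow> norm (X x s - X x t) \<le> M * \<bar>s - t\<bar>"
    by (rule lipschitz_fieldE[OF lip]) auto
  obtain C where C: "lipschitz_sources P (state_box q' v' R') C"
    using lipschitz_sources_state_box[of q' v' R'] assms qv by fastforce
  have "reference_field P (state_box q' v' R') C M v' X"
  proof
    fix u assume "u \<in> state_box q' v' R'"
    then show "0 < pres u" "v' \<le> gas_vel u"
      using assms(1) unfolding state_box_def mem_Collect_eq by linarith+
  next
    fix x t :: real assume "x \<in> {0..len P}" "0 \<le> t"
    from box[OF this] show "X x t \<in> state_box q' v' R'" by (rule state_box_mono[OF assms(2,4,5)])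
  qed (fact assms(3) M C cont transport)+
  then show ?thesis by (rule that)
qed

text \<open>Barriers are the horizontal line at \<open>t\<close> and the line of slowness
  \<open>1 / v\<close> through \<open>(len P, t)\<close>. The latter reaches the bottom at time
  \<open>t - len P / v\<close>, so the bound on \<open>t\<close> keeps everything at nonnegative
  times.\<close>

lemma characteristic_line_exists:
  assumes t: "len P / v \<le> t"
  shows "\<exists>\<tau>. characteristic_line P X t \<tau> \<and> 0 \<le> \<tau> 0"
proof -
  obtain C M where "reference_field P (state_box q v R) C M v X"
    using reference[of q v R] qv by auto
  then interpret reference_field P "state_box q v R" C M v X .
  have n: "0 \<le> t - (len P - x) / v" if "x \<in> {0..len P}" for x
  proof -
    have "(len P - x) / v \<le> len P / v" using that qv by (intro divide_right_mono) auto
    then show ?thesis using t by linarith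
  qed
  have t0: "0 \<le> t" using n[of "len P"] L by simp
  have "\<exists>\<tau>. \<tau> (len P) = t \<and> (\<forall>x\<in>{0..len P}. \<tau> x \<in> {t - (len P - x) / v..t} \<and>
    (\<tau> has_real_derivative 1 / gas_vel (X x (\<tau> x))) (at x within {0..len P}))"
  proof (rule backward_characteristic_between[OF sources vmin B_vel cont _ M,
        where lo' = "\<lambda>_. 1 / v" and hi' = "\<lambda>_. 0"])
    fix x assume x: "x \<in> {0..len P}"
    show "1 / gas_vel (X x (t - (len P - x) / v)) \<le> 1 / v"
      using B_vel[OF X_B[OF x n[OF x]]] qv by (intro divide_left_mono) auto
    show "((\<lambda>x. t - (len P - x) / v) has_real_derivative 1 / v) (at x within {0..len P})"
      using qv by (auto intro!: derivative_eq_intros)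
    show "0 \<le> 1 / gas_vel (X x t)" using X_pos(2)[OF x t0] by simp
    show "t - (len P - x) / v \<le> t" using x qv by simp
  next
    show "{(x, y). x \<in> {0..len P} \<and> t - (len P - x) / v \<le> y \<and> y \<le> t} \<subseteq> {0..len P} \<times> {0..}"
      using n by fastforce
  qed (use X_B X_lip L in auto)
  then obtain \<tau> where tau: "\<tau> (len P) = t" "\<And>x. x \<in> {0..len P} \<Longrightarrow> \<tau> x \<in> {t - (len P - x) / v..t}"
    "\<And>x. x \<in> {0..len P} \<Longrightarrow> (\<tau> has_real_derivative 1 / gas_vel (X x (\<tau> x))) (at x within {0..len P})"
    by blast
  have tau0: "0 \<le> \<tau> x" if "x \<in> {0..len P}" for x
    using n[OF that] tau(2)[OF that] unfolding atLeastAtMost_iff by linarith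
  have "characteristic_line P X t \<tau>"
    by (rule characteristic_lineI[where \<tau> = \<tau> and X = X]) (use tau(1,3) tau0 X_pos(2) in simp_all)
  then show ?thesis using tau0[of 0] L by auto
qed

lemma observer_output_actual:
  assumes cl: "characteristic_line P X t \<tau>" and H: "admissible_horizon t \<tau> H"
  shows "observer_output P (X (len P)) t H (\<lambda>x. X x t)"
proof -
  have tau0: "0 \<le> \<tau> 0" using H by (auto simp: admissible_horizon_def)
  have tau: "0 \<le> \<tau> x" if "x \<in> {0..len P}" for x
    using characteristic_line_mono[OF cl, of 0 x] tau0 that by auto
  have A: "region_A P t H \<tau> \<subseteq> {0..len P} \<times> {0..}"
    using H by (auto simp: region_A_def admissible_horizon_def)
  have B: "region_B P t \<tau> \<subseteq> {0..len P} \<times> {0..}"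
    using tau by (fastforce simp: region_B_def)
  have p: "0 < pres (X x s)" "0 < gas_vel (X x s)" if "(x, s) \<in> {0..len P} \<times> {0..}" for x s
    using X_pos that by auto
  have s1: "step1 P (X (len P)) t H \<tau> X"
    unfolding step1_def
  proof (intro conjI cl H lipschitz_field_subset[OF lip A] broad_transport_subset[OF transport A])
    show "\<forall>(x, s)\<in>region_A P t H \<tau>.
        0 < pres (X x s) \<and> 0 < gas_vel (X x s) \<and>
        pres (X x s) = pres (X (len P) s)
          + integral {x..len P} (\<lambda>\<xi>. grav_term P (X \<xi> s) + fric_term P (X \<xi> s)) \<and>
        gas_vel (X x s) = gas_vel (X (len P) s)
          - integral {x..len P} (\<lambda>\<xi>. dv_dx P (X \<xi> s))"
    proof (clarify, intro conjI)
      fix x s assume "(x, s) \<in> region_A P t H \<tau>"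
      then have xs: "(x, s) \<in> {0..len P} \<times> {0..}" using A by blast
      then have x: "0 \<le> s" "0 \<le> x" "x \<le> len P" by auto
      show "0 < pres (X x s)" "0 < gas_vel (X x s)" by (rule p[OF xs])+
      show "pres (X x s) = pres (X (len P) s)
          + integral {x..len P} (\<lambda>\<xi>. grav_term P (X \<xi> s) + fric_term P (X \<xi> s))"
        by (rule trajectory_pres[OF X x order_refl])
      show "gas_vel (X x s) = gas_vel (X (len P) s) - integral {x..len P} (\<lambda>\<xi>. dv_dx P (X \<xi> s))"
        by (rule trajectory_vel[OF X x order_refl])
    qed
  qed simp
  have s2: "step2 P t \<tau> X X"
    unfolding step2_def Let_def
  proof (intro conjI lipschitz_field_subset[OF lip B] broad_transport_subset[OF transport B])
    show "\<forall>s\<in>{\<tau> 0..t}. gas_frac (X 0 s) = inflow_gas_frac P (pres (X 0 s))"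
    proof
      fix s assume "s \<in> {\<tau> 0..t}"
      then have s: "0 \<le> s" using tau0 by auto
      have "inflow P (pres (X 0 s)) (gas_frac (X 0 s)) (gas_vel (X 0 s))"
        using X s unfolding trajectory_def by blast
      then show "gas_frac (X 0 s) = inflow_gas_frac P (pres (X 0 s))"
        using inflow_gas_frac_eq[OF P X_pos(1)[of 0 s]] s L by simp
    qed
    show "\<forall>(x, s)\<in>region_B P t \<tau>.
        0 < pres (X x s) \<and> 0 < gas_vel (X x s) \<and>
        pres (X x s) = pres (X (the_inv_into {0..len P} \<tau> s) s)
          + integral {x..the_inv_into {0..len P} \<tau> s} (\<lambda>\<xi>. grav_term P (X \<xi> s) + fric_term P (X \<xi> s)) \<and>
        gas_vel (X x s) = gas_vel (X (the_inv_into {0..len P} \<tau> s) s)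
          - integral {x..the_inv_into {0..len P} \<tau> s} (\<lambda>\<xi>. dv_dx P (X \<xi> s))"
    proof (clarify, intro conjI)
      fix x s assume xs': "(x, s) \<in> region_B P t \<tau>"
      then have xs: "(x, s) \<in> {0..len P} \<times> {0..}" using B by blast
      let ?z = "the_inv_into {0..len P} \<tau> s"
      have "?z \<in> {x..len P}"
        by (rule region_B_inverse(1)[OF cl cont _ xs']) (use tau in auto)
      then have x: "0 \<le> s" "0 \<le> x" "x \<le> ?z" "?z \<le> len P" using xs by auto
      show "0 < pres (X x s)" "0 < gas_vel (X x s)" by (rule p[OF xs])+
      show "pres (X x s) = pres (X ?z s)
          + integral {x..?z} (\<lambda>\<xi>. grav_term P (X \<xi> s) + fric_term P (X \<xi> s))"
        by (rule trajectory_pres[OF X x])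
      show "gas_vel (X x s) = gas_vel (X ?z s) - integral {x..?z} (\<lambda>\<xi>. dv_dx P (X \<xi> s))"
        by (rule trajectory_vel[OF X x])
    qed
  qed simp
  show ?thesis unfolding observer_output_def using s1 s2 by blast
qed

text \<open>The region below the line is closed under moving towards the top, both horizontally and
  along characteristics of \<open>X1\<close>. All these paths end at the measurement, where the
  fields agree, so \<open>backward_stability\<close> applies with deviation 0.\<close>

lemma step1_unique:
  assumes s1: "step1 P (X (len P)) t H \<tau> X1" and xs: "(x, s) \<in> region_A P t H \<tau>"
  shows "X1 x s = X x s"
proof -
  have cl: "characteristic_line P X1 t \<tau>" and H: "admissible_horizon t \<tau> H"
    and lip1: "lipschitz_field (region_A P t H \<tau>) X1"
    and tr1: "broad_transport P (region_A P t H \<tau>) X1"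
    and top: "\<And>s. s \<in> {t - H..t} \<Longrightarrow> X1 (len P) s = X (len P) s"
    using s1 unfolding step1_def by blast+
  have eqs: "0 < pres (X1 x s)" "0 < gas_vel (X1 x s)"
    "pres (X1 x s) = pres (X1 (len P) s)
      + integral {x..len P} (\<lambda>\<xi>. grav_term P (X1 \<xi> s) + fric_term P (X1 \<xi> s))"
    "gas_vel (X1 x s) = gas_vel (X1 (len P) s) - integral {x..len P} (\<lambda>\<xi>. dv_dx P (X1 \<xi> s))"
    if "(x, s) \<in> region_A P t H \<tau>" for x s
    using s1 that unfolding step1_def by blast+
  have mono: "\<tau> x \<le> \<tau> y" if "x \<in> {0..len P}" "y \<in> {x..len P}" for x y
    using characteristic_line_mono[OF cl] that by auto
  have low: "t - H \<le> \<tau> x" if "x \<in> {0..len P}" for x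
    using mono[of 0 x] that H by (auto simp: admissible_horizon_def)
  have end_t: "\<tau> (len P) = t" using characteristic_line_end[OF cl] L by simp
  have A: "region_A P t H \<tau> \<subseteq> {0..len P} \<times> {0..}"
    using H by (auto simp: region_A_def admissible_horizon_def)
  have cont1: "continuous_on (region_A P t H \<tau>) (\<lambda>(x, t). X1 x t)"
    by (rule lipschitz_field_continuous_on[OF lip1])
  have graph: "(x, \<tau> x) \<in> region_A P t H \<tau>" if "x \<in> {0..len P}" for x
    using low[OF that] that by (simp add: region_A_def)
  have deriv: "(\<tau> has_real_derivative 1 / gas_vel (X1 x (\<tau> x))) (at x within {0..len P})"
    if "x \<in> {0..len P}" for x
    by (rule characteristic_line_derivative[OF cl cont1 graph that])
  have "compact (region_A P t H \<tau>)"
    unfolding region_A_def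
    by (rule compact_between_curves[OF continuous_on_const DERIV_continuous_on[OF deriv] low])
  moreover have "region_A P t H \<tau> \<noteq> {}" using xs by blast
  ultimately obtain q1 v1 R1 where q1: "0 < q1" "0 < v1"
    "\<And>x s. (x, s) \<in> region_A P t H \<tau> \<Longrightarrow> X1 x s \<in> state_box q1 v1 R1"
    using compact_in_state_box[OF _ _ cont1] eqs(1,2) by metis
  define q' v' R' where "q' = min q q1" and "v' = min v v1" and "R' = max R R1"
  have box': "0 < q'" "q' \<le> q" "0 < v'" "v' \<le> v" "R \<le> R'"
    using q1 qv by (auto simp: q'_def v'_def R'_def)
  have X1_box: "X1 x s \<in> state_box q' v' R'" if "(x, s) \<in> region_A P t H \<tau>" for x s
    by (rule state_box_mono[OF _ _ _ q1(3)[OF that]]) (auto simp: q'_def v'_def R'_def)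
  obtain C M where "reference_field P (state_box q' v' R') C M v' X"
    using reference[OF box'] .
  then interpret reference_field P "state_box q' v' R'" C M v' X .
  obtain M1 where M1: "0 \<le> M1" "\<And>x s t'. (x, s) \<in> region_A P t H \<tau> \<Longrightarrow> (x, t') \<in> region_A P t H \<tau> \<Longrightarrow>
      norm (X1 x s - X1 x t') \<le> M1 * \<bar>s - t'\<bar>"
    by (rule lipschitz_fieldE[OF lip1]) blast
  have "norm (X1 x s - X x s) \<le> 6 * 0 * exp (backward_rate * len P)"
  proof (rule backward_stability[OF A tr1 cont1 X1_box _ _ eqs(3,4) _ _ _ _ xs])
    fix x s assume xs: "(x, s) \<in> region_A P t H \<tau>"
    then have x: "0 \<le> s" "0 \<le> x" "x \<le> len P" using A by auto
    have s: "t - H \<le> s" "s \<le> \<tau> x" using xs by (auto simp: region_A_def)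
    show "(y, s) \<in> region_A P t H \<tau>" if "y \<in> {x..len P}" for y
      using mono[of x y] that x s by (auto simp: region_A_def)
    show "pres (X x s) = pres (X (len P) s)
        + integral {x..len P} (\<lambda>\<xi>. grav_term P (X \<xi> s) + fric_term P (X \<xi> s))"
      by (rule trajectory_pres[OF X x order_refl])
    show "gas_vel (X x s) = gas_vel (X (len P) s) - integral {x..len P} (\<lambda>\<xi>. dv_dx P (X \<xi> s))"
      by (rule trajectory_vel[OF X x order_refl])
    have "X x s \<in> state_box q' v' R'" using X_B x by auto
    then show "norm (X1 x s - X x s) \<le> 4 * R'"
      using state_box_diff_bound[OF X1_box[OF xs]] box' by simp
    have sub: "{(y, r). y \<in> {x..len P} \<and> s \<le> r \<and> r \<le> \<tau> y} \<subseteq> region_A P t H \<tau>"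
      using x s by (auto simp: region_A_def)
    \<comment> \<open>The horizontal line is the lower barrier; the upper one is \<tau>, a
      characteristic of \<open>X1\<close> itself.\<close>
    have "\<exists>\<sigma>. \<sigma> x = s \<and> (\<forall>y\<in>{x..len P}. \<sigma> y \<in> {s..\<tau> y} \<and>
        (\<sigma> has_real_derivative 1 / gas_vel (X1 y (\<sigma> y))) (at y within {x..len P}))"
    proof (rule forward_characteristic_between[OF sources vmin B_vel cont1 X1_box M1 sub x(3),
          where lo' = "\<lambda>_. 0" and hi' = "\<lambda>y. 1 / gas_vel (X1 y (\<tau> y))"])
      fix y assume y: "y \<in> {x..len P}"
      then have yL: "y \<in> {0..len P}" using x by auto
      show sy: "s \<le> \<tau> y" using mono[of x y] y x s by auto
      show "(\<tau> has_real_derivative 1 / gas_vel (X1 y (\<tau> y))) (at y within {x..len P})"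
        by (rule DERIV_subset[OF deriv[OF yL]]) (use x in auto)
      have "(y, s) \<in> region_A P t H \<tau>" using sy s yL by (simp add: region_A_def)
      from eqs(2)[OF this] show "0 \<le> 1 / gas_vel (X1 y s)" by simp
    qed (use s in auto)
    then obtain \<sigma> where sg: "\<sigma> x = s" "\<And>y. y \<in> {x..len P} \<Longrightarrow> \<sigma> y \<in> {s..\<tau> y}"
      "\<And>y. y \<in> {x..len P} \<Longrightarrow> (\<sigma> has_real_derivative 1 / gas_vel (X1 y (\<sigma> y))) (at y within {x..len P})"
      by blast
    show "\<exists>\<sigma>. \<sigma> x = s \<and> (\<forall>y\<in>{x..len P}. (y, \<sigma> y) \<in> region_A P t H \<tau> \<and>
        (\<sigma> has_real_derivative 1 / gas_vel (X1 y (\<sigma> y))) (at y within {x..len P}))"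
    proof (intro exI[of _ \<sigma>] conjI ballI sg(1,3))
      fix y assume y: "y \<in> {x..len P}"
      show "(y, \<sigma> y) \<in> region_A P t H \<tau>"
        using sg(2)[OF y] sub y by auto
    qed
  next
    fix s assume "(len P, s) \<in> region_A P t H \<tau>"
    then have "s \<in> {t - H..t}" by (auto simp: region_A_def end_t)
    then show "norm (X1 (len P) s - X (len P) s) \<le> 0" by (simp add: top)
  qed
  then show ?thesis by simp
qed

text \<open>Above the line, horizontal paths to the right end on \<tau>, where step 1 has already
  given the actual values. Characteristics followed back end at the bottom, where the inflow
  relation ties the gas fraction to the pressure.\<close>

lemma step2_unique:
  assumes s1: "step1 P (X (len P)) t H \<tau> X1" and s2: "step2 P t \<tau> X1 X2"
    and xs: "(x, s) \<in> region_B P t \<tau>"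
  shows "X2 x s = X x s"
proof -
  have cl1: "characteristic_line P X1 t \<tau>" and H: "admissible_horizon t \<tau> H"
    using s1 unfolding step1_def by blast+
  have lip2: "lipschitz_field (region_B P t \<tau>) X2"
    and tr2: "broad_transport P (region_B P t \<tau>) X2"
    and line1: "\<And>x. x \<in> {0..len P} \<Longrightarrow> X2 x (\<tau> x) = X1 x (\<tau> x)"
    and inflow2: "\<And>s. s \<in> {\<tau> 0..t} \<Longrightarrow> gas_frac (X2 0 s) = inflow_gas_frac P (pres (X2 0 s))"
    using s2 unfolding step2_def by blast+
  define z where "z s = the_inv_into {0..len P} \<tau> s" for s
  have eqs: "0 < pres (X2 x s)" "0 < gas_vel (X2 x s)"
    "pres (X2 x s) = pres (X2 (z s) s)
      + integral {x..z s} (\<lambda>\<xi>. grav_term P (X2 \<xi> s) + fric_term P (X2 \<xi> s))"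
    "gas_vel (X2 x s) = gas_vel (X2 (z s) s) - integral {x..z s} (\<lambda>\<xi>. dv_dx P (X2 \<xi> s))"
    if "(x, s) \<in> region_B P t \<tau>" for x s
    using s2 that unfolding step2_def Let_def z_def by blast+
  have mono: "\<tau> x \<le> \<tau> y" if "x \<in> {0..len P}" "y \<in> {x..len P}" for x y
    using characteristic_line_mono[OF cl1] that by auto
  have low: "t - H \<le> \<tau> x" "0 \<le> \<tau> x" if "x \<in> {0..len P}" for x
    using mono[of 0 x] that H by (auto simp: admissible_horizon_def)
  have end_t: "\<tau> (len P) = t" using characteristic_line_end[OF cl1] L by simp
  have up: "\<tau> x \<le> t" if "x \<in> {0..len P}" for x
    using mono[OF that, of "len P"] that end_t by auto
  have line: "X2 x (\<tau> x) = X x (\<tau> x)" if "x \<in> {0..len P}" for x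
    using line1[OF that] step1_unique[OF s1, of x "\<tau> x"] low[OF that] that
    by (simp add: region_A_def)
  have graph: "(x, \<tau> x) \<in> region_B P t \<tau>" if "x \<in> {0..len P}" for x
    using up[OF that] that by (simp add: region_B_def)
  have graph0: "(x, \<tau> x) \<in> {0..len P} \<times> {0..}" if "x \<in> {0..len P}" for x
    using low[OF that] that by simp
  have cont2: "continuous_on (region_B P t \<tau>) (\<lambda>(x, t). X2 x t)"
    by (rule lipschitz_field_continuous_on[OF lip2])
  have B: "region_B P t \<tau> \<subseteq> {0..len P} \<times> {0..}"
    using low by (fastforce simp: region_B_def)
  \<comment> \<open>The line was computed with \<open>X1\<close>, but \<open>X1\<close> equals the
    trajectory on it, so it is also the actual characteristic and the regularity of \<open>X\<close>
    can be used along it.\<close>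
  have cl: "characteristic_line P X t \<tau>"
  proof -
    have e: "X \<xi> (\<tau> \<xi>) = X1 \<xi> (\<tau> \<xi>)" if "\<xi> \<in> {0..len P}" for \<xi>
      using line[OF that] line1[OF that] by simp
    show ?thesis
      unfolding characteristic_line_def
    proof (intro ballI conjI)
      fix x assume x: "x \<in> {0..len P}"
      show "0 < gas_vel (X x (\<tau> x))" by (rule X_pos[OF x low(2)[OF x]])
      have "((\<lambda>\<xi>. 1 / gas_vel (X1 \<xi> (\<tau> \<xi>))) has_integral (t - \<tau> x)) {x..len P}"
        using cl1 x unfolding characteristic_line_def by blast
      then show "((\<lambda>\<xi>. 1 / gas_vel (X \<xi> (\<tau> \<xi>))) has_integral (t - \<tau> x)) {x..len P}"
        by (rule has_integral_eq[rotated]) (use e x in auto)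
    qed
  qed
  have deriv: "(\<tau> has_real_derivative 1 / gas_vel (X2 x (\<tau> x))) (at x within {0..len P})"
    if "x \<in> {0..len P}" for x
    using characteristic_line_derivative[OF cl cont graph0 that] by (simp add: line[OF that])
  have "compact (region_B P t \<tau>)"
    unfolding region_B_def
    by (rule compact_between_curves[OF DERIV_continuous_on[OF deriv] continuous_on_const up])
  moreover have "region_B P t \<tau> \<noteq> {}" using xs by blast
  ultimately obtain q2 v2 R2 where q2: "0 < q2" "0 < v2"
    "\<And>x s. (x, s) \<in> region_B P t \<tau> \<Longrightarrow> X2 x s \<in> state_box q2 v2 R2"
    using compact_in_state_box[OF _ _ cont2] eqs(1,2) by metis
  define q' v' R' where "q' = min q q2" and "v' = min v v2" and "R' = max R R2"
  have box': "0 < q'" "q' \<le> q" "0 < v'" "v' \<le> v" "R \<le> R'"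
    using q2 qv by (auto simp: q'_def v'_def R'_def)
  have X2_box: "X2 x s \<in> state_box q' v' R'" if "(x, s) \<in> region_B P t \<tau>" for x s
    by (rule state_box_mono[OF _ _ _ q2(3)[OF that]]) (auto simp: q'_def v'_def R'_def)
  obtain C M where "reference_field P (state_box q' v' R') C M v' X"
    using reference[OF box'] .
  then interpret reference_field P "state_box q' v' R'" C M v' X .
  obtain M2 where M2: "0 \<le> M2" "\<And>x s t'. (x, s) \<in> region_B P t \<tau> \<Longrightarrow> (x, t') \<in> region_B P t \<tau> \<Longrightarrow>
      norm (X2 x s - X2 x t') \<le> M2 * \<bar>s - t'\<bar>"
    by (rule lipschitz_fieldE[OF lip2]) blast
  obtain E where E: "0 \<le> E" "\<And>p p'. p \<in> {q'..R'} \<Longrightarrow> p' \<in> {q'..R'} \<Longrightarrow>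
      \<bar>inflow_gas_frac P p - inflow_gas_frac P p'\<bar> \<le> E * \<bar>p - p'\<bar>"
    using inflow_gas_frac_lipschitz[OF P box'(1)] by blast
  show ?thesis
  proof (rule forward_uniqueness[OF B tr2 cont2 X2_box, where R = R' and E = E and b = "4 * R'"])
    show "(x, s) \<in> region_B P t \<tau>" "0 \<le> E" by (fact xs E)+
    show "gas_vel u \<le> R'" if "u \<in> state_box q' v' R'" for u
      using that by (simp add: state_box_def)
  next
    fix s assume "(0, s) \<in> region_B P t \<tau>"
    then have s: "s \<in> {\<tau> 0..t}" "0 \<le> s" "X2 0 s \<in> state_box q' v' R'"
      using B X2_box by (auto simp: region_B_def)
    have X0: "X 0 s \<in> state_box q' v' R'" using X_B[of 0 s] s L by simp
    have "inflow P (pres (X 0 s)) (gas_frac (X 0 s)) (gas_vel (X 0 s))"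
      using X s(2) unfolding trajectory_def by blast
    then have a: "gas_frac (X 0 s) = inflow_gas_frac P (pres (X 0 s))"
      using inflow_gas_frac_eq[OF P X_pos(1)[of 0 s]] s L by simp
    show "\<bar>gas_frac (X2 0 s) - gas_frac (X 0 s)\<bar> \<le> E * \<bar>pres (X2 0 s) - pres (X 0 s)\<bar>"
      unfolding a inflow2[OF s(1)] by (rule E(2)) (use s(3) X0 in \<open>auto simp: state_box_def\<close>)
  next
    fix x s assume xs: "(x, s) \<in> region_B P t \<tau>"
    then have x: "0 \<le> s" "0 \<le> x" "x \<le> len P" using B by auto
    have s: "\<tau> x \<le> s" "s \<le> t" using xs by (auto simp: region_B_def)
    have "X x s \<in> state_box q' v' R'" using X_B x by auto
    then show "norm (X2 x s - X x s) \<le> 4 * R'"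
      using state_box_diff_bound[OF X2_box[OF xs]] box' by simp
    have z: "z s \<in> {x..len P}" "\<tau> (z s) = s"
      using region_B_inverse[OF cl cont graph0 xs] by (simp_all add: z_def)
    have zs: "x \<le> z s" "z s \<le> len P" using z by auto
    show "\<exists>z\<in>{x..len P}. (\<forall>y\<in>{x..z}. (y, s) \<in> region_B P t \<tau>) \<and> X2 z s = X z s \<and>
        pres (X2 x s) = pres (X2 z s) + integral {x..z} (\<lambda>\<xi>. grav_term P (X2 \<xi> s) + fric_term P (X2 \<xi> s)) \<and>
        pres (X x s) = pres (X z s) + integral {x..z} (\<lambda>\<xi>. grav_term P (X \<xi> s) + fric_term P (X \<xi> s)) \<and>
        gas_vel (X2 x s) = gas_vel (X2 z s) - integral {x..z} (\<lambda>\<xi>. dv_dx P (X2 \<xi> s)) \<and>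
        gas_vel (X x s) = gas_vel (X z s) - integral {x..z} (\<lambda>\<xi>. dv_dx P (X \<xi> s))"
    proof (intro bexI[of _ "z s"] conjI eqs(3,4) xs z(1)
        trajectory_pres[OF X x(1,2) zs] trajectory_vel[OF X x(1,2) zs] ballI)
      show "X2 (z s) s = X (z s) s" using line[of "z s"] z x by auto
      fix y assume y: "y \<in> {x..z s}"
      have "\<tau> y \<le> \<tau> (z s)" using mono[of y "z s"] y x zs by auto
      then show "(y, s) \<in> region_B P t \<tau>" using y x s zs z(2) by (auto simp: region_B_def)
    qed
    have sub: "{(y, r). y \<in> {0..x} \<and> \<tau> y \<le> r \<and> r \<le> s} \<subseteq> region_B P t \<tau>"
      using x s by (auto simp: region_B_def)
    \<comment> \<open>Followed backwards, the characteristic stays above \<tau>, which is a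
      characteristic of \<open>X2\<close> too, and below the horizontal line at
      \<open>s\<close>.\<close>
    have "\<exists>\<sigma>. \<sigma> x = s \<and> (\<forall>y\<in>{0..x}. \<sigma> y \<in> {\<tau> y..s} \<and>
        (\<sigma> has_real_derivative 1 / gas_vel (X2 y (\<sigma> y))) (at y within {0..x}))"
    proof (rule backward_characteristic_between[OF sources vmin B_vel cont2 X2_box M2 sub x(2),
          where hi' = "\<lambda>_. 0" and lo' = "\<lambda>y. 1 / gas_vel (X2 y (\<tau> y))"])
      fix y assume y: "y \<in> {0..x}"
      then have yL: "y \<in> {0..len P}" using x by auto
      show sy: "\<tau> y \<le> s" using mono[of y x] y x s by auto
      show "(\<tau> has_real_derivative 1 / gas_vel (X2 y (\<tau> y))) (at y within {0..x})"
        by (rule DERIV_subset[OF deriv[OF yL]]) (use x in auto)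
      have "(y, s) \<in> region_B P t \<tau>" using sy s yL by (simp add: region_B_def)
      from eqs(2)[OF this] show "0 \<le> 1 / gas_vel (X2 y s)" by simp
    qed (use s in auto)
    then obtain \<sigma> where sg: "\<sigma> x = s" "\<And>y. y \<in> {0..x} \<Longrightarrow> \<sigma> y \<in> {\<tau> y..s}"
      "\<And>y. y \<in> {0..x} \<Longrightarrow> (\<sigma> has_real_derivative 1 / gas_vel (X2 y (\<sigma> y))) (at y within {0..x})"
      by blast
    show "\<exists>\<sigma>. \<sigma> x = s \<and> (\<forall>y\<in>{0..x}. (y, \<sigma> y) \<in> region_B P t \<tau> \<and>
        (\<sigma> has_real_derivative 1 / gas_vel (X2 y (\<sigma> y))) (at y within {0..x}))"
    proof (intro exI[of _ \<sigma>] conjI ballI sg(1,3))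
      fix y assume y: "y \<in> {0..x}"
      show "(y, \<sigma> y) \<in> region_B P t \<tau>"
        using sg(2)[OF y] sub y by auto
    qed
  qed
qed

lemma observer_exact:
  assumes t: "len P / v \<le> t"
  shows "observer_exact P X t"
  unfolding observer_exact_def
proof (intro conjI allI impI ballI)
  have "0 \<le> t" using t L qv order_trans[of 0 "len P / v" t] by simp
  obtain \<tau> where "characteristic_line P X t \<tau>" "0 \<le> \<tau> 0"
    using characteristic_line_exists[OF t] by blast
  \<comment> \<open>The longest admissible horizon is \<open>H = t\<close>, the record since time
    0.\<close>
  then show "\<exists>\<tau> H. characteristic_line P X t \<tau> \<and> admissible_horizon t \<tau> H"
    by (intro exI[of _ \<tau>] exI[of _ t]) (simp add: admissible_horizon_def)
  show "\<exists>Xhat. observer_output P (X (len P)) t H Xhat"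
    if "characteristic_line P X t \<tau> \<and> admissible_horizon t \<tau> H" for \<tau> H
    using observer_output_actual that by blast
  fix H Xhat x assume o: "observer_output P (X (len P)) t H Xhat" and x: "x \<in> {0..len P}"
  obtain \<tau> X1 X2 where s: "step1 P (X (len P)) t H \<tau> X1" "step2 P t \<tau> X1 X2" "Xhat x = X2 x t"
    using o x unfolding observer_output_def by blast
  have cl: "characteristic_line P X1 t \<tau>" using s(1) unfolding step1_def by blast
  \<comment> \<open>The estimated profile is the upper edge of region B.\<close>
  have "\<tau> x \<le> \<tau> (len P)" using characteristic_line_mono[OF cl] x by auto
  then have "(x, t) \<in> region_B P t \<tau>"
    using x characteristic_line_end[OF cl] L by (simp add: region_B_def)
  from step2_unique[OF s(1,2) this] show "Xhat x = X x t" using s(3) by simp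
qed

end

theorem theorem4:
  fixes P :: well and p0 :: "real \<Rightarrow> real"
  assumes "positive_parameters P"
    and "steady_pressure P p0"
    and "\<forall>x\<in>{0..len P}. 0 < p0 x"
  shows "\<exists>(K::nat) (\<delta>\<^sub>3::real) (\<delta>\<^sub>3'::real). 0 < \<delta>\<^sub>3 \<and> 0 < \<delta>\<^sub>3' \<and>
    (\<forall>(ptop :: real \<Rightarrow> real) (X :: real \<Rightarrow> real \<Rightarrow> state).
       trajectory P ptop X \<longrightarrow>
       (\<exists>M. M-lipschitz_on {0..} (X (len P))) \<longrightarrow>
       (\<forall>t\<ge>0. norm (deviation P p0 X (len P) t) \<le> \<delta>\<^sub>3) \<longrightarrow>
       (AE t in lebesgue. 0 < t \<longrightarrow>
          (\<exists>D. (deviation P p0 X (len P) has_vector_derivative D) (at t) \<and> norm D \<le> \<delta>\<^sub>3')) \<longrightarrow>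
       (\<forall>k\<ge>K. observer_exact P X (real k * period P)))"
proof -
  obtain \<delta> q v R where d: "0 < \<delta>" "0 < q" "0 < v" "q \<le> R" "v \<le> R"
    and near: "\<forall>ptop X. trajectory P ptop X \<longrightarrow> (\<forall>t\<ge>0. norm (deviation P p0 X (len P) t) \<le> \<delta>) \<longrightarrow>
      (\<forall>x\<in>{0..len P}. \<forall>t\<ge>0. X x t \<in> state_box q v R)"
    using trajectory_near_steady_state[OF assms] by (elim exE conjE)
  have \<theta>: "0 < period P" using assms(1) by (simp add: positive_parameters_def)
  \<comment> \<open>Velocities are at least \<open>v\<close>, so \<open>len P / v\<close> bounds the
    crossing time; from the sampling instant \<open>K\<close> on, the characteristic ending at the
    top starts at a nonnegative time.\<close>
  obtain K :: nat where K: "len P / v / period P \<le> real K" using real_arch_simple by blast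
  have exact: "observer_exact P X (real k * period P)"
    if "trajectory P ptop X" "\<forall>t\<ge>0. norm (deviation P p0 X (len P) t) \<le> \<delta>" "K \<le> k" for ptop X k
  proof -
    interpret confined_trajectory P ptop X q v R
    proof
      fix x t :: real assume "x \<in> {0..len P}" "0 \<le> t"
      then show "X x t \<in> state_box q v R" using near[rule_format, OF that(1)] that(2) by simp
    qed (fact assms(1) that(1) d)+
    have "len P / v \<le> real K * period P" using K \<theta> by (simp only: pos_divide_le_eq)
    also have "\<dots> \<le> real k * period P" using that(3) \<theta> by (intro mult_right_mono) auto
    finally show ?thesis by (rule observer_exact)
  qed
  show ?thesis
  proof (rule exI[of _ K], rule exI[of _ \<delta>], rule exI[of _ 1], intro conjI allI impI)
    show "0 < \<delta>" by (rule d(1))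
    fix ptop X k
    assume "trajectory P ptop X" "\<forall>t\<ge>0. norm (deviation P p0 X (len P) t) \<le> \<delta>" "K \<le> k"
    then show "observer_exact P X (real k * period P)" by (rule exact)
  qed simp
qed

end
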